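(* Let $X$ be a compact metric space. Then $\mathrm{Dur}(M_n(C(X)))=1$ for every integer $n\ge 1$.
   Context: For a unital $C^*$-algebra $B$, $U_0(B)$ is the connected component of the identity in the unitary group $U(B)$ (norm topology), and $CU(B)$ is the norm closure of the commutator subgroup of $U_0(B)$. For integers $n\ge m\ge1$ let $i_B^{(m,n)}\colon U_0(M_m(B))/CU(M_m(B))\to U_0(M_n(B))/CU(M_n(B))$ be the homomorphism induced by $u\mapsto\mathrm{diag}(u,1_{n-m})$. The determinant rank of $B$ is $\mathrm{Dur}(B)=\min\{m\in\mathbb N : i_B^{(m,n)}\text{ is an isomorphism for all } n>m\}$ (with $m\ge1$), and $\mathrm{Dur}(B)=\infty$ if no such $m$ exists. *)

theory Defs
  imports
    "HOL-Analysis.Abstract_Metric_Spaces"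
    "HOL-Algebra.Generated_Groups"
    "HOL-Library.Extended_Nat"
    "Jordan_Normal_Form.Matrix"
begin

section \<open>Unital C*-algebras\<close>

record 'a cstar = "(complex, 'a) module" +
  star :: "'a \<Rightarrow> 'a"
  nrm :: "'a \<Rightarrow> real"

text \<open>
  Truncated off the carrier because \<open>Metric_space\<close> requires non-negativity and symmetry everywhere.
\<close>

definition nrm_dist :: "'a cstar \<Rightarrow> 'a \<Rightarrow> 'a \<Rightarrow> real" where
  "nrm_dist A x y = (if x \<in> carrier A \<and> y \<in> carrier A then nrm A (x \<ominus>\<^bsub>A\<^esub> y) else 0)"

definition norm_topology :: "'a cstar \<Rightarrow> 'a topology" where
  "norm_topology A = Metric_space.mtopology (carrier A) (nrm_dist A)"

text \<open>
  The zero algebra is admitted: it is the algebra of functions on the empty space.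
\<close>

locale unital_cstar_algebra = ring A for A :: "'a cstar" (structure) +
  assumes smult_closed: "x \<in> carrier A \<Longrightarrow> c \<odot> x \<in> carrier A"
    and smult_l_distr: "x \<in> carrier A \<Longrightarrow> (c + d) \<odot> x = c \<odot> x \<oplus> d \<odot> x"
    and smult_r_distr: "\<lbrakk>x \<in> carrier A; y \<in> carrier A\<rbrakk> \<Longrightarrow> c \<odot> (x \<oplus> y) = c \<odot> x \<oplus> c \<odot> y"
    and smult_assoc: "x \<in> carrier A \<Longrightarrow> (c * d) \<odot> x = c \<odot> (d \<odot> x)"
    and smult_one: "x \<in> carrier A \<Longrightarrow> 1 \<odot> x = x"
    and smult_mult_left: "\<lbrakk>x \<in> carrier A; y \<in> carrier A\<rbrakk> \<Longrightarrow> (c \<odot> x) \<otimes> y = c \<odot> (x \<otimes> y)"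
    and smult_mult_right: "\<lbrakk>x \<in> carrier A; y \<in> carrier A\<rbrakk> \<Longrightarrow> x \<otimes> (c \<odot> y) = c \<odot> (x \<otimes> y)"
    and star_closed: "x \<in> carrier A \<Longrightarrow> star A x \<in> carrier A"
    and star_star: "x \<in> carrier A \<Longrightarrow> star A (star A x) = x"
    and star_add: "\<lbrakk>x \<in> carrier A; y \<in> carrier A\<rbrakk> \<Longrightarrow> star A (x \<oplus> y) = star A x \<oplus> star A y"
    and star_smult: "x \<in> carrier A \<Longrightarrow> star A (c \<odot> x) = cnj c \<odot> star A x"
    and star_mult: "\<lbrakk>x \<in> carrier A; y \<in> carrier A\<rbrakk> \<Longrightarrow> star A (x \<otimes> y) = star A y \<otimes> star A x"
    and nrm_nonneg: "x \<in> carrier A \<Longrightarrow> 0 \<le> nrm A x"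
    and nrm_eq_zero: "x \<in> carrier A \<Longrightarrow> nrm A x = 0 \<longleftrightarrow> x = \<zero>"
    and nrm_triangle: "\<lbrakk>x \<in> carrier A; y \<in> carrier A\<rbrakk> \<Longrightarrow> nrm A (x \<oplus> y) \<le> nrm A x + nrm A y"
    and nrm_smult: "x \<in> carrier A \<Longrightarrow> nrm A (c \<odot> x) = cmod c * nrm A x"
    and nrm_mult: "\<lbrakk>x \<in> carrier A; y \<in> carrier A\<rbrakk> \<Longrightarrow> nrm A (x \<otimes> y) \<le> nrm A x * nrm A y"
    and cstar_identity: "x \<in> carrier A \<Longrightarrow> nrm A (star A x \<otimes> x) = (nrm A x)\<^sup>2"
    and nrm_complete: "Metric_space.mcomplete (carrier A) (nrm_dist A)"

section \<open>Continuous functions and matrix algebras\<close>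

text \<open>
  Continuous functions are represented extensionally, so that equality of elements is
  equality on the space. The 0 inserted into the supremum only matters for the empty space.
\<close>

definition cont_alg :: "'x topology \<Rightarrow> ('x \<Rightarrow> complex) cstar" where
  "cont_alg X =
    \<lparr>carrier = {f \<in> extensional (topspace X). continuous_map X euclidean f},
     monoid.mult = (\<lambda>f g. \<lambda>x\<in>topspace X. f x * g x),
     one = (\<lambda>x\<in>topspace X. 1),
     zero = (\<lambda>x\<in>topspace X. 0),
     add = (\<lambda>f g. \<lambda>x\<in>topspace X. f x + g x),
     module.smult = (\<lambda>c f. \<lambda>x\<in>topspace X. c * f x),
     star = (\<lambda>f. \<lambda>x\<in>topspace X. cnj (f x)),
     nrm = (\<lambda>f. Sup (insert 0 ((\<lambda>x. cmod (f x)) ` topspace X)))\<rparr>"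

lemma cont_alg_simps:
  "carrier (cont_alg X) = {f \<in> extensional (topspace X). continuous_map X euclidean f}"
  "f \<otimes>\<^bsub>cont_alg X\<^esub> g = (\<lambda>x\<in>topspace X. f x * g x)"
  "\<one>\<^bsub>cont_alg X\<^esub> = (\<lambda>x\<in>topspace X. 1)"
  "\<zero>\<^bsub>cont_alg X\<^esub> = (\<lambda>x\<in>topspace X. 0)"
  "f \<oplus>\<^bsub>cont_alg X\<^esub> g = (\<lambda>x\<in>topspace X. f x + g x)"
  "c \<odot>\<^bsub>cont_alg X\<^esub> f = (\<lambda>x\<in>topspace X. c * f x)"
  "star (cont_alg X) f = (\<lambda>x\<in>topspace X. cnj (f x))"
  "nrm (cont_alg X) f = Sup (insert 0 ((\<lambda>x. cmod (f x)) ` topspace X))"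
  by (simp_all add: cont_alg_def)

lemma continuous_map_restrict_topspace:
  "continuous_map X euclidean (restrict f (topspace X)) \<longleftrightarrow> continuous_map X euclidean f"
  by (metis continuous_map_eq restrict_apply')

lemma continuous_map_cnj: "continuous_map X euclidean f \<Longrightarrow> continuous_map X euclidean (\<lambda>x. cnj (f x))"
  using continuous_map_compose[of X euclidean f euclidean cnj] continuous_on_cnj[of UNIV id]
  by (auto simp: o_def)

lemma continuous_map_complex_mult: "\<lbrakk>continuous_map X euclidean f; continuous_map X euclidean g\<rbrakk> \<Longrightarrow> continuous_map X euclidean (\<lambda>x. f x * g x :: complex)"
  unfolding continuous_map_atin by (auto intro: tendsto_mult)

lemma ring_cont_alg: "ring (cont_alg X)"
proof (rule ringI)
  show "abelian_group (cont_alg X)"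
  proof (rule abelian_groupI)
    fix f assume f: "f \<in> carrier (cont_alg X)"
    have "(\<lambda>x\<in>topspace X. - f x) \<in> carrier (cont_alg X)"
      using f by (auto simp: cont_alg_simps continuous_map_restrict_topspace intro!: continuous_map_minus)
    moreover have "(\<lambda>x\<in>topspace X. - f x) \<oplus>\<^bsub>cont_alg X\<^esub> f = \<zero>\<^bsub>cont_alg X\<^esub>"
      by (auto simp: cont_alg_simps fun_eq_iff)
    ultimately show "\<exists>y\<in>carrier (cont_alg X). y \<oplus>\<^bsub>cont_alg X\<^esub> f = \<zero>\<^bsub>cont_alg X\<^esub>" by blast
  qed (auto simp: cont_alg_simps continuous_map_restrict_topspace fun_eq_iff extensional_def algebra_simps intro!: continuous_map_add)
  show "monoid (cont_alg X)"
    by (rule monoidI) (auto simp: cont_alg_simps continuous_map_restrict_topspace fun_eq_iff extensional_def intro!: continuous_map_complex_mult)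
qed (auto simp: cont_alg_simps fun_eq_iff algebra_simps)

lemma cont_alg_minus:
  assumes "f \<in> carrier (cont_alg X)" "g \<in> carrier (cont_alg X)"
  shows "f \<ominus>\<^bsub>cont_alg X\<^esub> g = (\<lambda>x\<in>topspace X. f x - g x)"
proof -
  interpret R: ring "cont_alg X" by (rule ring_cont_alg)
  have h: "(\<lambda>x\<in>topspace X. - g x) \<in> carrier (cont_alg X)"
      using assms by (auto simp: cont_alg_simps continuous_map_restrict_topspace intro!: continuous_map_minus)
  have "(\<lambda>x\<in>topspace X. - g x) \<oplus>\<^bsub>cont_alg X\<^esub> g = \<zero>\<^bsub>cont_alg X\<^esub>"
    by (auto simp: cont_alg_simps fun_eq_iff)
  then have "\<ominus>\<^bsub>cont_alg X\<^esub> g = (\<lambda>x\<in>topspace X. - g x)"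
    using h assms by (intro R.minus_equality) auto
  then show ?thesis
    by (auto simp: R.minus_eq cont_alg_simps fun_eq_iff)
qed

lemma bdd_above_cont_alg:
  assumes "compact_space X" "f \<in> carrier (cont_alg X)"
  shows "bdd_above (insert 0 ((\<lambda>x. cmod (f x)) ` topspace X))"
proof -
  have "compactin euclidean (f ` topspace X)"
    using assms by (intro image_compactin[of X]) (auto simp: cont_alg_simps compact_space_def)
  then have "bounded (f ` topspace X)" by (simp add: compact_imp_bounded)
  then show ?thesis unfolding bounded_iff by (auto simp: bdd_above_def) (metis (no_types) linorder_le_cases order_trans)
qed

lemma nrm_cont_alg_le_iff:
  assumes "compact_space X" "f \<in> carrier (cont_alg X)"
  shows "nrm (cont_alg X) f \<le> r \<longleftrightarrow> 0 \<le> r \<and> (\<forall>x\<in>topspace X. cmod (f x) \<le> r)"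
  using bdd_above_cont_alg[OF assms] by (subst cont_alg_simps, subst cSup_le_iff) auto

lemma cont_alg_le_nrm:
  assumes "compact_space X" "f \<in> carrier (cont_alg X)" "x \<in> topspace X"
  shows "cmod (f x) \<le> nrm (cont_alg X) f"
  using nrm_cont_alg_le_iff[OF assms(1,2), of "nrm (cont_alg X) f"] assms(3) by auto

lemma nrm_cont_alg_nonneg:
  assumes "compact_space X" "f \<in> carrier (cont_alg X)"
  shows "0 \<le> nrm (cont_alg X) f"
  using nrm_cont_alg_le_iff[OF assms, of "nrm (cont_alg X) f"] by auto

lemma unital_cstar_algebra_cont_alg:
  assumes X: "compact_space X"
  shows "unital_cstar_algebra (cont_alg X)"
proof -
  interpret R: ring "cont_alg X" by (rule ring_cont_alg)
  note le = nrm_cont_alg_le_iff[OF X] and ge = cont_alg_le_nrm[OF X] and nn = nrm_cont_alg_nonneg[OF X]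
  note cl = R.m_closed R.a_closed
  have sm: "c \<odot>\<^bsub>cont_alg X\<^esub> f \<in> carrier (cont_alg X)" if "f \<in> carrier (cont_alg X)" for c f
    using that by (auto simp: cont_alg_simps continuous_map_restrict_topspace intro!: continuous_map_complex_mult)
  have st: "star (cont_alg X) f \<in> carrier (cont_alg X)" if "f \<in> carrier (cont_alg X)" for f
    using that by (auto simp: cont_alg_simps continuous_map_restrict_topspace intro!: continuous_map_cnj)
  have z: "nrm (cont_alg X) x = 0 \<longleftrightarrow> x = \<zero>\<^bsub>cont_alg X\<^esub>" if "x \<in> carrier (cont_alg X)" for x
    using le[OF that, of 0] nn[OF that] that by (auto simp: cont_alg_simps(1,4) fun_eq_iff extensional_def)
  have tri: "nrm (cont_alg X) (x \<oplus>\<^bsub>cont_alg X\<^esub> y) \<le> nrm (cont_alg X) x + nrm (cont_alg X) y"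
    if "x \<in> carrier (cont_alg X)" "y \<in> carrier (cont_alg X)" for x y
    using that by (subst le[OF R.a_closed])
      (auto simp: nn cont_alg_simps(5) intro!: add_mono ge norm_triangle_le)
  have sml: "nrm (cont_alg X) (c \<odot>\<^bsub>cont_alg X\<^esub> x) \<le> cmod c * nrm (cont_alg X) x"
    if "x \<in> carrier (cont_alg X)" for c x
    using that by (subst le[OF sm]) (auto simp: nn sm cont_alg_simps(6) norm_mult intro!: mult_left_mono ge)
  have sme: "nrm (cont_alg X) (c \<odot>\<^bsub>cont_alg X\<^esub> x) = cmod c * nrm (cont_alg X) x"
    if x: "x \<in> carrier (cont_alg X)" for c x
  proof (cases "c = 0")
    case True
    then show ?thesis using sml[OF x, of c] nn[OF sm[OF x], of c] by simp
  next
    case False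
    have "x = inverse c \<odot>\<^bsub>cont_alg X\<^esub> (c \<odot>\<^bsub>cont_alg X\<^esub> x)"
      using False x by (auto simp: cont_alg_simps fun_eq_iff extensional_def)
    then have "nrm (cont_alg X) x \<le> cmod (inverse c) * nrm (cont_alg X) (c \<odot>\<^bsub>cont_alg X\<^esub> x)"
      using sml[OF sm[OF x], of "inverse c" c] by simp
    then have "cmod c * nrm (cont_alg X) x \<le> nrm (cont_alg X) (c \<odot>\<^bsub>cont_alg X\<^esub> x)"
      using False by (simp add: norm_divide field_simps)
    then show ?thesis using sml[OF x, of c] by simp
  qed
  have mul: "nrm (cont_alg X) (x \<otimes>\<^bsub>cont_alg X\<^esub> y) \<le> nrm (cont_alg X) x * nrm (cont_alg X) y"
    if "x \<in> carrier (cont_alg X)" "y \<in> carrier (cont_alg X)" for x y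
    using that by (subst le[OF R.m_closed]) (auto simp: nn cont_alg_simps(2) norm_mult intro!: mult_mono ge)
  have cs: "nrm (cont_alg X) (star (cont_alg X) x \<otimes>\<^bsub>cont_alg X\<^esub> x) = (nrm (cont_alg X) x)\<^sup>2"
    if x: "x \<in> carrier (cont_alg X)" for x
  proof (rule antisym)
    let ?N = "nrm (cont_alg X) (star (cont_alg X) x \<otimes>\<^bsub>cont_alg X\<^esub> x)"
    have c: "star (cont_alg X) x \<otimes>\<^bsub>cont_alg X\<^esub> x \<in> carrier (cont_alg X)" using x st by simp
    show "?N \<le> (nrm (cont_alg X) x)\<^sup>2"
      using x c by (subst le)
        (auto simp: cont_alg_simps(2,7) norm_mult power2_eq_square nn intro!: mult_mono ge)
    have "cmod (x t) \<le> sqrt ?N" if "t \<in> topspace X" for t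
      using ge[OF c that] that
      by (intro real_le_rsqrt) (auto simp: cont_alg_simps(2,7) norm_mult power2_eq_square)
    then have "nrm (cont_alg X) x \<le> sqrt ?N" using x nn[OF c] by (subst le) auto
    then show "(nrm (cont_alg X) x)\<^sup>2 \<le> ?N"
      using nn[OF x] nn[OF c] by (metis power_mono real_sqrt_pow2)
  qed
  have dist: "nrm_dist (cont_alg X) x y \<le> r \<longleftrightarrow> 0 \<le> r \<and> (\<forall>t\<in>topspace X. cmod (x t - y t) \<le> r)"
    if "x \<in> carrier (cont_alg X)" "y \<in> carrier (cont_alg X)" for x y r
    using that by (simp add: nrm_dist_def le) (auto simp: cont_alg_minus)
  have dl: "cmod (x t - y t) \<le> nrm_dist (cont_alg X) x y"
    if "x \<in> carrier (cont_alg X)" "y \<in> carrier (cont_alg X)" "t \<in> topspace X" for x y t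
    using dist[OF that(1,2), of "nrm_dist (cont_alg X) x y"] that(3) by auto
  interpret M: Metric_space "carrier (cont_alg X)" "nrm_dist (cont_alg X)"
  proof
    fix x y assume c: "x \<in> carrier (cont_alg X)" "y \<in> carrier (cont_alg X)"
    show "nrm_dist (cont_alg X) x y = 0 \<longleftrightarrow> x = y"
    proof
      assume "nrm_dist (cont_alg X) x y = 0"
      then show "x = y"
        using c dl[OF c] by (intro extensionalityI[of _ "topspace X"]) (auto simp: cont_alg_simps(1))
    next
      assume "x = y"
      then show "nrm_dist (cont_alg X) x y = 0"
        using c z[of "\<zero>\<^bsub>cont_alg X\<^esub>"] by (simp add: nrm_dist_def R.minus_eq R.r_neg)
    qed
    fix w assume "w \<in> carrier (cont_alg X)"
    then show "nrm_dist (cont_alg X) x w \<le> nrm_dist (cont_alg X) x y + nrm_dist (cont_alg X) y w"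
      using c tri[of "x \<ominus>\<^bsub>cont_alg X\<^esub> y" "y \<ominus>\<^bsub>cont_alg X\<^esub> w"]
      unfolding nrm_dist_def by (simp add: R.minus_eq R.a_assoc R.l_neg R.r_neg1 R.r_neg2)
  next
    fix x y
    show "0 \<le> nrm_dist (cont_alg X) x y"
      by (simp add: nrm_dist_def nn)
    have "nrm_dist (cont_alg X) x y \<le> nrm_dist (cont_alg X) y x" for x y
      using dist[of x y "nrm_dist (cont_alg X) y x"] dl[of y x]
      by (cases "x \<in> carrier (cont_alg X) \<and> y \<in> carrier (cont_alg X)")
        (auto simp: norm_minus_commute nn nrm_dist_def)
    then show "nrm_dist (cont_alg X) x y = nrm_dist (cont_alg X) y x"
      by (simp add: order_antisym)
  qed
  have complete: M.mcomplete
    unfolding M.mcomplete_def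
  proof (intro allI impI)
    fix s assume s: "M.MCauchy s"
    then have sc: "s n \<in> carrier (cont_alg X)" for n by (auto simp: M.MCauchy_def)
    have Cau: "\<exists>N. \<forall>m n t. N \<le> m \<longrightarrow> N \<le> n \<longrightarrow> t \<in> topspace X \<longrightarrow> dist (s m t) (s n t) < e" if e: "e > 0" for e
    proof -
      obtain N where "\<forall>m n. N \<le> m \<longrightarrow> N \<le> n \<longrightarrow> nrm_dist (cont_alg X) (s m) (s n) < e"
        using s e unfolding M.MCauchy_def by metis
      then show ?thesis using dl[OF sc sc] unfolding dist_norm by (meson order_le_less_trans)
    qed
    have co: "\<forall>\<^sub>F n in sequentially. continuous_map X Met_TC.mtopology (s n)"
      using sc by (simp add: cont_alg_simps)
    obtain g where g: "continuous_map X Met_TC.mtopology g"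
      "\<And>e. 0 < e \<Longrightarrow> \<forall>\<^sub>F n in sequentially. \<forall>t\<in>topspace X. dist (s n t) (g t) < e"
      using Met_TC.continuous_map_uniformly_Cauchy_limit[OF _ co Cau] by (auto simp: complete_UNIV)
    define h where "h = restrict g (topspace X)"
    have h: "h \<in> carrier (cont_alg X)" using g(1) by (simp add: h_def cont_alg_simps continuous_map_restrict_topspace)
    have "limitin M.mtopology s h sequentially"
      unfolding M.limitin_metric
    proof (intro conjI allI impI h)
      fix e :: real assume "e > 0"
      then have "\<forall>\<^sub>F n in sequentially. \<forall>t\<in>topspace X. dist (s n t) (g t) < e/2" using g(2)[of "e/2"] \<open>e > 0\<close> by (auto simp del: less_divide_eq_numeral1)
      then show "\<forall>\<^sub>F n in sequentially. s n \<in> carrier (cont_alg X) \<and> nrm_dist (cont_alg X) (s n) h < e"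
      proof eventually_elim
        case (elim n)
        have "nrm_dist (cont_alg X) (s n) h \<le> e/2"
          using elim \<open>e > 0\<close> by (subst dist[OF sc h]) (auto simp: dist_norm h_def less_imp_le)
        then show ?case using sc \<open>e > 0\<close> by simp
      qed
    qed
    then show "\<exists>x. limitin M.mtopology s x sequentially" by blast
  qed
  show ?thesis
    using sm st z tri sme mul cs nn complete
    by unfold_locales
      (simp_all, auto simp: cont_alg_simps fun_eq_iff extensional_def algebra_simps)
qed

text \<open>
  The C*-norm on the \<open>n \<times> n\<close> matrices over \<open>A\<close> is the operator norm of their action on the
  Hilbert \<open>A\<close>-module \<open>A\<^sup>n\<close> of columns, whose norm is
  \<open>\<parallel>v\<parallel> = \<parallel>v\<^sub>1\<^sup>* v\<^sub>1 + \<dots> + v\<^sub>n\<^sup>* v\<^sub>n\<parallel>\<^sup>1\<^sup>/\<^sup>2\<close>.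
\<close>

definition col_carrier :: "nat \<Rightarrow> 'a cstar \<Rightarrow> 'a vec set" where
  "col_carrier n A = {v \<in> carrier_vec n. \<forall>i<n. vec_index v i \<in> carrier A}"

definition col_nrm :: "nat \<Rightarrow> 'a cstar \<Rightarrow> 'a vec \<Rightarrow> real" where
  "col_nrm n A v = sqrt (nrm A (\<Oplus>\<^bsub>A\<^esub>i\<in>{..<n}. star A (vec_index v i) \<otimes>\<^bsub>A\<^esub> vec_index v i))"

definition mat_act :: "nat \<Rightarrow> 'a cstar \<Rightarrow> 'a mat \<Rightarrow> 'a vec \<Rightarrow> 'a vec" where
  "mat_act n A a v = vec n (\<lambda>i. \<Oplus>\<^bsub>A\<^esub>k\<in>{..<n}. a $$ (i, k) \<otimes>\<^bsub>A\<^esub> vec_index v k)"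

definition mat_alg :: "nat \<Rightarrow> 'a cstar \<Rightarrow> 'a mat cstar" where
  "mat_alg n A =
    \<lparr>carrier = {a \<in> carrier_mat n n. \<forall>i<n. \<forall>j<n. a $$ (i, j) \<in> carrier A},
     monoid.mult = (\<lambda>a b. mat n n (\<lambda>(i, j). \<Oplus>\<^bsub>A\<^esub>k\<in>{..<n}. a $$ (i, k) \<otimes>\<^bsub>A\<^esub> b $$ (k, j))),
     one = mat n n (\<lambda>(i, j). if i = j then \<one>\<^bsub>A\<^esub> else \<zero>\<^bsub>A\<^esub>),
     zero = mat n n (\<lambda>(i, j). \<zero>\<^bsub>A\<^esub>),
     add = (\<lambda>a b. mat n n (\<lambda>(i, j). a $$ (i, j) \<oplus>\<^bsub>A\<^esub> b $$ (i, j))),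
     module.smult = (\<lambda>c a. mat n n (\<lambda>(i, j). c \<odot>\<^bsub>A\<^esub> a $$ (i, j))),
     star = (\<lambda>a. mat n n (\<lambda>(i, j). star A (a $$ (j, i)))),
     nrm = (\<lambda>a. SUP v\<in>{v \<in> col_carrier n A. col_nrm n A v \<le> 1}. col_nrm n A (mat_act n A a v))\<rparr>"

section \<open>Determinant rank\<close>

definition unitary_group :: "'a cstar \<Rightarrow> 'a monoid" where
  "unitary_group A =
    \<lparr>carrier = {u \<in> carrier A. star A u \<otimes>\<^bsub>A\<^esub> u = \<one>\<^bsub>A\<^esub> \<and> u \<otimes>\<^bsub>A\<^esub> star A u = \<one>\<^bsub>A\<^esub>},
     monoid.mult = monoid.mult A, one = \<one>\<^bsub>A\<^esub>\<rparr>"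

definition U0 :: "'a cstar \<Rightarrow> 'a monoid" where
  "U0 A = unitary_group A
    \<lparr>carrier := connected_component_of_set
       (subtopology (norm_topology A) (carrier (unitary_group A))) \<one>\<^bsub>A\<^esub>\<rparr>"

definition CU :: "'a cstar \<Rightarrow> 'a set" where
  "CU A = Abstract_Topology.closure_of (norm_topology A) (derived (U0 A) (carrier (U0 A)))"

definition diag_embed :: "'a cstar \<Rightarrow> nat \<Rightarrow> nat \<Rightarrow> 'a mat \<Rightarrow> 'a mat" where
  "diag_embed A m n u = mat n n
    (\<lambda>(i, j). if i < m \<and> j < m then u $$ (i, j) else if i = j then \<one>\<^bsub>A\<^esub> else \<zero>\<^bsub>A\<^esub>)"

text \<open>
  The map sending the class of \<open>u\<close> to the class of \<open>diag(u, 1)\<close>. It is well defined since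
  \<open>diag_embed\<close> maps \<open>CU (mat_alg m A)\<close> into \<open>CU (mat_alg n A)\<close>, so that the set below is a
  singleton for every coset \<open>C\<close>.
\<close>

definition induced_map :: "'a cstar \<Rightarrow> nat \<Rightarrow> nat \<Rightarrow> 'a mat set \<Rightarrow> 'a mat set" where
  "induced_map A m n C =
    the_elem ((\<lambda>u. CU (mat_alg n A) #>\<^bsub>U0 (mat_alg n A)\<^esub> diag_embed A m n u) ` C)"

text \<open>The infimum of the empty set is \<open>\<infinity>\<close>.\<close>

definition Dur :: "'a cstar \<Rightarrow> enat" where
  "Dur A = Inf {enat m | m. 1 \<le> m \<and>
     (\<forall>n>m. induced_map A m n \<in>
        iso (U0 (mat_alg m A) Mod CU (mat_alg m A)) (U0 (mat_alg n A) Mod CU (mat_alg n A)))}"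

end

(*
  Realise M_m(M_n(C(X))) as the continuous functions from X to the k x k matrices, k = mn. A unitary u with
  Re <f, u f> > 0 can be reduced to 1, column by column, by continuous families of reflections
  1 - (1 - e^{i theta}) p p^*. Modulo commutators in U_0, each column only contributes a reflection
  along the first basis vector: a product R_p R_e of two reflections with <e, p> > 0 is a commutator,
  and a swap of coordinates moves the phases. Open subgroups contain U_0, so every u in U_0 is
  a product of commutators times diag(e^{i theta}, 1, ..., 1). Taking determinants,
  CU is the set of u in U_0 with det u = 1, and it follows that u |-> diag(u, 1) induces
  a bijection on U_0 / CU.
*)
theory Submission
  imports Defs "HOL-Analysis.Complex_Transcendental" "HOL-Analysis.L2_Norm" "Jordan_Normal_Form.Determinant"
begin

section \<open>Vectors and matrices as functions\<close>

text \<open>The obstacle is continuity in x. Over a general X, a column of a unitary need not admit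
  a continuous rotation to a basis vector: the normalised midpoint of the two breaks down where they
  are opposite, and an entry that vanishes somewhere has no phase there. Positivity of Re <f, u f>
  at every point removes both problems, since each diagonal entry then has positive real part, and
  the condition is inherited by what remains after a column has been eliminated. No estimate
  deteriorates from one column to the next.

  The phases obtained are real functions \<theta>, not merely circle-valued ones. Scaling \<theta>
  joins diag(cis \<theta>, 1, ..., 1) to 1, and this element already comes from the smallest matrix
  size, which gives surjectivity of the map on cosets.

  For injectivity, det diag(u, 1) = det u; if this is 1, the phase of u in U_0 satisfies cis
  \<theta> = 1, so u is a product of commutators in its own size. The same description by
  determinants shows that the commutator subgroup is already norm closed: determinants pass to
  limits and U_0 is open.\<close>

definition app :: "nat \<Rightarrow> (nat \<Rightarrow> nat \<Rightarrow> complex) \<Rightarrow> (nat \<Rightarrow> complex) \<Rightarrow> nat \<Rightarrow> complex" where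
  "app k M f = (\<lambda>i. \<Sum>l<k. M i l * f l)"

definition mm :: "nat \<Rightarrow> (nat \<Rightarrow> nat \<Rightarrow> complex) \<Rightarrow> (nat \<Rightarrow> nat \<Rightarrow> complex) \<Rightarrow> nat \<Rightarrow> nat \<Rightarrow> complex" where
  "mm k M N = (\<lambda>i j. \<Sum>l<k. M i l * N l j)"

definition adj :: "(nat \<Rightarrow> nat \<Rightarrow> complex) \<Rightarrow> nat \<Rightarrow> nat \<Rightarrow> complex" where
  "adj M = (\<lambda>i j. cnj (M j i))"

definition ip :: "nat \<Rightarrow> (nat \<Rightarrow> complex) \<Rightarrow> (nat \<Rightarrow> complex) \<Rightarrow> complex" where
  "ip k f g = (\<Sum>i<k. cnj (f i) * g i)"

definition vnorm :: "nat \<Rightarrow> (nat \<Rightarrow> complex) \<Rightarrow> real" where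
  "vnorm k f = L2_set (\<lambda>i. cmod (f i)) {..<k}"

definition bvec :: "nat \<Rightarrow> nat \<Rightarrow> complex" where
  "bvec j = (\<lambda>i. if i = j then 1 else 0)"

definition id_mat :: "nat \<Rightarrow> nat \<Rightarrow> complex" where
  "id_mat = (\<lambda>i j. if i = j then 1 else 0)"

text \<open>Vectors and matrices are functions on all of nat whose values from the dimension on are
  arbitrary, so equal vectors agree only below \<open>k\<close>. Such congruence rules let the
  simplifier use \<open>i < k\<close> inside inner products and norms.\<close>

lemma ip_cong: "\<lbrakk>\<And>i. i < k \<Longrightarrow> f i = f' i; \<And>i. i < k \<Longrightarrow> g i = g' i\<rbrakk> \<Longrightarrow> ip k f g = ip k f' g'"
  unfolding ip_def by (rule sum.cong) auto

lemma vnorm_cong: "(\<And>i. i < k \<Longrightarrow> f i = g i) \<Longrightarrow> vnorm k f = vnorm k g"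
  unfolding vnorm_def by (rule L2_set_cong) auto

lemma app_cong: "\<lbrakk>\<And>l. l < k \<Longrightarrow> M i l = N i l; \<And>l. l < k \<Longrightarrow> f l = g l\<rbrakk> \<Longrightarrow> app k M f i = app k N g i"
  unfolding app_def by (rule sum.cong) auto

lemma ip_linear:
  "ip k f (\<lambda>i. g i + h i) = ip k f g + ip k f h"
  "ip k f (\<lambda>i. g i - h i) = ip k f g - ip k f h"
  "ip k f (\<lambda>i. c * g i) = c * ip k f g"
  "ip k f (\<lambda>i. g i / c) = ip k f g / c"
  "ip k (\<lambda>i. g i + h i) f = ip k g f + ip k h f"
  "ip k (\<lambda>i. g i - h i) f = ip k g f - ip k h f"
  "ip k (\<lambda>i. c * g i) f = cnj c * ip k g f"
  "ip k (\<lambda>i. g i / c) f = ip k g f / cnj c"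
  unfolding ip_def
  by (simp_all add: sum.distrib sum_subtractf sum_distrib_left sum_divide_distrib algebra_simps)

lemma ip_cnj: "cnj (ip k f g) = ip k g f"
  unfolding ip_def by (simp add: mult.commute)

lemma ip_bvec:
  "j < k \<Longrightarrow> ip k (bvec j) f = f j"
  "j < k \<Longrightarrow> ip k f (bvec j) = cnj (f j)"
  unfolding ip_def bvec_def by (simp_all add: if_distrib if_distribR cong: if_cong)

lemma ip_self: "ip k f f = complex_of_real ((vnorm k f)\<^sup>2)"
proof -
  have "(vnorm k f)\<^sup>2 = (\<Sum>i<k. (cmod (f i))\<^sup>2)"
    by (simp add: vnorm_def L2_set_def sum_nonneg)
  then show ?thesis
    by (simp add: ip_def complex_norm_square mult.commute del: of_real_power)
qed

lemma vnorm_nonneg: "0 \<le> vnorm k f"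
  by (simp add: vnorm_def L2_set_nonneg)

lemma vnorm_eq_0: "vnorm k f = 0 \<longleftrightarrow> (\<forall>i<k. f i = 0)"
  by (auto simp: vnorm_def L2_set_eq_0_iff)

lemma vnorm_triangle: "vnorm k (\<lambda>i. f i + g i) \<le> vnorm k f + vnorm k g"
  unfolding vnorm_def
  by (rule order_trans[OF L2_set_mono L2_set_triangle_ineq]) (auto simp: norm_triangle_ineq)

lemma vnorm_scale: "vnorm k (\<lambda>i. c * f i) = cmod c * vnorm k f"
  by (simp add: vnorm_def norm_mult L2_set_right_distrib)

lemma component_le_vnorm: "i < k \<Longrightarrow> cmod (f i) \<le> vnorm k f"
  unfolding vnorm_def by (rule member_le_L2_set) auto

lemma vnorm_bvec: "j < k \<Longrightarrow> vnorm k (bvec j) = 1"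
  by (simp add: vnorm_def bvec_def L2_set_def if_distrib[of cmod] if_distrib[of "\<lambda>x. x\<^sup>2"] cong: if_cong)

lemma ip_le_vnorm: "cmod (ip k f g) \<le> vnorm k f * vnorm k g"
proof -
  have "cmod (ip k f g) \<le> (\<Sum>i<k. \<bar>cmod (f i)\<bar> * \<bar>cmod (g i)\<bar>)"
    unfolding ip_def by (rule order_trans[OF norm_sum]) (simp add: norm_mult)
  also have "\<dots> \<le> vnorm k f * vnorm k g"
    unfolding vnorm_def by (rule L2_set_mult_ineq)
  finally show ?thesis .
qed

lemma app_linear:
  "app k M (\<lambda>i. f i + g i) = (\<lambda>i. app k M f i + app k M g i)"
  "app k M (\<lambda>i. f i - g i) = (\<lambda>i. app k M f i - app k M g i)"
  "app k M (\<lambda>i. c * f i) = (\<lambda>i. c * app k M f i)"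
  unfolding app_def
  by (simp_all add: sum.distrib sum_subtractf sum_distrib_left algebra_simps)

lemma app_bvec: "j < k \<Longrightarrow> app k M (bvec j) i = M i j"
  unfolding app_def bvec_def by (simp add: if_distrib if_distribR cong: if_cong)

lemma app_mm: "app k (mm m M N) f = app m M (app k N f)"
  unfolding app_def mm_def
  by (intro ext, simp add: sum_distrib_left sum_distrib_right mult.assoc, rule sum.swap)

lemma app_id_mat: "i < k \<Longrightarrow> app k id_mat f i = f i"
  unfolding app_def id_mat_def by (simp add: if_distrib if_distribR cong: if_cong)

lemma app_adj: "ip k (app m (adj M) f) g = ip m f (app k M g)"
  unfolding app_def ip_def adj_def
  by (simp add: sum_distrib_left sum_distrib_right) (subst sum.swap, simp add: algebra_simps)

lemma app_adj': "ip k f (app m (adj M) g) = ip m (app k M f) g"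
  using app_adj[of k m M g f] ip_cnj by metis

text \<open>Testing on basis vectors reduces an identity of matrices to one of their actions, where
  products become compositions and reflections have a short formula.\<close>

lemma mat_eqI:
  assumes "\<And>f i. i < k \<Longrightarrow> app m M f i = app m N f i" "i < k" "j < m"
  shows "M i j = N i j"
  using assms(1)[OF assms(2), of "bvec j"] assms(3) by (simp add: app_bvec)

text \<open>The l^2 norm is at most the l^1 norm, and each entry contributes at most
  \<open>r\<close> times the norm of \<open>f\<close>. The constant is crude, but it only serves to
  compare operator norms with suprema of entries.\<close>

lemma vnorm_app_le:
  assumes "\<And>i j. \<lbrakk>i < k; j < m\<rbrakk> \<Longrightarrow> cmod (M i j) \<le> r"
  shows "vnorm k (app m M f) \<le> real k * real m * r * vnorm m f"
proof -
  have "vnorm k (app m M f) \<le> (\<Sum>i<k. cmod (app m M f i))"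
    unfolding vnorm_def by (rule L2_set_le_sum) auto
  also have "\<dots> \<le> (\<Sum>i<k. \<Sum>j<m. r * vnorm m f)"
  proof (rule sum_mono)
    fix i assume "i \<in> {..<k}"
    then show "cmod (app m M f i) \<le> (\<Sum>j<m. r * vnorm m f)"
      unfolding app_def
      by (intro order_trans[OF norm_sum] sum_mono)
        (auto simp: norm_mult intro!: mult_mono assms component_le_vnorm order_trans[OF norm_ge_zero assms])
  qed
  finally show ?thesis by (simp add: mult.assoc)
qed

section \<open>Bounds on operator norms\<close>

definition bounded_op :: "nat \<Rightarrow> nat \<Rightarrow> (nat \<Rightarrow> nat \<Rightarrow> complex) \<Rightarrow> real \<Rightarrow> bool" where
  "bounded_op k m M r \<longleftrightarrow> (\<forall>f. vnorm k (app m M f) \<le> r * vnorm m f)"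

lemma bounded_op_cong:
  "(\<And>i j. \<lbrakk>i < k; j < m\<rbrakk> \<Longrightarrow> M i j = N i j) \<Longrightarrow> bounded_op k m M r \<longleftrightarrow> bounded_op k m N r"
proof -
  assume "\<And>i j. \<lbrakk>i < k; j < m\<rbrakk> \<Longrightarrow> M i j = N i j"
  then have "vnorm k (app m M f) = vnorm k (app m N f)" for f
    by (intro vnorm_cong app_cong) auto
  then show ?thesis by (simp add: bounded_op_def)
qed

lemma bounded_op_entry:
  assumes "bounded_op k m M r" "i < k" "j < m"
  shows "cmod (M i j) \<le> r"
proof -
  have "cmod (M i j) \<le> vnorm k (app m M (bvec j))"
    using component_le_vnorm[OF assms(2), of "app m M (bvec j)"] assms(3) by (simp add: app_bvec)
  also have "\<dots> \<le> r"
    using assms(1,3) vnorm_bvec unfolding bounded_op_def by (metis mult.right_neutral)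
  finally show ?thesis .
qed

text \<open>The C*-identity in terms of upper bounds. One direction uses ||V f||^2 = <f, V^* V f>,
  the other ||g||^2 = <V g, V f> for g = V^* V f; both conclude by Cauchy-Schwarz. Norms of columns
  are defined by sums of v_i^* v_i, which have this form.\<close>

lemma bounded_op_square:
  assumes "0 \<le> r"
  shows "bounded_op k k (mm m (adj V) V) (r\<^sup>2) \<longleftrightarrow> bounded_op m k V r"
proof
  assume h: "bounded_op k k (mm m (adj V) V) (r\<^sup>2)"
  show "bounded_op m k V r" unfolding bounded_op_def
  proof
    fix f
    have "complex_of_real ((vnorm m (app k V f))\<^sup>2) = ip k f (app k (mm m (adj V) V) f)"
      by (simp only: app_mm app_adj' flip: ip_self)
    then have "(vnorm m (app k V f))\<^sup>2 = cmod (ip k f (app k (mm m (adj V) V) f))"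
      by (metis abs_power2 norm_of_real)
    also have "\<dots> \<le> vnorm k f * vnorm k (app k (mm m (adj V) V) f)" by (rule ip_le_vnorm)
    also have "\<dots> \<le> vnorm k f * (r\<^sup>2 * vnorm k f)"
      using h vnorm_nonneg unfolding bounded_op_def by (intro mult_left_mono) auto
    also have "\<dots> = (r * vnorm k f)\<^sup>2" by (simp add: power2_eq_square)
    finally show "vnorm m (app k V f) \<le> r * vnorm k f"
      by (rule power2_le_imp_le) (simp add: assms vnorm_nonneg)
  qed
next
  assume h: "bounded_op m k V r"
  show "bounded_op k k (mm m (adj V) V) (r\<^sup>2)" unfolding bounded_op_def
  proof
    fix f
    define g where "g = app k (mm m (adj V) V) f"
    have hh: "vnorm m (app k V f) \<le> r * vnorm k f" for f using h by (simp add: bounded_op_def)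
    have "complex_of_real ((vnorm k g)\<^sup>2) = ip m (app k V g) (app k V f)"
      by (subst ip_self[symmetric], subst app_adj'[symmetric]) (simp add: g_def app_mm)
    then have "(vnorm k g)\<^sup>2 = cmod (ip m (app k V g) (app k V f))"
      by (metis abs_power2 norm_of_real)
    also have "\<dots> \<le> vnorm m (app k V g) * vnorm m (app k V f)" by (rule ip_le_vnorm)
    also have "\<dots> \<le> (r * vnorm k g) * (r * vnorm k f)"
      by (intro mult_mono hh) (auto simp: vnorm_nonneg assms)
    finally have *: "vnorm k g * vnorm k g \<le> vnorm k g * (r\<^sup>2 * vnorm k f)"
      by (simp add: power2_eq_square algebra_simps)
    show "vnorm k g \<le> r\<^sup>2 * vnorm k f"
    proof (cases "vnorm k g = 0")
      case True
      then show ?thesis using assms by (simp add: vnorm_nonneg)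
    next
      case False
      then have "0 < vnorm k g" using vnorm_nonneg[of k g] by linarith
      then show ?thesis using * by (metis mult_le_cancel_left_pos)
    qed
  qed
qed

section \<open>Reflections and accretive matrices\<close>

text \<open>For a unit vector \<open>p\<close> this multiplies \<open>p\<close> by \<open>z\<close>
  and fixes its orthogonal complement; \<open>z = -1\<close> gives the Householder
  reflection.\<close>

definition hrefl :: "(nat \<Rightarrow> complex) \<Rightarrow> complex \<Rightarrow> nat \<Rightarrow> nat \<Rightarrow> complex" where
  "hrefl p z = (\<lambda>i j. id_mat i j - (1 - z) * p i * cnj (p j))"

definition unitary :: "nat \<Rightarrow> (nat \<Rightarrow> nat \<Rightarrow> complex) \<Rightarrow> bool" where
  "unitary k M \<longleftrightarrow> (\<forall>i<k. \<forall>j<k. mm k (adj M) M i j = id_mat i j \<and> mm k M (adj M) i j = id_mat i j)"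

text \<open>Strict positivity without a uniform lower bound: it suffices for diagonal entries in the
  right half-plane, where phases can be chosen continuously.\<close>

definition accretive :: "nat \<Rightarrow> (nat \<Rightarrow> nat \<Rightarrow> complex) \<Rightarrow> bool" where
  "accretive k M \<longleftrightarrow> (\<forall>f. (\<exists>i<k. f i \<noteq> 0) \<longrightarrow> 0 < Re (ip k f (app k M f)))"

lemma mm_cong:
  assumes "\<And>i j. \<lbrakk>i < k; j < m\<rbrakk> \<Longrightarrow> M i j = M' i j" "\<And>i j. \<lbrakk>i < m; j < n\<rbrakk> \<Longrightarrow> N i j = N' i j"
    "i < k" "j < n"
  shows "mm m M N i j = mm m M' N' i j"
  unfolding mm_def using assms by (intro sum.cong) auto

lemma mm_assoc: "mm m (mm k M N) P i j = mm k M (mm m N P) i j"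
  unfolding mm_def
  by (simp add: sum_distrib_left sum_distrib_right mult.assoc) (rule sum.swap)

lemma mm_id: "i < k \<Longrightarrow> mm k id_mat M i j = M i j" "j < k \<Longrightarrow> mm k M id_mat i j = M i j"
  unfolding mm_def id_mat_def by (simp_all add: if_distrib if_distribR cong: if_cong)

lemma app_eqI:
  assumes "\<And>i j. \<lbrakk>i < k; j < m\<rbrakk> \<Longrightarrow> M i j = N i j" "i < k"
  shows "app m M f i = app m N f i"
  using assms by (intro app_cong) auto

lemma unitaryD:
  assumes "unitary k M" "i < k"
  shows "app k (adj M) (app k M f) i = f i" "app k M (app k (adj M) f) i = f i"
  using assms app_eqI[of k k "mm k (adj M) M" id_mat i f] app_eqI[of k k "mm k M (adj M)" id_mat i f]
  by (simp_all add: unitary_def app_mm app_id_mat)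

lemma unitary_ip:
  assumes "unitary k M"
  shows "ip k (app k M f) (app k M g) = ip k f g"
  using assms by (simp add: unitaryD app_adj'[symmetric] cong: ip_cong)

lemma app_hrefl: "i < k \<Longrightarrow> app k (hrefl p z) f i = f i - (1 - z) * p i * ip k p f"
  using app_id_mat[of i k f]
  by (simp add: app_def hrefl_def ip_def left_diff_distrib sum_subtractf sum_distrib_left mult.assoc)

lemma adj_hrefl: "adj (hrefl p z) = hrefl p (cnj z)"
  by (auto simp: adj_def hrefl_def id_mat_def fun_eq_iff)

lemma hrefl_one: "hrefl p 1 = id_mat"
  by (simp add: hrefl_def)

lemma hrefl_uminus: "hrefl (\<lambda>i. - p i) z = hrefl p z"
  by (simp add: hrefl_def)

lemma hrefl_mult:
  assumes "vnorm k p = 1" "i < k" "j < k"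
  shows "mm k (hrefl p z) (hrefl p w) i j = hrefl p (z * w) i j"
proof (rule mat_eqI[where M = "mm k (hrefl p z) (hrefl p w)" and N = "hrefl p (z * w)", OF _ assms(2,3)])
  fix f i assume i: "i < k"
  have "ip k p (app k (hrefl p w) f) = ip k p (\<lambda>i. f i - (1 - w) * ip k p f * p i)"
    by (rule ip_cong) (auto simp: app_hrefl)
  also have "\<dots> = w * ip k p f"
    unfolding ip_linear ip_self assms by (simp add: algebra_simps)
  finally show "app k (mm k (hrefl p z) (hrefl p w)) f i = app k (hrefl p (z * w)) f i"
    using i by (simp add: app_mm app_hrefl algebra_simps)
qed

lemma unitary_hrefl:
  assumes "vnorm k p = 1" "cmod z = 1"
  shows "unitary k (hrefl p z)"
proof -
  have "z * cnj z = 1" by (simp add: assms(2) complex_norm_square[symmetric])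
  then show ?thesis
    using assms(1) by (simp add: unitary_def adj_hrefl hrefl_mult hrefl_one mult.commute[of "cnj z"])
qed

text \<open>Conjugation by a unitary moves the axis of a reflection and keeps its eigenvalue. The
  commutators needed later arise this way: reflections whose axes are carried into each other by an
  element of U_0 differ by a commutator.\<close>

lemma conj_hrefl:
  assumes "unitary k M" "i < k" "j < k"
  shows "mm k (mm k M (hrefl p z)) (adj M) i j = hrefl (app k M p) z i j"
proof (rule mat_eqI[where M = "mm k (mm k M (hrefl p z)) (adj M)" and N = "hrefl (app k M p) z", OF _ assms(2,3)])
  fix f i assume i: "i < k"
  have "app k M (app k (hrefl p z) (app k (adj M) f)) i
      = app k M (\<lambda>i. app k (adj M) f i - (1 - z) * ip k p (app k (adj M) f) * p i) i"
    by (rule app_cong) (auto simp: app_hrefl)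
  also have "\<dots> = f i - (1 - z) * ip k (app k M p) f * app k M p i"
    using i by (simp only: app_linear unitaryD[OF assms(1)] app_adj')
  finally show "app k (mm k (mm k M (hrefl p z)) (adj M)) f i = app k (hrefl (app k M p) z) f i"
    using i by (simp add: app_mm app_hrefl algebra_simps)
qed

lemma accretive_diag:
  assumes "accretive k M" "j < k"
  shows "0 < Re (M j j)"
proof -
  have "ip k (bvec j) (app k M (bvec j)) = M j j"
    using assms(2) by (simp add: ip_bvec app_bvec)
  moreover have "\<exists>i<k. bvec j i \<noteq> 0" using assms(2) by (auto simp: bvec_def)
  ultimately show ?thesis using assms(1) by (metis accretive_def)
qed

text \<open>The number \<open>real k * real k * r\<close> bounds the operator norm of M - 1 by
  \<open>vnorm_app_le\<close>, so by Cauchy-Schwarz the perturbation of <f, f> stays below <f,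
  f>.\<close>

lemma accretive_near_id:
  assumes "\<And>i j. \<lbrakk>i < k; j < k\<rbrakk> \<Longrightarrow> cmod (M i j - id_mat i j) \<le> r" "real k * real k * r < 1"
  shows "accretive k M"
  unfolding accretive_def
proof (intro allI impI)
  fix f :: "nat \<Rightarrow> complex" assume "\<exists>i<k. f i \<noteq> 0"
  then have pos: "0 < vnorm k f" using vnorm_eq_0 vnorm_nonneg by (metis order_le_less)
  define N where "N = (\<lambda>i j. M i j - id_mat i j)"
  have "ip k f (app k M f) = ip k f (\<lambda>i. f i + app k N f i)"
    by (rule ip_cong) (use app_id_mat[of _ k f] in \<open>auto simp: N_def app_def left_diff_distrib sum_subtractf\<close>)
  also have "\<dots> = of_real ((vnorm k f)\<^sup>2) + ip k f (app k N f)"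
    by (simp only: ip_linear ip_self)
  finally have eq: "ip k f (app k M f) = of_real ((vnorm k f)\<^sup>2) + ip k f (app k N f)" .
  have "cmod (ip k f (app k N f)) \<le> vnorm k f * (real k * real k * r * vnorm k f)"
    by (rule order_trans[OF ip_le_vnorm]) (auto simp: N_def vnorm_nonneg intro!: mult_left_mono vnorm_app_le assms)
  also have "\<dots> = (real k * real k * r) * (vnorm k f)\<^sup>2" by (simp add: power2_eq_square)
  also have "\<dots> < 1 * (vnorm k f)\<^sup>2" using assms(2) pos by (intro mult_strict_right_mono) auto
  finally show "0 < Re (ip k f (app k M f))"
    using abs_Re_le_cmod[of "ip k f (app k N f)"] by (simp add: eq del: of_real_power)
qed

lemma vnorm_eq_1I: "ip k f f = 1 \<Longrightarrow> vnorm k f = 1"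
  using vnorm_nonneg[of k f] by (metis ip_self of_real_eq_1_iff power2_eq_1_iff not_one_le_zero neg_0_le_iff_le)

text \<open>
  With \<open>c\<close> the \<open>j\<close>-th column of \<open>u\<close> and \<open>a\<close> its \<open>j\<close>-th entry, the product of the three reflections is the
  unitary sending the \<open>j\<close>-th basis vector to \<open>c\<close>. For \<open>f\<close> orthogonal to it,
  \<open>\<langle>f, v f\<rangle>\<close> is a convex combination of \<open>\<langle>f, u f\<rangle>\<close> and of the Schur complement of \<open>a\<close> in \<open>u\<close> at \<open>f\<close>,
  which is why accretivity passes from \<open>u\<close> to \<open>v\<close>.
\<close>

lemma column_elimination:
  fixes u v :: "nat \<Rightarrow> nat \<Rightarrow> complex" and j k :: nat
  defines "a \<equiv> u j j"
  defines "p \<equiv> \<lambda>i. (bvec j i + cnj (sgn a) * u i j) / complex_of_real (sqrt (2 + 2 * cmod a))"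
  assumes u: "unitary k u" "accretive k u" and j: "j < k"
    and fixed: "\<And>i l. \<lbrakk>i < j; l < k\<rbrakk> \<Longrightarrow> u l i = id_mat l i"
  shows "vnorm k p = 1" "p j = complex_of_real ((1 + cmod a) / sqrt (2 + 2 * cmod a))"
    and "\<lbrakk>unitary k v;
      \<And>f i. i < k \<Longrightarrow> app k (hrefl p (-1)) (app k (hrefl (bvec j) (-1)) (app k (hrefl (bvec j) (sgn a)) (app k v f))) i
         = app k u f i\<rbrakk> \<Longrightarrow> accretive k v \<and> (\<forall>i\<le>j. \<forall>l<k. v l i = id_mat l i)"
proof -
  define z where "z = sgn a"
  define s where "s = complex_of_real (sqrt (2 + 2 * cmod a))"
  define c where "c = (\<lambda>i. u i j)"
  have Rea: "0 < Re a" unfolding a_def using accretive_diag[OF u(2) j] .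
  then have a0: "a \<noteq> 0" by auto
  have z1: "z * cnj z = 1" and az: "a = of_real (cmod a) * z"
    using a0 by (simp_all add: z_def sgn_div_norm scaleR_conv_of_real complex_norm_square[symmetric] divide_simps)
      (simp add: complex_norm_square power2_eq_square)
  then have cza: "cnj z * a = of_real (cmod a)" and za: "z * cnj a = of_real (cmod a)"
    by (metis (no_types) mult.commute mult.left_commute mult.right_neutral complex_cnj_mult complex_cnj_complex_of_real complex_cnj_cnj)+
  have s2: "s * s = 2 * (1 + of_real (cmod a))" unfolding s_def
    by (simp flip: of_real_mult) simp
  have s0: "s \<noteq> 0" "cnj s = s" and a1: "1 + complex_of_real (cmod a) \<noteq> 0"
    unfolding s_def by (simp_all add: add_nonneg_eq_0_iff) (metis norm_ge_zero add_nonneg_eq_0_iff of_real_1 of_real_add of_real_eq_0_iff zero_le_one zero_neq_one)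
  have p: "p = (\<lambda>i. (bvec j i + cnj z * c i) / s)"
    by (simp add: p_def z_def s_def c_def)
  have bj: "bvec j j = 1" by (simp add: bvec_def)
  have cj: "c j = a" by (simp add: c_def a_def)
  have c: "app k u (bvec j) = c" using j by (simp add: c_def app_bvec fun_eq_iff)
  have cc: "ip k c c = 1"
    using unitary_ip[OF u(1), of "bvec j" "bvec j"] j by (simp add: c ip_bvec) (simp add: bvec_def)
  \<comment> \<open>The vectors e_j and cnj z * c are unit vectors with inner product |a|, so their
    sum has squared norm 2 + 2|a|. This is the origin of the denominator of
    \<open>p\<close>.\<close>
  have pp: "ip k p p = (bvec j j + cnj z * c j + z * (cnj (c j) + cnj z * ip k c c)) / (s * s)"
    unfolding p ip_linear using j by (simp add: ip_bvec s0 add_divide_distrib distrib_left bj ac_simps)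
  also have "\<dots> = (1 + cnj z * a + z * cnj a + z * cnj z) / (s * s)"
    by (simp add: cj cc bvec_def algebra_simps)
  also have "\<dots> = (1 + of_real (cmod a) + of_real (cmod a) + 1) / (s * s)"
    by (simp add: za z1 cza)
  also have "1 + of_real (cmod a) + of_real (cmod a) + 1 = s * s" by (simp add: s2)
  also have "(s * s) / (s * s) = 1" using s0 by simp
  finally show p1: "vnorm k p = 1" by (rule vnorm_eq_1I)
  show pj: "p j = complex_of_real ((1 + cmod a) / sqrt (2 + 2 * cmod a))"
    by (simp add: p cj cza bvec_def s_def)
  assume v: "unitary k v" and uv: "\<And>f i. i < k \<Longrightarrow> app k (hrefl p (-1)) (app k (hrefl (bvec j) (-1)) (app k (hrefl (bvec j) (sgn a)) (app k v f))) i
         = app k u f i"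
  define R where "R = (\<lambda>f. app k (hrefl p (-1)) (app k (hrefl (bvec j) (-1)) (app k (hrefl (bvec j) z) f)))"
  have uni: "unitary k (hrefl p (-1))" "unitary k (hrefl (bvec j) (-1))" "unitary k (hrefl (bvec j) z)"
    using z1 j by (auto intro!: unitary_hrefl p1 vnorm_bvec simp: z_def norm_sgn a0)
  have R_ip: "ip k (R f) (R g) = ip k f g" for f g
    by (simp add: R_def unitary_ip uni)
  have Rv: "R (app k v f) i = app k u f i" if "i < k" for f i
    using uv[OF that] by (simp add: R_def z_def)
  \<comment> \<open>Only R v = u is known. Since R preserves inner products, <f, v g> becomes <R f,
    u g>, and R never has to be inverted.\<close>
  have v_ip: "ip k f (app k v g) = ip k (R f) (app k u g)" for f g
    using R_ip[of f "app k v g"] by (simp add: Rv cong: ip_cong)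
  have R: "R f i = f i - (1 + z) * f j * bvec j i
      - (bvec j i + cnj z * c i) * (ip k (\<lambda>i. cnj z * c i) f - z * f j - (1 + z) * of_real (cmod a) * f j) / (1 + of_real (cmod a))"
    if i: "i < k" for f i
  proof -
    \<comment> \<open>The two reflections along e_j multiply the j-th coordinate by z and by -1;
      \<open>g\<close> is the result, with f_j replaced by -z f_j.\<close>
    define g where "g = (\<lambda>i. f i - ((1 + z) * f j) * bvec j i)"
    have e1: "app k (hrefl (bvec j) z) f m = f m - (1 - z) * bvec j m * f j" if "m < k" for m
      using j that by (simp add: app_hrefl ip_bvec)
    have e2: "app k (hrefl (bvec j) (-1)) (app k (hrefl (bvec j) z) f) m = g m" if "m < k" for m
      using j that by (simp add: app_hrefl ip_bvec e1 g_def) (simp add: bvec_def algebra_simps)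
    have gj: "g j = - z * f j" by (simp add: g_def bvec_def algebra_simps)
    have "ip k (\<lambda>i. cnj z * c i) g = ip k (\<lambda>i. cnj z * c i) f - (1 + z) * f j * (z * cnj a)"
      unfolding g_def ip_linear(2,3) using j by (simp add: ip_bvec cj)
    then have pg: "ip k p g = (ip k (\<lambda>i. cnj z * c i) f - z * f j - (1 + z) * of_real (cmod a) * f j) / s"
      unfolding p ip_linear(5,8) using j by (simp add: ip_bvec s0 gj za add_divide_distrib algebra_simps)
    have "R f i = g i - 2 * p i * ip k p g"
      unfolding R_def app_hrefl[OF i, of p] using i by (simp add: e2 cong: ip_cong)
    also have "\<dots> = g i - (bvec j i + cnj z * c i) * (ip k (\<lambda>i. cnj z * c i) f - z * f j - (1 + z) * of_real (cmod a) * f j) * (2 / (s * s))"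
      unfolding pg by (simp add: p)
    also have "2 / (s * s) = 1 / (1 + of_real (cmod a))" unfolding s2 using a1 by (simp del: distrib_left_numeral)
    finally show ?thesis by (simp add: g_def)
  qed
  have Rf: "R f i = f i - (bvec j i + cnj z * c i) * (z * ip k c f) / (1 + of_real (cmod a))"
    if "i < k" "f j = 0" for f i
    using R[OF that(1), of f] that(2) by (simp add: ip_linear)
  \<comment> \<open>The reflection along the midpoint of e_j and cnj z * c sends e_j to - cnj z * c.
    The factor -z from the reflections along e_j cancels both the sign and the phase, which is why
    the reflection with eigenvalue -1 along e_j is included.\<close>
  have Rj: "R (bvec j) i = c i" if "i < k" for i
  proof -
    have cz: "ip k (\<lambda>i. cnj z * c i) (bvec j) = of_real (cmod a)"
      using j za by (simp add: ip_bvec cj)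
    have "of_real (cmod a) - z * bvec j j - (1 + z) * of_real (cmod a) * bvec j j = - z * (1 + of_real (cmod a))"
      by (simp add: bj algebra_simps)
    then have "R (bvec j) i = bvec j i - (1 + z) * bvec j i - (bvec j i + cnj z * c i) * (- z * (1 + of_real (cmod a))) / (1 + of_real (cmod a))"
      using R[OF that, of "bvec j"] by (simp only: cz bj mult_1_right)
    also have "\<dots> = bvec j i - (1 + z) * bvec j i + (bvec j i + cnj z * c i) * z"
      using a1 by simp
    also have "\<dots> = (z * cnj z) * c i" by (simp add: algebra_simps)
    finally show ?thesis by (simp add: z1)
  qed
  \<comment> \<open>R and u agree on e_i for every i up to j. For i < j, e_i is fixed by u and hence
    orthogonal to c = u e_j, so R fixes it too. Comparing inner products then gives v e_i =
    e_i.\<close>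
  have vfix: "v l i = id_mat l i" if "i \<le> j" "l < k" for i l
  proof -
    have "R (bvec i) m = app k u (bvec i) m" if m: "m < k" for m
    proof (cases "i = j")
      case True
      then show ?thesis using Rj[OF m] c by simp
    next
      case False
      then have i: "i < j" "i < k" "bvec i j = 0" "bvec j i = 0" using \<open>i \<le> j\<close> j by (auto simp: bvec_def)
      have ui: "app k u (bvec i) m = bvec i m" if "m < k" for m
        using fixed[OF i(1) that] i by (simp add: app_bvec) (simp add: bvec_def id_mat_def)
      have "ip k c (bvec i) = ip k (app k u (bvec j)) (app k u (bvec i))"
        by (simp add: c ui cong: ip_cong)
      also have "\<dots> = 0" using i j by (simp add: unitary_ip[OF u(1)] ip_bvec)
      finally show ?thesis using Rf[OF m, of "bvec i"] i(3) ui[OF m] by simp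
    qed
    then have "ip k (bvec l) (app k v (bvec i)) = ip k (R (bvec l)) (R (bvec i))"
      unfolding v_ip by (intro ip_cong) auto
    also have "\<dots> = ip k (bvec l) (bvec i)" by (rule R_ip)
    finally show ?thesis using that j by (simp add: ip_bvec app_bvec) (simp add: bvec_def id_mat_def)
  qed
  have acc: "0 < Re (ip k f (app k v f))" if f: "f j = 0" "\<exists>i<k. f i \<noteq> 0" for f
  proof -
    define b where "b = app k u f j"
    define \<kappa> where "\<kappa> = ip k f c"
    define \<tau> where "\<tau> = ip k f (app k u f)"
    \<comment> \<open>The weight of the convex combination: it satisfies \<mu> / a = cnj z / (1 +
      |a|), the coefficient with which \<kappa> b is subtracted in <f, v f>.\<close>
    define \<mu> where "\<mu> = cmod a / (1 + cmod a)"
    \<comment> \<open>The coefficient b / a makes the j-th coordinate of u y vanish, so that <y, u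
      y> is the Schur complement \<tau> - (b / a) \<kappa>.\<close>
    define y where "y = (\<lambda>i. f i - (b / a) * bvec j i)"
    have cu: "ip k c (app k u f) = 0"
      using unitary_ip[OF u(1), of "bvec j" f] j f(1) by (simp add: c ip_bvec)
    have "ip k f (app k v f) = ip k (\<lambda>i. f i - (z * ip k c f / (1 + of_real (cmod a))) * (bvec j i + cnj z * c i)) (app k u f)"
      unfolding v_ip by (rule ip_cong) (simp_all add: Rf f(1))
    also have "\<dots> = \<tau> - cnj z * \<kappa> * b / (1 + of_real (cmod a))"
      unfolding ip_linear using j by (simp add: cu ip_bvec ip_cnj \<tau>_def \<kappa>_def b_def)
    finally have 1: "ip k f (app k v f) = \<tau> - cnj z * \<kappa> * b / (1 + of_real (cmod a))" .
    have "ip k y (app k u y) = \<tau> - (b / a) * \<kappa>"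
      unfolding y_def app_linear ip_linear c using j a0
      by (simp add: ip_bvec cj b_def[symmetric] \<tau>_def[symmetric] \<kappa>_def[symmetric])
        (simp add: divide_simps algebra_simps)
    moreover have "\<exists>i<k. y i \<noteq> 0"
    proof -
      obtain i where "i < k" "f i \<noteq> 0" using f(2) by auto
      then show ?thesis using f(1) by (intro exI[of _ i]) (auto simp: y_def bvec_def)
    qed
    ultimately have 2: "0 < Re (\<tau> - (b / a) * \<kappa>)" using u(2) by (metis accretive_def)
    have 3: "0 < Re \<tau>" using u(2) f(2) by (auto simp: \<tau>_def accretive_def)
    have l: "0 \<le> \<mu>" "\<mu> < 1"
      using a0 by (simp_all add: \<mu>_def add_pos_pos)
    have "of_real \<mu> / a = cnj z / (1 + of_real (cmod a))"
    proof -
      have "1 / a = cnj z / of_real (cmod a)"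
        using a0 cza by (simp add: divide_simps)
      then have "of_real \<mu> / a = of_real \<mu> * (cnj z / of_real (cmod a))"
        by (metis mult.right_neutral times_divide_eq_right)
      also have "\<dots> = cnj z / (1 + of_real (cmod a))" using a0 by (simp add: \<mu>_def)
      finally show ?thesis .
    qed
    then have "\<tau> - cnj z * \<kappa> * b / (1 + of_real (cmod a)) = \<tau> - (of_real \<mu> / a) * \<kappa> * b" by simp
    also have "\<dots> = of_real (1 - \<mu>) * \<tau> + of_real \<mu> * (\<tau> - (b / a) * \<kappa>)"
      by (simp add: algebra_simps)
    finally have "ip k f (app k v f) = of_real (1 - \<mu>) * \<tau> + of_real \<mu> * (\<tau> - (b / a) * \<kappa>)"
      using 1 by simp
    then have "Re (ip k f (app k v f)) = (1 - \<mu>) * Re \<tau> + \<mu> * Re (\<tau> - (b / a) * \<kappa>)"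
      by simp
    also have "0 < \<dots>" using 2 3 l by (intro add_pos_nonneg mult_pos_pos mult_nonneg_nonneg) auto
    finally show ?thesis .
  qed
  have "accretive k v" unfolding accretive_def
  proof (intro allI impI)
    fix f :: "nat \<Rightarrow> complex" assume f: "\<exists>i<k. f i \<noteq> 0"
    \<comment> \<open>Since v is unitary and fixes e_j, it preserves the orthogonal complement of
      e_j. The cross terms vanish, and e_j contributes |f_j|^2.\<close>
    define g where "g = (\<lambda>i. f i - f j * bvec j i)"
    have gj: "g j = 0" by (simp add: g_def bvec_def)
    have vj: "app k v (bvec j) i = bvec j i" if "i < k" for i
      using vfix[of j i] that j by (simp add: app_bvec) (simp add: bvec_def id_mat_def)
    have vg: "app k v g j = 0"
    proof -
      have "app k v g j = ip k (app k v (bvec j)) (app k v g)"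
        using j by (simp add: vj ip_bvec cong: ip_cong)
      then show ?thesis using j gj by (simp add: unitary_ip[OF v] ip_bvec)
    qed
    have f_eq: "f = (\<lambda>i. g i + f j * bvec j i)" by (auto simp: g_def)
    have "ip k f (app k v f) = ip k (\<lambda>i. g i + f j * bvec j i) (app k v (\<lambda>i. g i + f j * bvec j i))"
      using f_eq by simp
    also have "\<dots> = ip k (\<lambda>i. g i + f j * bvec j i) (\<lambda>i. app k v g i + f j * bvec j i)"
      by (rule ip_cong) (simp_all add: app_linear vj)
    also have "\<dots> = ip k g (app k v g) + cnj (f j) * f j"
      unfolding ip_linear using j vg gj by (simp add: ip_bvec) (simp add: bvec_def)
    finally have eq: "Re (ip k f (app k v f)) = Re (ip k g (app k v g)) + (cmod (f j))\<^sup>2"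
      by (simp add: cmod_power2) (simp add: power2_eq_square)
    show "0 < Re (ip k f (app k v f))"
    proof (cases "\<exists>i<k. g i \<noteq> 0")
      case True
      then show ?thesis using acc[of g] gj by (simp add: eq add_pos_nonneg)
    next
      case False
      then have "ip k g (app k v g) = 0" by (simp add: ip_def)
      moreover have "f j \<noteq> 0"
        using False f by (auto simp: g_def)
      ultimately show ?thesis by (simp add: eq)
    qed
  qed
  then show "accretive k v \<and> (\<forall>i\<le>j. \<forall>l<k. v l i = id_mat l i)" using vfix by blast
qed

section \<open>Algebras of continuous matrix functions\<close>

text \<open>Algebras of continuous functions from \<open>X\<close> to k x k matrices, presented
  through the evaluation \<open>\<rho> a x\<close>. The norm enters by its upper bounds, the form
  that passes to matrix algebras most easily. Through \<open>nrm_le_iff\<close> every element is a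
  bounded function, which takes the place of compactness of \<open>X\<close>.\<close>

locale matrix_functions =
  fixes A :: "'a cstar" (structure) and X :: "'x topology" and k :: nat
    and \<rho> :: "'a \<Rightarrow> 'x \<Rightarrow> nat \<Rightarrow> nat \<Rightarrow> complex"
  assumes dim_pos: "0 < k"
    and mult_closed: "\<lbrakk>a \<in> carrier A; b \<in> carrier A\<rbrakk> \<Longrightarrow> a \<otimes> b \<in> carrier A"
    and add_closed: "\<lbrakk>a \<in> carrier A; b \<in> carrier A\<rbrakk> \<Longrightarrow> a \<oplus> b \<in> carrier A"
    and one_closed: "\<one> \<in> carrier A"
    and zero_closed: "\<zero> \<in> carrier A"
    and star_closed: "a \<in> carrier A \<Longrightarrow> star A a \<in> carrier A"
    and rho_cont: "\<lbrakk>a \<in> carrier A; i < k; j < k\<rbrakk> \<Longrightarrow> continuous_map X euclidean (\<lambda>x. \<rho> a x i j)"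
    and rho_inj: "\<lbrakk>a \<in> carrier A; b \<in> carrier A;
      \<And>x i j. \<lbrakk>x \<in> topspace X; i < k; j < k\<rbrakk> \<Longrightarrow> \<rho> a x i j = \<rho> b x i j\<rbrakk> \<Longrightarrow> a = b"
    and rho_surj: "(\<And>i j. \<lbrakk>i < k; j < k\<rbrakk> \<Longrightarrow> continuous_map X euclidean (\<lambda>x. F x i j)) \<Longrightarrow>
      \<exists>a\<in>carrier A. \<forall>x\<in>topspace X. \<forall>i<k. \<forall>j<k. \<rho> a x i j = F x i j"
    and rho_mult: "\<lbrakk>a \<in> carrier A; b \<in> carrier A; x \<in> topspace X; i < k; j < k\<rbrakk> \<Longrightarrow>
      \<rho> (a \<otimes> b) x i j = mm k (\<rho> a x) (\<rho> b x) i j"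
    and rho_add: "\<lbrakk>a \<in> carrier A; b \<in> carrier A; x \<in> topspace X; i < k; j < k\<rbrakk> \<Longrightarrow>
      \<rho> (a \<oplus> b) x i j = \<rho> a x i j + \<rho> b x i j"
    and rho_one: "\<lbrakk>x \<in> topspace X; i < k; j < k\<rbrakk> \<Longrightarrow> \<rho> \<one> x i j = id_mat i j"
    and rho_zero: "\<lbrakk>x \<in> topspace X; i < k; j < k\<rbrakk> \<Longrightarrow> \<rho> \<zero> x i j = 0"
    and rho_star: "\<lbrakk>a \<in> carrier A; x \<in> topspace X; i < k; j < k\<rbrakk> \<Longrightarrow> \<rho> (star A a) x i j = cnj (\<rho> a x j i)"
    and nrm_le_iff: "a \<in> carrier A \<Longrightarrow>
      nrm A a \<le> r \<longleftrightarrow> 0 \<le> r \<and> (\<forall>x\<in>topspace X. bounded_op k k (\<rho> a x) r)"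
begin

definition el :: "('x \<Rightarrow> nat \<Rightarrow> nat \<Rightarrow> complex) \<Rightarrow> 'a" where
  "el F = (SOME a. a \<in> carrier A \<and> (\<forall>x\<in>topspace X. \<forall>i<k. \<forall>j<k. \<rho> a x i j = F x i j))"

lemma el:
  assumes "\<And>i j. \<lbrakk>i < k; j < k\<rbrakk> \<Longrightarrow> continuous_map X euclidean (\<lambda>x. F x i j)"
  shows "el F \<in> carrier A"
    and "\<lbrakk>x \<in> topspace X; i < k; j < k\<rbrakk> \<Longrightarrow> \<rho> (el F) x i j = F x i j"
proof -
  have "\<exists>a. a \<in> carrier A \<and> (\<forall>x\<in>topspace X. \<forall>i<k. \<forall>j<k. \<rho> a x i j = F x i j)"
    using rho_surj[of F, OF assms] by blast
  from someI_ex[OF this] show "el F \<in> carrier A" "\<lbrakk>x \<in> topspace X; i < k; j < k\<rbrakk> \<Longrightarrow> \<rho> (el F) x i j = F x i j"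
    by (auto simp: el_def)
qed

lemma uminus_exists:
  assumes a: "a \<in> carrier A"
  shows "\<exists>b\<in>carrier A. b \<oplus> a = \<zero>"
proof -
  have "continuous_map X euclidean (\<lambda>x. - \<rho> a x i j)" if "i < k" "j < k" for i j
    using that a by (intro continuous_map_minus rho_cont)
  then obtain b where b: "b \<in> carrier A" "\<And>x i j. \<lbrakk>x \<in> topspace X; i < k; j < k\<rbrakk> \<Longrightarrow> \<rho> b x i j = - \<rho> a x i j"
    using rho_surj[of "\<lambda>x i j. - \<rho> a x i j"] by blast
  then have "b \<oplus> a = \<zero>"
    using a by (intro rho_inj add_closed zero_closed) (simp_all add: rho_add rho_zero)
  then show ?thesis using b(1) by blast
qed

sublocale abelian_group A
proof (rule abelian_groupI)
  fix a b c assume abc: "a \<in> carrier A" "b \<in> carrier A" "c \<in> carrier A"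
  show "a \<oplus> b \<oplus> c = a \<oplus> (b \<oplus> c)" "a \<oplus> b = b \<oplus> a" "\<zero> \<oplus> a = a"
    by (rule rho_inj; simp add: abc add_closed zero_closed rho_add rho_zero)+
  show "\<exists>y\<in>carrier A. y \<oplus> a = \<zero>" by (rule uminus_exists[OF abc(1)])
qed (simp_all add: add_closed zero_closed)

lemma rho_minus:
  assumes "a \<in> carrier A" "b \<in> carrier A" "x \<in> topspace X" "i < k" "j < k"
  shows "\<rho> (a \<ominus> b) x i j = \<rho> a x i j - \<rho> b x i j"
proof -
  have "(\<ominus> b) \<oplus> b = \<zero>" using assms(2) by (rule l_neg)
  then have "\<rho> (\<ominus> b) x i j + \<rho> b x i j = 0"
    using assms rho_add[of "\<ominus> b" b x i j] rho_zero[of x i j] by simp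
  then show ?thesis
    using assms by (simp add: a_minus_def rho_add add_eq_0_iff)
qed

lemma rho_finsum:
  assumes "finite I" "\<And>i. i \<in> I \<Longrightarrow> f i \<in> carrier A" "x \<in> topspace X" "i < k" "j < k"
  shows "\<rho> (\<Oplus>m\<in>I. f m) x i j = (\<Sum>m\<in>I. \<rho> (f m) x i j)"
  using assms(1,2)
proof (induction I rule: finite_induct)
  case empty
  then show ?case using assms by (simp add: rho_zero)
next
  case (insert m I)
  then show ?case using assms(3-)
    by (subst finsum_insert) (auto simp: rho_add)
qed

lemma nrm_nonneg: "a \<in> carrier A \<Longrightarrow> 0 \<le> nrm A a"
  using nrm_le_iff[of a "nrm A a"] by simp

lemma bounded_op_nrm: "\<lbrakk>a \<in> carrier A; x \<in> topspace X\<rbrakk> \<Longrightarrow> bounded_op k k (\<rho> a x) (nrm A a)"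
  using nrm_le_iff[of a "nrm A a"] by simp

lemma rho_le_nrm: "\<lbrakk>a \<in> carrier A; x \<in> topspace X; i < k; j < k\<rbrakk> \<Longrightarrow> cmod (\<rho> a x i j) \<le> nrm A a"
  using bounded_op_entry bounded_op_nrm by blast

lemma nrm_le:
  assumes "a \<in> carrier A" "0 \<le> r" "\<And>x i j. \<lbrakk>x \<in> topspace X; i < k; j < k\<rbrakk> \<Longrightarrow> cmod (\<rho> a x i j) \<le> r"
  shows "nrm A a \<le> real k * real k * r"
  using assms by (auto simp: nrm_le_iff bounded_op_def intro!: vnorm_app_le)

lemma nrm_dist_eq: "\<lbrakk>a \<in> carrier A; b \<in> carrier A\<rbrakk> \<Longrightarrow> nrm_dist A a b = nrm A (a \<ominus> b)"
  by (simp add: nrm_dist_def)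

lemma nrm_add: "\<lbrakk>a \<in> carrier A; b \<in> carrier A\<rbrakk> \<Longrightarrow> nrm A (a \<oplus> b) \<le> nrm A a + nrm A b"
proof -
  assume ab: "a \<in> carrier A" "b \<in> carrier A"
  have "bounded_op k k (\<rho> (a \<oplus> b) x) (nrm A a + nrm A b)" if x: "x \<in> topspace X" for x
    unfolding bounded_op_def
  proof
    fix f
    have "vnorm k (app k (\<rho> (a \<oplus> b) x) f) = vnorm k (\<lambda>i. app k (\<rho> a x) f i + app k (\<rho> b x) f i)"
      by (rule vnorm_cong) (simp add: app_def rho_add ab x distrib_right sum.distrib)
    also have "\<dots> \<le> vnorm k (app k (\<rho> a x) f) + vnorm k (app k (\<rho> b x) f)"
      by (rule vnorm_triangle)
    also have "\<dots> \<le> nrm A a * vnorm k f + nrm A b * vnorm k f"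
      using bounded_op_nrm ab x unfolding bounded_op_def by (intro add_mono) auto
    finally show "vnorm k (app k (\<rho> (a \<oplus> b) x) f) \<le> (nrm A a + nrm A b) * vnorm k f"
      by (simp add: distrib_right)
  qed
  then show ?thesis using ab by (simp add: nrm_le_iff nrm_nonneg)
qed

sublocale Metric_space "carrier A" "nrm_dist A"
proof
  fix a b
  show "0 \<le> nrm_dist A a b" by (simp add: nrm_dist_def nrm_nonneg)
  show "nrm_dist A a b = nrm_dist A b a"
  proof (cases "a \<in> carrier A \<and> b \<in> carrier A")
    case True
    then have "nrm A (a \<ominus> b) \<le> r \<longleftrightarrow> nrm A (b \<ominus> a) \<le> r" for r
    proof -
      have "vnorm k (app k (\<rho> (a \<ominus> b) x) f) = vnorm k (app k (\<rho> (b \<ominus> a) x) f)" if x: "x \<in> topspace X" for x f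
      proof -
        have "vnorm k (app k (\<rho> (a \<ominus> b) x) f) = vnorm k (\<lambda>i. (-1) * app k (\<rho> (b \<ominus> a) x) f i)"
          by (rule vnorm_cong)
            (simp add: app_def rho_minus True x left_diff_distrib sum_subtractf)
        then show ?thesis by (simp only: vnorm_scale) simp
      qed
      then show ?thesis using True by (simp add: nrm_le_iff bounded_op_def)
    qed
    from this[of "nrm A (a \<ominus> b)"] this[of "nrm A (b \<ominus> a)"] show ?thesis
      using True by (simp add: nrm_dist_eq)
  qed (auto simp: nrm_dist_def)
next
  fix a b assume ab: "a \<in> carrier A" "b \<in> carrier A"
  have "nrm A (a \<ominus> b) \<le> 0 \<longleftrightarrow> a = b"
  proof
    assume le: "nrm A (a \<ominus> b) \<le> 0"
    have "\<rho> (a \<ominus> b) x i j = 0" if "x \<in> topspace X" "i < k" "j < k" for x i j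
      using order_trans[OF rho_le_nrm[of "a \<ominus> b" x i j] le] that ab by simp
    then show "a = b"
      using ab by (intro rho_inj) (simp_all add: rho_minus)
  next
    assume "a = b"
    then show "nrm A (a \<ominus> b) \<le> 0"
      using nrm_le[of "a \<ominus> b" 0] ab by (simp add: rho_minus)
  qed
  then show "nrm_dist A a b = 0 \<longleftrightarrow> a = b"
    using ab nrm_nonneg[of "a \<ominus> b"] by (auto simp: nrm_dist_eq)
next
  fix a b c assume abc: "a \<in> carrier A" "b \<in> carrier A" "c \<in> carrier A"
  have "a \<ominus> c = (a \<ominus> b) \<oplus> (b \<ominus> c)"
    using abc by (intro rho_inj) (simp_all add: rho_add rho_minus)
  then show "nrm_dist A a c \<le> nrm_dist A a b + nrm_dist A b c"
    using abc nrm_add[of "a \<ominus> b" "b \<ominus> c"] by (simp add: nrm_dist_eq)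
qed

lemma rho_le_dist:
  "\<lbrakk>a \<in> carrier A; b \<in> carrier A; x \<in> topspace X; i < k; j < k\<rbrakk> \<Longrightarrow> cmod (\<rho> a x i j - \<rho> b x i j) \<le> nrm_dist A a b"
  using rho_le_nrm[of "a \<ominus> b" x i j] by (simp add: nrm_dist_eq rho_minus)

text \<open>Together with \<open>rho_le_dist\<close> this makes the norm metric equivalent to the
  uniform distance of entries, so that topological arguments can be carried out entrywise.\<close>

lemma dist_le:
  assumes "a \<in> carrier A" "b \<in> carrier A" "0 \<le> r"
    "\<And>x i j. \<lbrakk>x \<in> topspace X; i < k; j < k\<rbrakk> \<Longrightarrow> cmod (\<rho> a x i j - \<rho> b x i j) \<le> r"
  shows "nrm_dist A a b \<le> real k * real k * r"
  using assms by (simp add: nrm_dist_eq rho_minus nrm_le)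

end

text \<open>The starting point, with scalars as 1 x 1 matrices. The only index below 1 is 0, so the
  evaluation map may ignore its indices.\<close>

lemma matrix_functions_cont_alg:
  assumes "compact_space X"
  shows "matrix_functions (cont_alg X) X 1 (\<lambda>f x i j. f x)"
proof -
  interpret R: ring "cont_alg X" by (rule ring_cont_alg)
  interpret C: unital_cstar_algebra "cont_alg X" by (rule unital_cstar_algebra_cont_alg[OF assms])
  have v1: "vnorm 1 f = cmod (f 0)" for f by (simp add: vnorm_def L2_set_def)
  have b1: "bounded_op 1 1 (\<lambda>i j. z) r \<longleftrightarrow> cmod z \<le> r" for z r
  proof
    assume "bounded_op 1 1 (\<lambda>i j. z) r"
    then show "cmod z \<le> r" using bounded_op_entry[of 1 1 "\<lambda>i j. z" r 0 0] by simp
  qed (simp add: bounded_op_def v1[unfolded One_nat_def] app_def norm_mult mult_right_mono)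
  show ?thesis
  proof (unfold_locales, goal_cases)
    case (7 a i j)
    then show ?case by (simp add: cont_alg_simps)
  next
    case (8 a b)
    then show ?case by (auto intro!: extensionalityI[of _ "topspace X"] simp: cont_alg_simps)
  next
    case (9 F)
    then show ?case
      by (intro bexI[of _ "\<lambda>x\<in>topspace X. F x 0 0"])
        (auto simp: cont_alg_simps continuous_map_restrict_topspace)
  next
    case (15 a r)
    then show ?case using nrm_cont_alg_le_iff[OF assms 15] by (simp add: b1[unfolded One_nat_def])
  qed (simp_all add: R.m_closed R.a_closed C.star_closed, simp_all add: cont_alg_simps mm_def id_mat_def)
qed

section \<open>Matrices over an algebra of matrix functions\<close>

lemma sum_blocks:
  fixes f :: "nat \<Rightarrow> nat \<Rightarrow> 'b::comm_monoid_add"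
  shows "(\<Sum>l<n * k. f (l div k) (l mod k)) = (\<Sum>m<n. \<Sum>r<k. f m r)"
proof -
  have "(\<Sum>l<n * k. f (l div k) (l mod k)) = (\<Sum>m<n. \<Sum>l\<in>{m * k..<m * k + k}. f (l div k) (l mod k))"
    by (rule sum.nat_group[symmetric])
  also have "\<dots> = (\<Sum>m<n. \<Sum>r<k. f m r)"
  proof (rule sum.cong[OF refl])
    fix m
    show "(\<Sum>l\<in>{m * k..<m * k + k}. f (l div k) (l mod k)) = (\<Sum>r<k. f m r)"
      by (rule sum.reindex_bij_witness[of _ "\<lambda>r. m * k + r" "\<lambda>l. l - m * k"])
        (auto simp: div_add1_eq[of "m * k"] le_iff_add)
  qed
  finally show ?thesis .
qed

lemma div_less_mod_less: "l < n * k \<Longrightarrow> l div k < n \<and> l mod k < (k::nat)"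
  by (metis less_mult_imp_div_less mod_less_divisor mult_0_right neq0_conv not_less_zero)

lemma mat_alg_simps:
  "carrier (mat_alg n A) = {a \<in> carrier_mat n n. \<forall>i<n. \<forall>j<n. a $$ (i, j) \<in> carrier A}"
  "a \<otimes>\<^bsub>mat_alg n A\<^esub> b = mat n n (\<lambda>(i, j). \<Oplus>\<^bsub>A\<^esub>k\<in>{..<n}. a $$ (i, k) \<otimes>\<^bsub>A\<^esub> b $$ (k, j))"
  "\<one>\<^bsub>mat_alg n A\<^esub> = mat n n (\<lambda>(i, j). if i = j then \<one>\<^bsub>A\<^esub> else \<zero>\<^bsub>A\<^esub>)"
  "\<zero>\<^bsub>mat_alg n A\<^esub> = mat n n (\<lambda>(i, j). \<zero>\<^bsub>A\<^esub>)"
  "a \<oplus>\<^bsub>mat_alg n A\<^esub> b = mat n n (\<lambda>(i, j). a $$ (i, j) \<oplus>\<^bsub>A\<^esub> b $$ (i, j))"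
  "star (mat_alg n A) a = mat n n (\<lambda>(i, j). star A (a $$ (j, i)))"
  "nrm (mat_alg n A) a = (SUP v\<in>{v \<in> col_carrier n A. col_nrm n A v \<le> 1}. col_nrm n A (mat_act n A a v))"
  by (simp_all add: mat_alg_def)

definition block_fun :: "nat \<Rightarrow> ('a \<Rightarrow> 'x \<Rightarrow> nat \<Rightarrow> nat \<Rightarrow> complex) \<Rightarrow> 'a mat \<Rightarrow> 'x \<Rightarrow> nat \<Rightarrow> nat \<Rightarrow> complex" where
  "block_fun k \<rho> a x i j = \<rho> (a $$ (i div k, j div k)) x (i mod k) (j mod k)"

definition block_col :: "nat \<Rightarrow> ('a \<Rightarrow> 'x \<Rightarrow> nat \<Rightarrow> nat \<Rightarrow> complex) \<Rightarrow> 'a vec \<Rightarrow> 'x \<Rightarrow> nat \<Rightarrow> nat \<Rightarrow> complex" where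
  "block_col k \<rho> v x i j = \<rho> (vec_index v (i div k)) x (i mod k) j"

context matrix_functions
begin

lemma col_carrier_index: "\<lbrakk>v \<in> col_carrier n A; i < n\<rbrakk> \<Longrightarrow> vec_index v i \<in> carrier A"
  by (simp add: col_carrier_def)

lemma mat_alg_index: "\<lbrakk>a \<in> carrier (mat_alg n A); i < n; j < n\<rbrakk> \<Longrightarrow> a $$ (i, j) \<in> carrier A"
  by (simp add: mat_alg_simps)

text \<open>At each point a column of n elements stacks to an (n k) x k matrix V, and the sum
  defining the column norm evaluates to V^* V. By \<open>bounded_op_square\<close> the
  Hilbert-module norm is thus the supremum of the operator norms of V.\<close>

lemma col_nrm_le_iff:
  assumes v: "v \<in> col_carrier n A" and r: "0 \<le> r"
  shows "col_nrm n A v \<le> r \<longleftrightarrow> (\<forall>x\<in>topspace X. bounded_op (n * k) k (block_col k \<rho> v x) r)"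
proof -
  define s where "s = (\<Oplus>i\<in>{..<n}. star A (vec_index v i) \<otimes> vec_index v i)"
  have vi: "vec_index v i \<in> carrier A" if "i < n" for i using v that by (rule col_carrier_index)
  then have cl: "star A (vec_index v i) \<otimes> vec_index v i \<in> carrier A" if "i \<in> {..<n}" for i
    using that by (simp add: mult_closed star_closed)
  have s: "s \<in> carrier A" unfolding s_def using cl by (intro finsum_closed) auto
  have "\<rho> s x i j = mm (n * k) (adj (block_col k \<rho> v x)) (block_col k \<rho> v x) i j"
    if x: "x \<in> topspace X" and ij: "i < k" "j < k" for x i j
  proof -
    have "\<rho> s x i j = (\<Sum>m<n. \<rho> (star A (vec_index v m) \<otimes> vec_index v m) x i j)"
      unfolding s_def by (rule rho_finsum[OF _ cl x ij]) simp_all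
    also have "\<dots> = (\<Sum>m<n. \<Sum>l<k. cnj (\<rho> (vec_index v m) x l i) * \<rho> (vec_index v m) x l j)"
      using x ij vi by (intro sum.cong refl) (simp add: rho_mult star_closed mm_def rho_star)
    also have "\<dots> = (\<Sum>l<n * k. cnj (\<rho> (vec_index v (l div k)) x (l mod k) i) * \<rho> (vec_index v (l div k)) x (l mod k) j)"
      by (rule sum_blocks[symmetric])
    finally show ?thesis by (simp add: mm_def adj_def block_col_def)
  qed
  then have "bounded_op k k (\<rho> s x) (r\<^sup>2) \<longleftrightarrow> bounded_op (n * k) k (block_col k \<rho> v x) r" if "x \<in> topspace X" for x
    using bounded_op_cong[of k k "\<rho> s x" "mm (n * k) (adj (block_col k \<rho> v x)) (block_col k \<rho> v x)"]
      bounded_op_square[OF r] that by simp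
  moreover have "col_nrm n A v \<le> r \<longleftrightarrow> nrm A s \<le> r\<^sup>2"
    unfolding col_nrm_def s_def[symmetric] using nrm_nonneg[OF s] r
    by (metis real_sqrt_le_iff real_sqrt_abs abs_of_nonneg)
  ultimately show ?thesis by (simp add: nrm_le_iff[OF s])
qed

lemma mat_act_closed:
  assumes "a \<in> carrier (mat_alg n A)" "v \<in> col_carrier n A"
  shows "mat_act n A a v \<in> col_carrier n A"
  using assms unfolding col_carrier_def mat_act_def
  by (auto intro!: finsum_closed mult_closed mat_alg_index)

lemma block_col_mat_act:
  assumes a: "a \<in> carrier (mat_alg n A)" and v: "v \<in> col_carrier n A"
    and x: "x \<in> topspace X" and ij: "i < n * k" "j < k"
  shows "block_col k \<rho> (mat_act n A a v) x i j = mm (n * k) (block_fun k \<rho> a x) (block_col k \<rho> v x) i j"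
proof -
  have i: "i div k < n" "i mod k < k" using div_less_mod_less[OF ij(1)] by auto
  have cl: "a $$ (i div k, m) \<otimes> vec_index v m \<in> carrier A" if "m \<in> {..<n}" for m
    using that i a v by (simp add: mult_closed mat_alg_index col_carrier_index)
  have "block_col k \<rho> (mat_act n A a v) x i j = (\<Sum>m<n. \<rho> (a $$ (i div k, m) \<otimes> vec_index v m) x (i mod k) j)"
    unfolding block_col_def mat_act_def index_vec[OF i(1)]
    by (rule rho_finsum[OF _ cl x i(2) ij(2)]) simp_all
  also have "\<dots> = (\<Sum>m<n. \<Sum>l<k. \<rho> (a $$ (i div k, m)) x (i mod k) l * \<rho> (vec_index v m) x l j)"
    using x ij i a v by (intro sum.cong refl) (simp add: rho_mult mm_def mat_alg_index col_carrier_index)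
  also have "\<dots> = mm (n * k) (block_fun k \<rho> a x) (block_col k \<rho> v x) i j"
    unfolding mm_def block_fun_def block_col_def by (rule sum_blocks[symmetric])
  finally show ?thesis .
qed

lemma block_fun_mult:
  assumes a: "a \<in> carrier (mat_alg n A)" and b: "b \<in> carrier (mat_alg n A)"
    and x: "x \<in> topspace X" and ij: "i < n * k" "j < n * k"
  shows "block_fun k \<rho> (a \<otimes>\<^bsub>mat_alg n A\<^esub> b) x i j = mm (n * k) (block_fun k \<rho> a x) (block_fun k \<rho> b x) i j"
proof -
  have i: "i div k < n" "i mod k < k" and j: "j div k < n" "j mod k < k"
    using ij div_less_mod_less by auto
  have cl: "a $$ (i div k, m) \<otimes> b $$ (m, j div k) \<in> carrier A" if "m \<in> {..<n}" for m
    using that i j a b by (simp add: mult_closed mat_alg_index)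
  have "block_fun k \<rho> (a \<otimes>\<^bsub>mat_alg n A\<^esub> b) x i j
      = \<rho> (\<Oplus>m\<in>{..<n}. a $$ (i div k, m) \<otimes> b $$ (m, j div k)) x (i mod k) (j mod k)"
    using i j by (simp add: block_fun_def mat_alg_simps)
  also have "\<dots> = (\<Sum>m<n. \<rho> (a $$ (i div k, m) \<otimes> b $$ (m, j div k)) x (i mod k) (j mod k))"
    by (rule rho_finsum[OF _ cl x i(2) j(2)]) simp_all
  also have "\<dots> = (\<Sum>m<n. \<Sum>l<k. \<rho> (a $$ (i div k, m)) x (i mod k) l * \<rho> (b $$ (m, j div k)) x l (j mod k))"
    using x i j a b by (intro sum.cong refl) (simp add: rho_mult mm_def mat_alg_index)
  also have "\<dots> = mm (n * k) (block_fun k \<rho> a x) (block_fun k \<rho> b x) i j"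
    unfolding mm_def block_fun_def by (rule sum_blocks[symmetric])
  finally show ?thesis .
qed

lemma col_act_bounded_iff:
  assumes a: "a \<in> carrier (mat_alg n A)" and r: "0 \<le> r"
  shows "(\<forall>v\<in>{v \<in> col_carrier n A. col_nrm n A v \<le> 1}. col_nrm n A (mat_act n A a v) \<le> r)
    \<longleftrightarrow> (\<forall>x\<in>topspace X. bounded_op (n * k) (n * k) (block_fun k \<rho> a x) r)" (is "?L \<longleftrightarrow> ?R")
proof -
  have iff: "col_nrm n A (mat_act n A a v) \<le> r
      \<longleftrightarrow> (\<forall>x\<in>topspace X. bounded_op (n * k) k (mm (n * k) (block_fun k \<rho> a x) (block_col k \<rho> v x)) r)"
    if v: "v \<in> col_carrier n A" for v
  proof -
    have "bounded_op (n * k) k (block_col k \<rho> (mat_act n A a v) x) r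
        \<longleftrightarrow> bounded_op (n * k) k (mm (n * k) (block_fun k \<rho> a x) (block_col k \<rho> v x)) r"
      if x: "x \<in> topspace X" for x
      by (rule bounded_op_cong) (rule block_col_mat_act[OF a v x])
    then show ?thesis by (simp add: col_nrm_le_iff[OF mat_act_closed[OF a v] r])
  qed
  show ?thesis
  proof
    assume R: ?R
    have "bounded_op (n * k) k (mm (n * k) (block_fun k \<rho> a x) (block_col k \<rho> v x)) r"
      if v: "v \<in> col_carrier n A" "col_nrm n A v \<le> 1" and x: "x \<in> topspace X" for v x
      unfolding bounded_op_def
    proof
      fix f
      have "vnorm (n * k) (app k (mm (n * k) (block_fun k \<rho> a x) (block_col k \<rho> v x)) f)
          \<le> r * vnorm (n * k) (app k (block_col k \<rho> v x) f)"
        using R x by (simp add: app_mm bounded_op_def)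
      also have "\<dots> \<le> r * vnorm k f"
        using col_nrm_le_iff[OF v(1), of 1] v(2) x r
        by (intro mult_left_mono) (auto simp: bounded_op_def)
      finally show "vnorm (n * k) (app k (mm (n * k) (block_fun k \<rho> a x) (block_col k \<rho> v x)) f) \<le> r * vnorm k f" .
    qed
    then show ?L using iff by blast
  next
    assume L: ?L
    have "vnorm (n * k) (app (n * k) (block_fun k \<rho> a x) f) \<le> r * vnorm (n * k) f"
      if x: "x \<in> topspace X" for x f
    proof (cases "vnorm (n * k) f = 0")
      case True
      then have "vnorm (n * k) (app (n * k) (block_fun k \<rho> a x) f) = 0"
        by (auto simp: vnorm_eq_0 app_def)
      then show ?thesis using True by simp
    next
      case False
      define t where "t = vnorm (n * k) f"
      have t: "0 < t" using False vnorm_nonneg[of "n * k" f] unfolding t_def by linarith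
      \<comment> \<open>A vector f testing the bound at the point x is turned into a column constant
        on X: the matrix with f / |f| as first column and zeros elsewhere. It has operator norm 1
        and maps e_0 to f / |f|, so the bound on columns evaluated at e_0 is the bound for
        f.\<close>
      define V where "V = (\<lambda>i j::nat. if j = 0 then inverse (complex_of_real t) * f i else 0)"
      define v where "v = vec n (\<lambda>m. el (\<lambda>x i j. V (m * k + i) j))"
      have "el (\<lambda>x i j. V (m * k + i) j) \<in> carrier A" for m by (rule el) simp
      then have vc: "v \<in> col_carrier n A" by (simp add: v_def col_carrier_def)
      have V: "block_col k \<rho> v y i j = V i j" if "y \<in> topspace X" "i < n * k" "j < k" for y i j
        using that div_less_mod_less[OF that(2)] by (simp add: block_col_def v_def el(2))
      have appV: "app k V g i = (inverse (complex_of_real t) * g 0) * f i" for g i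
      proof -
        have "app k V g i = (\<Sum>l<k. if l = 0 then (inverse (complex_of_real t) * g 0) * f i else 0)"
          unfolding app_def V_def by (rule sum.cong) auto
        then show ?thesis using dim_pos by simp
      qed
      have nV: "vnorm (n * k) (app k V g) = cmod (g 0)" for g
        unfolding appV vnorm_scale using t by (simp add: norm_mult norm_inverse t_def[symmetric])
      have "bounded_op (n * k) k V 1"
        unfolding bounded_op_def nV using component_le_vnorm[OF dim_pos] by simp
      moreover have "bounded_op (n * k) k (block_col k \<rho> v y) 1 \<longleftrightarrow> bounded_op (n * k) k V 1"
        if "y \<in> topspace X" for y
        by (rule bounded_op_cong) (rule V[OF that])
      ultimately have "col_nrm n A v \<le> 1" by (simp add: col_nrm_le_iff[OF vc])
      then have "bounded_op (n * k) k (mm (n * k) (block_fun k \<rho> a x) (block_col k \<rho> v x)) r"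
        using L iff[OF vc] vc x by blast
      then have "vnorm (n * k) (app (n * k) (block_fun k \<rho> a x) (app k (block_col k \<rho> v x) (bvec 0))) \<le> r"
        using vnorm_bvec[OF dim_pos] unfolding bounded_op_def app_mm by (metis mult.right_neutral)
      moreover have "vnorm (n * k) (app (n * k) (block_fun k \<rho> a x) (app k (block_col k \<rho> v x) (bvec 0)))
          = vnorm (n * k) (\<lambda>i. inverse (complex_of_real t) * app (n * k) (block_fun k \<rho> a x) f i)"
      proof (rule vnorm_cong)
        fix i
        have "app k (block_col k \<rho> v x) (bvec 0) m = inverse (complex_of_real t) * f m" if "m < n * k" for m
          using that x dim_pos by (simp add: app_bvec V) (simp add: V_def)
        then show "app (n * k) (block_fun k \<rho> a x) (app k (block_col k \<rho> v x) (bvec 0)) i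
            = inverse (complex_of_real t) * app (n * k) (block_fun k \<rho> a x) f i"
          by (subst app_linear(3)[symmetric, THEN fun_cong]) (rule app_cong, auto)
      qed
      moreover have "cmod (inverse (complex_of_real t)) = inverse t"
        using t by (simp add: norm_inverse)
      ultimately have "inverse t * vnorm (n * k) (app (n * k) (block_fun k \<rho> a x) f) \<le> r"
        by (simp only: vnorm_scale)
      then show ?thesis
        using t unfolding t_def[symmetric] by (simp add: field_simps)
    qed
    then show ?R by (simp add: bounded_op_def)
  qed
qed

text \<open>The norm is a conditionally complete supremum, meaningful only for a nonempty bounded
  set. The zero column provides a member, which also excludes negative \<open>r\<close>, and the sum
  \<open>B\<close> of the norms of all entries provides a bound.\<close>

lemma nrm_mat_alg_le_iff:
  assumes a: "a \<in> carrier (mat_alg n A)"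
  shows "nrm (mat_alg n A) a \<le> r \<longleftrightarrow> 0 \<le> r \<and> (\<forall>x\<in>topspace X. bounded_op (n * k) (n * k) (block_fun k \<rho> a x) r)"
proof -
  let ?S = "{v \<in> col_carrier n A. col_nrm n A v \<le> 1}"
  let ?g = "\<lambda>v. col_nrm n A (mat_act n A a v)"
  define z where "z = vec n (\<lambda>_. \<zero>)"
  have z: "z \<in> col_carrier n A" by (simp add: z_def col_carrier_def)
  have "block_col k \<rho> z x i j = 0" if "x \<in> topspace X" "i < n * k" "j < k" for x i j
    using that div_less_mod_less[OF that(2)] by (simp add: block_col_def z_def rho_zero)
  then have "bounded_op (n * k) k (block_col k \<rho> z x) 1" if "x \<in> topspace X" for x
    using bounded_op_cong[of "n * k" k "block_col k \<rho> z x" "\<lambda>_ _. 0" 1] that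
    by (simp add: bounded_op_def app_def vnorm_nonneg vnorm_eq_0[THEN iffD2])
  then have zS: "z \<in> ?S" using z by (simp add: col_nrm_le_iff)
  have g_nonneg: "0 \<le> ?g v" if "v \<in> ?S" for v
  proof -
    have "?g v = sqrt (nrm A (\<Oplus>i\<in>{..<n}. star A (vec_index (mat_act n A a v) i) \<otimes> vec_index (mat_act n A a v) i))"
      by (simp add: col_nrm_def)
    also have "0 \<le> \<dots>"
      using mat_act_closed[OF a, of v] that
      by (intro real_sqrt_ge_zero nrm_nonneg finsum_closed) (auto intro!: mult_closed star_closed col_carrier_index)
    finally show ?thesis .
  qed
  define B where "B = (\<Sum>i<n. \<Sum>j<n. nrm A (a $$ (i, j)))"
  have nn: "0 \<le> nrm A (a $$ (i, j))" if "i < n" "j < n" for i j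
    using that a by (intro nrm_nonneg mat_alg_index)
  have "cmod (block_fun k \<rho> a x i j) \<le> B" if "x \<in> topspace X" "i < n * k" "j < n * k" for x i j
  proof -
    have i: "i div k < n" "i mod k < k" and j: "j div k < n" "j mod k < k"
      using that div_less_mod_less by auto
    have "cmod (block_fun k \<rho> a x i j) \<le> nrm A (a $$ (i div k, j div k))"
      unfolding block_fun_def using a i j that by (intro rho_le_nrm mat_alg_index)
    also have "\<dots> \<le> (\<Sum>j<n. nrm A (a $$ (i div k, j)))"
      using j nn i by (intro member_le_sum) auto
    also have "\<dots> \<le> B" unfolding B_def
      using i nn by (intro member_le_sum[of "i div k" "{..<n}" "\<lambda>i. \<Sum>j<n. nrm A (a $$ (i, j))"] sum_nonneg) auto
    finally show ?thesis .
  qed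
  then have "\<forall>x\<in>topspace X. bounded_op (n * k) (n * k) (block_fun k \<rho> a x) (real (n * k) * real (n * k) * B)"
    unfolding bounded_op_def by (auto intro!: vnorm_app_le simp del: of_nat_mult)
  moreover have "0 \<le> B" unfolding B_def using nn by (intro sum_nonneg) auto
  ultimately have "\<forall>v\<in>?S. ?g v \<le> real (n * k) * real (n * k) * B"
    by (subst col_act_bounded_iff[OF a]) auto
  then have bdd: "bdd_above (?g ` ?S)" by (intro bdd_aboveI2) auto
  have sup: "nrm (mat_alg n A) a \<le> r \<longleftrightarrow> (\<forall>v\<in>?S. ?g v \<le> r)"
    unfolding mat_alg_simps using zS bdd by (intro cSUP_le_iff) auto
  show ?thesis
  proof (cases "0 \<le> r")
    case True
    then show ?thesis using sup col_act_bounded_iff[OF a True] by simp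
  next
    case False
    then show ?thesis using sup zS g_nonneg[OF zS] by force
  qed
qed

text \<open>Stability under forming matrices. Applied first to C(X) and then to M_n(C(X)), it brings
  all the groups in the definition of \<open>Dur\<close> under the same lemmas.\<close>

theorem matrix_functions_mat_alg:
  assumes n: "0 < n"
  shows "matrix_functions (mat_alg n A) X (n * k) (block_fun k \<rho>)"
proof (unfold_locales, goal_cases)
  case 1
  then show ?case using n dim_pos by simp
next
  case (7 a i j)
  then show ?case unfolding block_fun_def
    using div_less_mod_less by (intro rho_cont mat_alg_index) auto
next
  case (8 a b)
  have "a $$ (i, j) = b $$ (i, j)" if ij: "i < n" "j < n" for i j
  proof (rule rho_inj)
    show "a $$ (i, j) \<in> carrier A" "b $$ (i, j) \<in> carrier A" using 8 ij by (auto intro: mat_alg_index)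
    fix x p q assume "x \<in> topspace X" and pq: "p < k" "q < k"
    moreover have "p + i * k < n * k" "q + j * k < n * k"
      using ij pq dim_pos by (auto simp: less_mult_imp_div_less intro!: div_less_iff_less_mult[THEN iffD1])
    ultimately show "\<rho> (a $$ (i, j)) x p q = \<rho> (b $$ (i, j)) x p q"
      using 8(3)[of x "p + i * k" "q + j * k"] by (simp add: block_fun_def)
  qed
  then show ?case using 8(1,2) by (intro eq_matI) (auto simp: mat_alg_simps)
next
  case (9 F)
  define a where "a = mat n n (\<lambda>(m, l). el (\<lambda>x p q. F x (p + m * k) (q + l * k)))"
  have cont: "continuous_map X euclidean (\<lambda>x. F x (p + m * k) (q + l * k))"
    if "p < k" "q < k" "m < n" "l < n" for m l p q
    using that dim_pos by (intro 9) (auto intro!: div_less_iff_less_mult[THEN iffD1])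
  have "a \<in> carrier (mat_alg n A)"
    by (auto simp: a_def mat_alg_simps intro!: el cont)
  moreover have "block_fun k \<rho> a x i j = F x i j" if "x \<in> topspace X" "i < n * k" "j < n * k" for x i j
    using that div_less_mod_less[of i n k] div_less_mod_less[of j n k]
    by (simp add: block_fun_def a_def el(2) cont)
  ultimately show ?case by blast
next
  case (10 a b x i j)
  then show ?case by (rule block_fun_mult)
next
  case (11 a b x i j)
  then show ?case using div_less_mod_less[of i n k] div_less_mod_less[of j n k]
    by (simp add: block_fun_def mat_alg_index) (simp add: mat_alg_simps rho_add)
next
  case (12 x i j)
  have "i = j \<longleftrightarrow> i div k = j div k \<and> i mod k = j mod k" by (metis div_mult_mod_eq)
  then show ?case using 12 div_less_mod_less[of i n k] div_less_mod_less[of j n k]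
    by (auto simp: block_fun_def mat_alg_simps rho_one rho_zero id_mat_def)
next
  case (13 x i j)
  then show ?case using div_less_mod_less[of i n k] div_less_mod_less[of j n k]
    by (simp add: block_fun_def mat_alg_simps rho_zero)
next
  case (14 a x i j)
  then show ?case using div_less_mod_less[of i n k] div_less_mod_less[of j n k]
    by (simp add: block_fun_def mat_alg_simps rho_star)
next
  case (15 a r)
  then show ?case by (rule nrm_mat_alg_le_iff)
qed (auto simp: mat_alg_simps intro!: finsum_closed mult_closed add_closed one_closed zero_closed star_closed)

end

section \<open>The unitary group\<close>

lemma unitary_group_simps:
  "carrier (unitary_group A) = {u \<in> carrier A. star A u \<otimes>\<^bsub>A\<^esub> u = \<one>\<^bsub>A\<^esub> \<and> u \<otimes>\<^bsub>A\<^esub> star A u = \<one>\<^bsub>A\<^esub>}"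
  "u \<otimes>\<^bsub>unitary_group A\<^esub> v = u \<otimes>\<^bsub>A\<^esub> v" "\<one>\<^bsub>unitary_group A\<^esub> = \<one>\<^bsub>A\<^esub>"
  by (simp_all add: unitary_group_def)

lemma unitary_entry_le_1:
  assumes "unitary k M" "i < k" "j < k"
  shows "cmod (M i j) \<le> 1"
proof (rule bounded_op_entry[OF _ assms(2,3)])
  have "(vnorm k (app k M f))\<^sup>2 = (vnorm k f)\<^sup>2" for f
    using unitary_ip[OF assms(1), of f f] unfolding ip_self of_real_eq_iff .
  then have "vnorm k (app k M f) = vnorm k f" for f
    using vnorm_nonneg by (metis power2_eq_imp_eq)
  then show "bounded_op k k M 1" by (simp add: bounded_op_def)
qed

text \<open>Telescoping, M N - M' N' = M (N - N') + (M - M') N'. Only M and N' need entries bounded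
  by 1, which holds for unitaries.\<close>

lemma mm_entry_diff_le:
  assumes "\<And>l. l < k \<Longrightarrow> cmod (M i l - M' i l) \<le> r" "\<And>l. l < k \<Longrightarrow> cmod (N l j - N' l j) \<le> s"
    "\<And>l. l < k \<Longrightarrow> cmod (M i l) \<le> 1" "\<And>l. l < k \<Longrightarrow> cmod (N' l j) \<le> 1"
  shows "cmod (mm k M N i j - mm k M' N' i j) \<le> real k * (r + s)"
proof -
  have "mm k M N i j - mm k M' N' i j = (\<Sum>l<k. M i l * (N l j - N' l j) + (M i l - M' i l) * N' l j)"
    by (simp add: mm_def algebra_simps flip: sum_subtractf)
  also have "cmod \<dots> \<le> (\<Sum>l<k. 1 * s + r * 1)"
  proof (intro order_trans[OF norm_sum] sum_mono norm_triangle_le add_mono)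
    fix l assume "l \<in> {..<k}"
    then show "cmod (M i l * (N l j - N' l j)) \<le> 1 * s" "cmod ((M i l - M' i l) * N' l j) \<le> r * 1"
      unfolding norm_mult using assms order_trans[OF norm_ge_zero assms(1)] by (intro mult_mono; simp)+
  qed
  also have "\<dots> = real k * (r + s)" by simp
  finally show ?thesis .
qed

context matrix_functions
begin

lemma unitary_group_iff:
  "u \<in> carrier (unitary_group A) \<longleftrightarrow> u \<in> carrier A \<and> (\<forall>x\<in>topspace X. unitary k (\<rho> u x))"
proof (cases "u \<in> carrier A")
  case True
  have adj: "mm k (adj (\<rho> u x)) (\<rho> u x) i j = \<rho> (star A u \<otimes> u) x i j"
    "mm k (\<rho> u x) (adj (\<rho> u x)) i j = \<rho> (u \<otimes> star A u) x i j"
    if "x \<in> topspace X" "i < k" "j < k" for x i j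
    using that True by (simp_all add: rho_mult star_closed mm_def adj_def rho_star)
  have "star A u \<otimes> u = \<one> \<longleftrightarrow> (\<forall>x\<in>topspace X. \<forall>i<k. \<forall>j<k. \<rho> (star A u \<otimes> u) x i j = id_mat i j)"
    "u \<otimes> star A u = \<one> \<longleftrightarrow> (\<forall>x\<in>topspace X. \<forall>i<k. \<forall>j<k. \<rho> (u \<otimes> star A u) x i j = id_mat i j)"
    using True by (auto simp: rho_one intro!: rho_inj mult_closed star_closed one_closed)
  then show ?thesis
    using True adj by (auto simp: unitary_group_simps unitary_def)
qed (simp add: unitary_group_simps)

lemma unitary_carrier: "u \<in> carrier (unitary_group A) \<Longrightarrow> u \<in> carrier A"
  by (simp add: unitary_group_simps)

lemma unitary_rho: "\<lbrakk>u \<in> carrier (unitary_group A); x \<in> topspace X\<rbrakk> \<Longrightarrow> unitary k (\<rho> u x)"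
  by (simp add: unitary_group_iff)

lemma mult_assoc: "\<lbrakk>a \<in> carrier A; b \<in> carrier A; c \<in> carrier A\<rbrakk> \<Longrightarrow> a \<otimes> b \<otimes> c = a \<otimes> (b \<otimes> c)"
proof (rule rho_inj)
  fix x i j assume abc: "a \<in> carrier A" "b \<in> carrier A" "c \<in> carrier A" and x: "x \<in> topspace X" "i < k" "j < k"
  have "\<rho> (a \<otimes> b \<otimes> c) x i j = mm k (mm k (\<rho> a x) (\<rho> b x)) (\<rho> c x) i j"
    using abc x by (simp add: rho_mult mult_closed) (rule mm_cong[OF _ _ x(2,3)]; simp add: abc x rho_mult)
  also have "\<dots> = mm k (\<rho> a x) (mm k (\<rho> b x) (\<rho> c x)) i j" by (rule mm_assoc)
  also have "\<dots> = \<rho> (a \<otimes> (b \<otimes> c)) x i j"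
    using abc x by (simp add: rho_mult mult_closed) (rule mm_cong[OF _ _ x(2,3)]; simp add: abc x rho_mult)
  finally show "\<rho> (a \<otimes> b \<otimes> c) x i j = \<rho> (a \<otimes> (b \<otimes> c)) x i j" .
qed (simp_all add: mult_closed)

lemma one_mult: "a \<in> carrier A \<Longrightarrow> \<one> \<otimes> a = a" "a \<in> carrier A \<Longrightarrow> a \<otimes> \<one> = a"
proof -
  assume a: "a \<in> carrier A"
  show "\<one> \<otimes> a = a"
  proof (rule rho_inj)
    fix x i j assume x: "x \<in> topspace X" "i < k" "j < k"
    have "\<rho> (\<one> \<otimes> a) x i j = mm k id_mat (\<rho> a x) i j"
      using a x by (simp add: rho_mult one_closed) (rule mm_cong[OF _ _ x(2,3)]; simp add: x rho_one)
    then show "\<rho> (\<one> \<otimes> a) x i j = \<rho> a x i j" using x by (simp add: mm_id)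
  qed (simp_all add: a mult_closed one_closed)
  show "a \<otimes> \<one> = a"
  proof (rule rho_inj)
    fix x i j assume x: "x \<in> topspace X" "i < k" "j < k"
    have "\<rho> (a \<otimes> \<one>) x i j = mm k (\<rho> a x) id_mat i j"
      using a x by (simp add: rho_mult one_closed) (rule mm_cong[OF _ _ x(2,3)]; simp add: x rho_one)
    then show "\<rho> (a \<otimes> \<one>) x i j = \<rho> a x i j" using x by (simp add: mm_id)
  qed (simp_all add: a mult_closed one_closed)
qed

lemma star_star: "a \<in> carrier A \<Longrightarrow> star A (star A a) = a"
  by (rule rho_inj) (simp_all add: star_closed rho_star)

lemma star_mult: "\<lbrakk>a \<in> carrier A; b \<in> carrier A\<rbrakk> \<Longrightarrow> star A (a \<otimes> b) = star A b \<otimes> star A a"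
  by (rule rho_inj) (simp_all add: star_closed mult_closed rho_star rho_mult mm_def mult.commute)

lemma star_one: "star A \<one> = \<one>"
  by (rule rho_inj) (simp_all add: star_closed one_closed rho_star rho_one id_mat_def)

lemma star_unitary: "u \<in> carrier (unitary_group A) \<Longrightarrow> star A u \<in> carrier (unitary_group A)"
  by (simp add: unitary_group_simps star_closed star_star)

sublocale UG: group "unitary_group A"
  rewrites "monoid.mult (unitary_group A) = monoid.mult A" and "one (unitary_group A) = \<one>"
proof -
  show "group (unitary_group A)"
  proof (rule groupI)
    fix u v assume "u \<in> carrier (unitary_group A)" "v \<in> carrier (unitary_group A)"
    then have u: "u \<in> carrier A" "star A u \<in> carrier A" "star A u \<otimes> u = \<one>" "u \<otimes> star A u = \<one>"
      and v: "v \<in> carrier A" "star A v \<in> carrier A" "star A v \<otimes> v = \<one>" "v \<otimes> star A v = \<one>"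
      by (auto simp: unitary_group_simps star_closed)
    have "star A v \<otimes> star A u \<otimes> (u \<otimes> v) = star A v \<otimes> ((star A u \<otimes> u) \<otimes> v)"
      using u(1,2) v(1,2) by (simp add: mult_assoc mult_closed)
    moreover have "u \<otimes> v \<otimes> (star A v \<otimes> star A u) = u \<otimes> ((v \<otimes> star A v) \<otimes> star A u)"
      using u(1,2) v(1,2) by (simp add: mult_assoc mult_closed)
    ultimately show "u \<otimes>\<^bsub>unitary_group A\<^esub> v \<in> carrier (unitary_group A)"
      using u v by (simp add: unitary_group_simps mult_closed star_mult one_mult)
  next
    fix u assume "u \<in> carrier (unitary_group A)"
    then show "\<exists>v\<in>carrier (unitary_group A). v \<otimes>\<^bsub>unitary_group A\<^esub> u = \<one>\<^bsub>unitary_group A\<^esub>"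
      using star_unitary by (intro bexI[of _ "star A u"]) (auto simp: unitary_group_simps)
  qed (simp_all add: unitary_group_simps mult_assoc one_mult one_closed star_one)
qed (simp_all add: unitary_group_def)

lemma inv_unitary: "u \<in> carrier (unitary_group A) \<Longrightarrow> inv\<^bsub>unitary_group A\<^esub> u = star A u"
  by (rule UG.inv_equality) (auto simp: star_unitary, simp add: unitary_group_simps)

lemma unitary_mult_app:
  assumes "u \<in> carrier A" "v \<in> carrier A" "x \<in> topspace X" "i < k"
  shows "app k (\<rho> (u \<otimes> v) x) f i = app k (\<rho> u x) (app k (\<rho> v x) f) i"
  using app_eqI[of k k "\<rho> (u \<otimes> v) x" "mm k (\<rho> u x) (\<rho> v x)" i f] assms by (simp add: rho_mult app_mm)

section \<open>Continuous families of reflections\<close>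

definition unit_field :: "('x \<Rightarrow> nat \<Rightarrow> complex) \<Rightarrow> bool" where
  "unit_field p \<longleftrightarrow> (\<forall>i<k. continuous_map X euclidean (\<lambda>x. p x i)) \<and> (\<forall>x\<in>topspace X. vnorm k (p x) = 1)"

text \<open>Boundedness makes t |-> cis (t * \<theta> x) Lipschitz uniformly in x, so that scaling
  the phase connects a reflection to 1 in norm.\<close>

definition phase :: "('x \<Rightarrow> real) \<Rightarrow> bool" where
  "phase \<theta> \<longleftrightarrow> continuous_map X euclidean \<theta> \<and> (\<exists>B. \<forall>x\<in>topspace X. \<bar>\<theta> x\<bar> \<le> B)"

definition reflection :: "('x \<Rightarrow> nat \<Rightarrow> complex) \<Rightarrow> ('x \<Rightarrow> real) \<Rightarrow> 'a" where
  "reflection p \<theta> = el (\<lambda>x. hrefl (p x) (cis (\<theta> x)))"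

lemma unit_field_bvec: "j < k \<Longrightarrow> unit_field (\<lambda>_. bvec j)"
  by (simp add: unit_field_def vnorm_bvec)

lemma phase_const: "phase (\<lambda>_. c)"
  by (auto simp: phase_def)

lemma phase_add: "\<lbrakk>phase \<theta>; phase \<eta>\<rbrakk> \<Longrightarrow> phase (\<lambda>x. \<theta> x + \<eta> x)"
  unfolding phase_def by (auto intro!: continuous_map_add) (meson abs_triangle_ineq add_mono order_trans)

lemma phase_uminus: "phase \<theta> \<Longrightarrow> phase (\<lambda>x. - \<theta> x)"
  by (auto simp: phase_def intro!: continuous_map_minus)

lemma phase_scale: "phase \<theta> \<Longrightarrow> phase (\<lambda>x. t * \<theta> x)"
  unfolding phase_def
  by (auto intro!: continuous_map_real_mult_left simp: abs_mult) (meson abs_ge_zero mult_left_mono)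

lemma rho_reflection:
  assumes "unit_field p" "phase \<theta>"
  shows "reflection p \<theta> \<in> carrier A" "\<lbrakk>x \<in> topspace X; i < k; j < k\<rbrakk> \<Longrightarrow> \<rho> (reflection p \<theta>) x i j = hrefl (p x) (cis (\<theta> x)) i j"
proof -
  have c: "continuous_map X euclidean (\<lambda>x. hrefl (p x) (cis (\<theta> x)) i j)" if "i < k" "j < k" for i j
  proof -
    have "continuous_map X euclidean (\<lambda>x. p x i)" "continuous_map X euclidean (\<lambda>x. p x j)"
      "continuous_map X euclidean \<theta>" using assms that by (auto simp: unit_field_def phase_def)
    then show ?thesis unfolding hrefl_def cis_conv_exp continuous_map_atin
      by (auto intro!: tendsto_intros)
  qed
  show "reflection p \<theta> \<in> carrier A" "\<lbrakk>x \<in> topspace X; i < k; j < k\<rbrakk> \<Longrightarrow> \<rho> (reflection p \<theta>) x i j = hrefl (p x) (cis (\<theta> x)) i j"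
    unfolding reflection_def using el[OF c] by auto
qed

lemma reflection_unitary:
  assumes "unit_field p" "phase \<theta>"
  shows "reflection p \<theta> \<in> carrier (unitary_group A)"
proof -
  have "unitary k (\<rho> (reflection p \<theta>) x)" if x: "x \<in> topspace X" for x
  proof -
    have "unitary k (hrefl (p x) (cis (\<theta> x)))"
      using assms x by (intro unitary_hrefl) (auto simp: unit_field_def)
    moreover have "mm k (adj (\<rho> (reflection p \<theta>) x)) (\<rho> (reflection p \<theta>) x) i j = mm k (adj (hrefl (p x) (cis (\<theta> x)))) (hrefl (p x) (cis (\<theta> x))) i j"
      "mm k (\<rho> (reflection p \<theta>) x) (adj (\<rho> (reflection p \<theta>) x)) i j = mm k (hrefl (p x) (cis (\<theta> x))) (adj (hrefl (p x) (cis (\<theta> x)))) i j"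
      if "i < k" "j < k" for i j
      by (rule mm_cong[OF _ _ that]; simp add: adj_def rho_reflection[OF assms] x)+
    ultimately show ?thesis by (simp add: unitary_def)
  qed
  then show ?thesis by (simp add: unitary_group_iff rho_reflection[OF assms])
qed

lemma reflection_eqI:
  assumes "unit_field p" "phase \<theta>" "a \<in> carrier A"
    "\<And>x i j. \<lbrakk>x \<in> topspace X; i < k; j < k\<rbrakk> \<Longrightarrow> \<rho> a x i j = hrefl (p x) (cis (\<theta> x)) i j"
  shows "a = reflection p \<theta>"
  using assms by (intro rho_inj) (simp_all add: rho_reflection)

lemma reflection_mult:
  assumes "unit_field p" "phase \<theta>" "phase \<eta>"
  shows "reflection p \<theta> \<otimes> reflection p \<eta> = reflection p (\<lambda>x. \<theta> x + \<eta> x)"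
proof (rule reflection_eqI)
  fix x i j assume x: "x \<in> topspace X" "i < k" "j < k"
  have "\<rho> (reflection p \<theta> \<otimes> reflection p \<eta>) x i j = mm k (hrefl (p x) (cis (\<theta> x))) (hrefl (p x) (cis (\<eta> x))) i j"
    using assms x by (simp add: rho_mult rho_reflection) (rule mm_cong[OF _ _ x(2,3)]; simp add: x rho_reflection)
  then show "\<rho> (reflection p \<theta> \<otimes> reflection p \<eta>) x i j = hrefl (p x) (cis (\<theta> x + \<eta> x)) i j"
    using assms x by (simp add: hrefl_mult unit_field_def cis_mult)
qed (simp_all add: assms phase_add mult_closed rho_reflection)

lemma reflection_zero: "unit_field p \<Longrightarrow> reflection p (\<lambda>_. 0) = \<one>"
  by (rule reflection_eqI[symmetric]) (simp_all add: phase_const one_closed rho_one hrefl_one)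

lemma reflection_inv:
  assumes "unit_field p" "phase \<theta>"
  shows "inv\<^bsub>unitary_group A\<^esub> (reflection p \<theta>) = reflection p (\<lambda>x. - \<theta> x)"
  using assms by (intro UG.inv_equality) (simp_all add: reflection_mult phase_uminus reflection_zero reflection_unitary)

lemma reflection_pi_inv: "unit_field p \<Longrightarrow> inv\<^bsub>unitary_group A\<^esub> (reflection p (\<lambda>_. pi)) = reflection p (\<lambda>_. pi)"
  by (subst reflection_inv) (auto simp: phase_const cis_conv_exp[of "-pi"] exp_minus reflection_def simp flip: cis_conv_exp)

lemma reflection_cong:
  assumes "\<And>x i. \<lbrakk>x \<in> topspace X; i < k\<rbrakk> \<Longrightarrow> p x i = q x i" "unit_field p" "unit_field q" "phase \<theta>"
  shows "reflection p \<theta> = reflection q \<theta>"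
  using assms by (intro reflection_eqI) (simp_all add: rho_reflection hrefl_def)

lemma unit_field_uminus: "unit_field p \<Longrightarrow> unit_field (\<lambda>x i. - p x i)"
  using vnorm_scale[of k "-1"] by (auto simp: unit_field_def intro!: continuous_map_minus)

lemma reflection_uminus: "\<lbrakk>unit_field p; phase \<theta>\<rbrakk> \<Longrightarrow> reflection (\<lambda>x i. - p x i) \<theta> = reflection p \<theta>"
  by (rule reflection_eqI) (simp_all add: unit_field_uminus rho_reflection hrefl_uminus)

lemma unit_field_app:
  assumes "u \<in> carrier (unitary_group A)" "unit_field p"
  shows "unit_field (\<lambda>x. app k (\<rho> u x) (p x))"
proof -
  have "vnorm k (app k (\<rho> u x) (p x)) = 1" if x: "x \<in> topspace X" for x
    using assms x unitary_ip[OF unitary_rho[OF assms(1) x], of "p x" "p x"]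
    by (intro vnorm_eq_1I) (simp add: ip_self unit_field_def)
  then show ?thesis using assms unfolding unit_field_def app_def
    by (auto intro!: continuous_map_sum continuous_map_complex_mult rho_cont unitary_carrier)
qed

lemma reflection_conj:
  assumes u: "u \<in> carrier (unitary_group A)" and "unit_field p" "phase \<theta>"
  shows "u \<otimes> reflection p \<theta> \<otimes> inv\<^bsub>unitary_group A\<^esub> u = reflection (\<lambda>x. app k (\<rho> u x) (p x)) \<theta>"
  unfolding inv_unitary[OF u]
proof (rule reflection_eqI)
  fix x i j assume x: "x \<in> topspace X" "i < k" "j < k"
  have "\<rho> (u \<otimes> reflection p \<theta> \<otimes> star A u) x i j = mm k (mm k (\<rho> u x) (hrefl (p x) (cis (\<theta> x)))) (adj (\<rho> u x)) i j"
  proof -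
    have uc: "u \<in> carrier A" "reflection p \<theta> \<in> carrier A" using u assms by (simp_all add: unitary_carrier rho_reflection)
    have "\<rho> (u \<otimes> reflection p \<theta>) x i j = mm k (\<rho> u x) (hrefl (p x) (cis (\<theta> x))) i j" if "i < k" "j < k" for i j
      unfolding rho_mult[OF uc x(1) that]
      by (rule mm_cong[OF _ _ that]) (simp_all add: rho_reflection assms x)
    then show ?thesis
      using rho_mult[OF mult_closed[OF uc] star_closed[OF uc(1)] x]
      by (simp only:) (rule mm_cong[OF _ _ x(2,3)]; simp add: x rho_star adj_def uc)
  qed
  then show "\<rho> (u \<otimes> reflection p \<theta> \<otimes> star A u) x i j = hrefl (app k (\<rho> u x) (p x)) (cis (\<theta> x)) i j"
    using x by (simp add: conj_hrefl unitary_rho[OF u])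
qed (simp_all add: assms unit_field_app mult_closed rho_reflection star_closed unitary_carrier)

end

section \<open>The identity component\<close>

lemma cis_diff_le: "cmod (cis a - cis b) \<le> \<bar>a - b\<bar>"
proof -
  have "cmod (cis a - cis b) = cmod (cis b) * cmod (cis (a - b) - 1)"
    unfolding norm_mult[symmetric] by (simp add: right_diff_distrib cis_mult)
  also have "\<dots> = 2 * \<bar>sin ((a - b) / 2)\<bar>"
    using dist_exp_i_1[of "a - b"] by (simp add: cis_conv_exp)
  also have "\<dots> \<le> \<bar>a - b\<bar>" using abs_sin_x_le_abs_x[of "(a - b) / 2"] by simp
  finally show ?thesis .
qed

context matrix_functions
begin

abbreviation near :: "real \<Rightarrow> 'a \<Rightarrow> 'a \<Rightarrow> bool" where
  "near r u v \<equiv> \<forall>x\<in>topspace X. \<forall>i<k. \<forall>j<k. cmod (\<rho> u x i j - \<rho> v x i j) \<le> r"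

text \<open>The Lipschitz form is preserved by products, adjoints and the passage to diag(u, 1),
  with explicit constants and a purely entrywise check.\<close>

definition lipschitz_path :: "(real \<Rightarrow> 'a) \<Rightarrow> real \<Rightarrow> bool" where
  "lipschitz_path \<gamma> L \<longleftrightarrow> 0 \<le> L \<and> (\<forall>t\<in>{0..1}. \<gamma> t \<in> carrier (unitary_group A)) \<and>
    (\<forall>s\<in>{0..1}. \<forall>t\<in>{0..1}. near (L * \<bar>s - t\<bar>) (\<gamma> s) (\<gamma> t))"

text \<open>A concrete model of the identity component: membership is witnessed by a path, which can
  be multiplied or embedded into larger matrices. It is identified with
  \<open>carrier (U0 A)\<close> in \<open>U0_eq_path_comp\<close>.\<close>

definition path_comp :: "'a set" where
  "path_comp = {u. \<exists>\<gamma> L. lipschitz_path \<gamma> L \<and> \<gamma> 0 = \<one> \<and> \<gamma> 1 = u}"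

lemma near_mult:
  assumes "near r a a'" "near s b b'" "a \<in> carrier (unitary_group A)" "b \<in> carrier A"
    "a' \<in> carrier A" "b' \<in> carrier (unitary_group A)"
  shows "near (real k * (r + s)) (a \<otimes> b) (a' \<otimes> b')"
  using assms by (auto simp: rho_mult unitary_carrier intro!: mm_entry_diff_le unitary_entry_le_1 unitary_rho)

lemma path_comp_unitary: "u \<in> path_comp \<Longrightarrow> u \<in> carrier (unitary_group A)"
  by (auto simp: path_comp_def lipschitz_path_def)

lemma path_comp_subgroup: "subgroup path_comp (unitary_group A)"
proof (rule UG.subgroupI)
  show "path_comp \<subseteq> carrier (unitary_group A)" using path_comp_unitary by blast
  have "lipschitz_path (\<lambda>_. \<one>) 0"
    by (simp add: lipschitz_path_def UG.one_closed)
  then show "path_comp \<noteq> {}" by (auto simp: path_comp_def)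
next
  fix u assume "u \<in> path_comp"
  then obtain \<gamma> L where \<gamma>: "lipschitz_path \<gamma> L" "\<gamma> 0 = \<one>" "\<gamma> 1 = u" by (auto simp: path_comp_def)
  have "lipschitz_path (\<lambda>t. star A (\<gamma> t)) L"
    using \<gamma>(1) unfolding lipschitz_path_def
    by (simp add: star_unitary rho_star unitary_carrier complex_mod_cnj flip: complex_cnj_diff)
  then have "star A u \<in> path_comp"
    unfolding path_comp_def using \<gamma> star_one by (intro CollectI exI[of _ "\<lambda>t. star A (\<gamma> t)"] exI[of _ L]) simp
  moreover have "u \<in> carrier (unitary_group A)" by (rule path_comp_unitary) fact
  ultimately show "inv\<^bsub>unitary_group A\<^esub> u \<in> path_comp" by (simp add: inv_unitary)
next
  fix u v assume "u \<in> path_comp" "v \<in> path_comp"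
  then obtain \<gamma> L \<delta> M where \<gamma>: "lipschitz_path \<gamma> L" "\<gamma> 0 = \<one>" "\<gamma> 1 = u"
    and \<delta>: "lipschitz_path \<delta> M" "\<delta> 0 = \<one>" "\<delta> 1 = v" by (auto simp: path_comp_def)
  have "near (real k * (L + M) * \<bar>s - t\<bar>) (\<gamma> s \<otimes> \<delta> s) (\<gamma> t \<otimes> \<delta> t)" if "s \<in> {0..1}" "t \<in> {0..1}" for s t
    using near_mult[of "\<gamma> s" "\<gamma> t" "L * \<bar>s - t\<bar>" "\<delta> s" "\<delta> t" "M * \<bar>s - t\<bar>"] \<gamma>(1) \<delta>(1) that
    by (simp add: lipschitz_path_def unitary_carrier algebra_simps)
  then have "lipschitz_path (\<lambda>t. \<gamma> t \<otimes> \<delta> t) (real k * (L + M))"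
    using \<gamma>(1) \<delta>(1) by (simp add: lipschitz_path_def UG.m_closed)
  moreover have "\<gamma> 0 \<otimes> \<delta> 0 = \<one>" using \<gamma> \<delta> by (simp add: one_mult one_closed)
  ultimately show "u \<otimes> v \<in> path_comp" 
    unfolding path_comp_def using \<gamma> \<delta>
    by (intro CollectI exI[of _ "\<lambda>t. \<gamma> t \<otimes> \<delta> t"] exI[of _ "real k * (L + M)"]) simp
qed

lemma reflection_path_comp:
  assumes p: "unit_field p" and \<theta>: "phase \<theta>"
  shows "reflection p \<theta> \<in> path_comp"
proof -
  obtain B where B: "\<And>x. x \<in> topspace X \<Longrightarrow> \<bar>\<theta> x\<bar> \<le> B" using \<theta> by (auto simp: phase_def)
  define \<gamma> where "\<gamma> = (\<lambda>t. reflection p (\<lambda>x. t * \<theta> x))"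
  have "near (\<bar>B\<bar> * \<bar>s - t\<bar>) (\<gamma> s) (\<gamma> t)" for s t
  proof (intro ballI allI impI)
    fix x i j assume x: "x \<in> topspace X" "i < k" "j < k"
    have pc: "cmod (p x m) \<le> 1" if "m < k" for m
      using component_le_vnorm[OF that, of "p x"] p x by (simp add: unit_field_def)
    have "\<rho> (\<gamma> s) x i j - \<rho> (\<gamma> t) x i j = (cis (s * \<theta> x) - cis (t * \<theta> x)) * (p x i * cnj (p x j))"
      using x by (simp add: \<gamma>_def rho_reflection p \<theta> phase_scale hrefl_def algebra_simps)
    also have "cmod \<dots> \<le> \<bar>s * \<theta> x - t * \<theta> x\<bar> * (1 * 1)"
      unfolding norm_mult using pc x by (intro mult_mono cis_diff_le) auto
    also have "\<dots> = \<bar>\<theta> x\<bar> * \<bar>s - t\<bar>" by (simp add: abs_mult flip: left_diff_distrib)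
    also have "\<dots> \<le> \<bar>B\<bar> * \<bar>s - t\<bar>" using B[OF x(1)] by (intro mult_right_mono) auto
    finally show "cmod (\<rho> (\<gamma> s) x i j - \<rho> (\<gamma> t) x i j) \<le> \<bar>B\<bar> * \<bar>s - t\<bar>" .
  qed
  then have "lipschitz_path \<gamma> \<bar>B\<bar>"
    by (simp add: lipschitz_path_def \<gamma>_def reflection_unitary p \<theta> phase_scale)
  moreover have "\<gamma> 0 = \<one>" "\<gamma> 1 = reflection p \<theta>" by (simp_all add: \<gamma>_def reflection_zero p)
  ultimately show ?thesis by (auto simp: path_comp_def)
qed

lemma carrier_U0:
  "carrier (U0 A) = connected_component_of_set (subtopology mtopology (carrier (unitary_group A))) \<one>"
  by (simp add: U0_def norm_topology_def)

lemma path_comp_subset_U0: "path_comp \<subseteq> carrier (U0 A)"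
proof
  fix u assume "u \<in> path_comp"
  then obtain \<gamma> L where \<gamma>: "lipschitz_path \<gamma> L" "\<gamma> 0 = \<one>" "\<gamma> 1 = u" by (auto simp: path_comp_def)
  have L: "0 \<le> L" and un: "\<gamma> t \<in> carrier (unitary_group A)" if "t \<in> {0..1}" for t
    using \<gamma>(1) that by (auto simp: lipschitz_path_def)
  have dist: "nrm_dist A (\<gamma> s) (\<gamma> t) \<le> real k * real k * (L * \<bar>s - t\<bar>)" if "s \<in> {0..1}" "t \<in> {0..1}" for s t
    using \<gamma>(1) that by (intro dist_le) (auto simp: lipschitz_path_def unitary_carrier)
  have "continuous_map (top_of_set {0..1}) mtopology \<gamma>"
    unfolding continuous_map_to_metric
  proof (intro ballI allI impI)
    fix t \<epsilon> :: real assume "t \<in> topspace (top_of_set {0..1})" and \<epsilon>: "0 < \<epsilon>"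
    then have t: "t \<in> {0..1}" by simp
    \<comment> \<open>The summand 1 keeps \<open>C\<close> positive when \<open>L = 0\<close>, so
      that the radius \<epsilon> / C makes sense.\<close>
    define C where "C = real k * real k * L + 1"
    have C: "0 < C" using L[OF t] by (simp add: C_def add_nonneg_pos)
    have "\<gamma> y \<in> mball (\<gamma> t) \<epsilon>" if y: "y \<in> {0..1} \<inter> ball t (\<epsilon> / C)" for y
    proof -
      have d: "\<bar>t - y\<bar> < \<epsilon> / C" using y by (simp add: dist_real_def)
      have "nrm_dist A (\<gamma> t) (\<gamma> y) \<le> real k * real k * (L * \<bar>t - y\<bar>)" using y t by (intro dist) auto
      also have "\<dots> \<le> C * \<bar>t - y\<bar>" by (simp add: C_def algebra_simps)
      also have "\<dots> < \<epsilon>" using d C by (simp add: field_simps)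
      finally show ?thesis using un t y by (simp add: unitary_carrier)
    qed
    moreover have "openin (top_of_set {0..1}) ({0..1} \<inter> ball t (\<epsilon> / C))"
      by (rule openin_open_Int) simp
    moreover have "t \<in> {0..1} \<inter> ball t (\<epsilon> / C)" using t \<epsilon> C by simp
    ultimately show "\<exists>U. openin (top_of_set {0..1}) U \<and> t \<in> U \<and> (\<forall>y\<in>U. \<gamma> y \<in> mball (\<gamma> t) \<epsilon>)" by blast
  qed
  then have "continuous_map (top_of_set {0..1}) (subtopology mtopology (carrier (unitary_group A))) \<gamma>"
    using un by (auto simp: continuous_map_in_subtopology)
  moreover have "connectedin (top_of_set {0..1}) {0..1::real}"
    by (simp add: connectedin_subtopology)
  ultimately have "connectedin (subtopology mtopology (carrier (unitary_group A))) (\<gamma> ` {0..1})"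
    by (rule connectedin_continuous_map_image)
  moreover have "\<one> \<in> \<gamma> ` {0..1}" "u \<in> \<gamma> ` {0..1}" using \<gamma>(2,3) by force+
  ultimately show "u \<in> carrier (U0 A)"
    unfolding carrier_U0 by (auto simp: connected_component_of_def)
qed

lemma near_sym: "near r u v \<Longrightarrow> near r v u"
  by (simp add: norm_minus_commute)

text \<open>v u^{-1} - 1 = (v - u) u^*, and a sum of k products with factors of modulus at most 1
  costs a factor k.\<close>

lemma near_quotient:
  assumes "u \<in> carrier (unitary_group A)" "v \<in> carrier (unitary_group A)" "near r v u" "0 \<le> r"
  shows "near (real k * r) (v \<otimes> inv\<^bsub>unitary_group A\<^esub> u) \<one>"
  using near_mult[of v u r "star A u" "star A u" 0] assms
  by (simp add: inv_unitary unitary_carrier star_closed star_unitary) (simp add: unitary_group_simps)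

text \<open>An open subgroup is also closed, so it contains the identity component.\<close>

lemma U0_subset:
  assumes H: "subgroup H (unitary_group A)" and \<epsilon>: "0 < \<epsilon>"
    and nbhd: "\<And>u. \<lbrakk>u \<in> carrier (unitary_group A); near \<epsilon> u \<one>\<rbrakk> \<Longrightarrow> u \<in> H"
  shows "carrier (U0 A) \<subseteq> H"
proof -
  let ?G = "carrier (unitary_group A)"
  let ?T = "subtopology mtopology ?G"
  \<comment> \<open>Division by \<open>k\<close> compensates the factor lost in
    \<open>near_quotient\<close>.\<close>
  define r where "r = \<epsilon> / real k"
  have r: "0 < r" "real k * r = \<epsilon>" using \<epsilon> dim_pos by (simp_all add: r_def)
  \<comment> \<open>If u and v are close, then v u^{-1} is close to 1 and lies in H, so u and v are
    in the same right coset. Membership in H is therefore locally constant, which makes both H and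
    its complement open.\<close>
  have near_H: "v \<in> H \<longleftrightarrow> u \<in> H" if uv: "u \<in> ?G" "v \<in> ?G" "nrm_dist A u v < r" for u v
  proof -
    have step: "v \<in> H" if "u \<in> ?G" "v \<in> ?G" "near r v u" "u \<in> H" for u v
    proof -
      have "v \<otimes> inv\<^bsub>unitary_group A\<^esub> u \<in> H"
        using nbhd near_quotient[OF that(1-3)] r that by (auto simp: UG.m_closed UG.inv_closed)
      then have "v \<otimes> inv\<^bsub>unitary_group A\<^esub> u \<otimes> u \<in> H"
        using subgroup.m_closed[OF H] that(4) by (metis unitary_group_simps(2))
      then show ?thesis using that by (simp add: UG.m_assoc UG.l_inv)
    qed
    have near: "near r u v"
    proof (intro ballI allI impI)
      fix x i j assume "x \<in> topspace X" "i < k" "j < k"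
      then show "cmod (\<rho> u x i j - \<rho> v x i j) \<le> r"
        using rho_le_dist[of u v x i j] uv by (simp add: unitary_carrier)
    qed
    show ?thesis
      by (rule iffI[OF step[OF uv(2,1) near] step[OF uv(1,2) near_sym[OF near]]])
  qed
  have op: "openin ?T K" if K: "K \<subseteq> ?G" "\<And>u v. \<lbrakk>u \<in> K; v \<in> ?G; nrm_dist A u v < r\<rbrakk> \<Longrightarrow> v \<in> K" for K
  proof -
    have "K = (\<Union>u\<in>K. mball u r) \<inter> ?G"
    proof (intro equalityI subsetI)
      fix u assume "u \<in> K"
      then show "u \<in> (\<Union>u\<in>K. mball u r) \<inter> ?G"
        using K(1) r(1) by (intro IntI UN_I[of u]) (auto simp: unitary_carrier)
    next
      fix v assume "v \<in> (\<Union>u\<in>K. mball u r) \<inter> ?G"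
      then show "v \<in> K" using K(2) by auto
    qed
    moreover have "openin mtopology (\<Union>u\<in>K. mball u r)"
      by (intro openin_Union) auto
    ultimately show ?thesis unfolding openin_subtopology by blast
  qed
  have HG: "H \<subseteq> ?G" using H by (rule subgroup.subset)
  have "openin ?T H" using near_H HG by (intro op) blast+
  moreover have "openin ?T (?G - H)" using near_H by (intro op) blast+
  then have "closedin ?T H"
    using HG unfolding closedin_def topspace_subtopology topspace_mtopology
    by (metis (no_types, lifting) Int_absorb1 subsetI unitary_carrier)
  moreover have "connectedin ?T (carrier (U0 A))"
    unfolding carrier_U0 by (rule connectedin_connected_component_of)
  ultimately have "carrier (U0 A) \<subseteq> H \<or> disjnt (carrier (U0 A)) H"
    by (intro connectedin_clopen_cases)
  moreover have "\<one> \<in> carrier (U0 A)"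
    using subgroup.one_closed[OF path_comp_subgroup] unfolding unitary_group_simps
    by (rule subsetD[OF path_comp_subset_U0])
  moreover have "\<one> \<in> H" using subgroup.one_closed[OF H] unfolding unitary_group_simps .
  ultimately show ?thesis unfolding disjnt_iff by blast
qed

section \<open>Elimination of columns over X\<close>

abbreviation pi_reflection :: "('x \<Rightarrow> nat \<Rightarrow> complex) \<Rightarrow> 'a" where
  "pi_reflection p \<equiv> reflection p (\<lambda>_. pi)"

text \<open>The subgroup is left abstract because the elimination is used both for the path
  component and for the products of commutators with phases. A subgroup containing the two kinds of
  factors that one column contributes contains every accretive unitary.\<close>

lemma accretive_generated:
  assumes H: "subgroup H (unitary_group A)"
    and turns: "\<And>p j. \<lbrakk>unit_field p; j < k; \<And>x. x \<in> topspace X \<Longrightarrow> \<exists>r>0. p x j = complex_of_real r\<rbrakk> \<Longrightarrow>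
      pi_reflection p \<otimes> pi_reflection (\<lambda>_. bvec j) \<in> H"
    and phases: "\<And>j \<theta>. \<lbrakk>j < k; phase \<theta>\<rbrakk> \<Longrightarrow> reflection (\<lambda>_. bvec j) \<theta> \<in> H"
    and u: "u \<in> carrier (unitary_group A)" "\<And>x. x \<in> topspace X \<Longrightarrow> accretive k (\<rho> u x)"
  shows "u \<in> H"
proof -
  \<comment> \<open>The number j counts the columns that are already standard. At j = k the unitary
    is 1, and the induction runs downwards from there.\<close>
  have *: "u \<in> H" if "j \<le> k" "u \<in> carrier (unitary_group A)" "\<And>x. x \<in> topspace X \<Longrightarrow> accretive k (\<rho> u x)"
    "\<And>x i l. \<lbrakk>x \<in> topspace X; i < j; l < k\<rbrakk> \<Longrightarrow> \<rho> u x l i = id_mat l i" for j u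
    using that
  proof (induction j arbitrary: u rule: inc_induct)
    case base
    then have "u = \<one>" by (intro rho_inj) (auto simp: unitary_carrier one_closed rho_one)
    then show ?case using subgroup.one_closed[OF H] by (simp add: unitary_group_simps)
  next
    case (step j)
    define a where "a = (\<lambda>x. \<rho> u x j j)"
    define p where "p = (\<lambda>x i. (bvec j i + cnj (sgn (a x)) * \<rho> u x i j) / complex_of_real (sqrt (2 + 2 * cmod (a x))))"
    define \<theta> where "\<theta> = (\<lambda>x. Arg (a x))"
    have j: "j < k" using step by simp
    have uc: "u \<in> carrier A" using step by (simp add: unitary_carrier)
    have Re_a: "0 < Re (a x)" if "x \<in> topspace X" for x
      unfolding a_def using step.prems(2)[OF that] j by (rule accretive_diag)
    have elim: "vnorm k (p x) = 1" "p x j = complex_of_real ((1 + cmod (a x)) / sqrt (2 + 2 * cmod (a x)))"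
      "\<lbrakk>unitary k v;
       \<And>f i. i < k \<Longrightarrow> app k (hrefl (p x) (-1)) (app k (hrefl (bvec j) (-1)) (app k (hrefl (bvec j) (sgn (a x))) (app k v f))) i
         = app k (\<rho> u x) f i\<rbrakk> \<Longrightarrow> accretive k v \<and> (\<forall>i\<le>j. \<forall>l<k. v l i = id_mat l i)"
      if x: "x \<in> topspace X" for x v
      unfolding p_def a_def
      using column_elimination[OF unitary_rho[OF step.prems(1) x] step.prems(2)[OF x] j] step.prems(3)[OF x] by blast+
    have ca: "(a \<longlongrightarrow> a x) (atin X x)" and cu: "i < k \<Longrightarrow> ((\<lambda>x. \<rho> u x i j) \<longlongrightarrow> \<rho> u x i j) (atin X x)"
      if "x \<in> topspace X" for x i
      using rho_cont[OF uc _ j] that j by (auto simp: a_def continuous_map_atin)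
    have a0: "a x \<noteq> 0" if "x \<in> topspace X" for x using Re_a[OF that] by auto
    have s0: "complex_of_real (sqrt (2 + 2 * cmod z)) \<noteq> 0" for z
      by (simp add: add_nonneg_eq_0_iff)
    have p: "unit_field p"
      unfolding unit_field_def
      using elim(1) by (auto simp: p_def continuous_map_atin intro!: tendsto_intros ca cu a0 s0)
    have \<theta>: "phase \<theta>"
      unfolding phase_def
    proof (intro conjI exI[of _ pi] ballI)
      \<comment> \<open>Positive real part keeps a away from the negative axis, where
        \<open>Arg\<close> jumps; this is where a real-valued continuous phase is obtained.\<close>
      show "continuous_map X euclidean \<theta>"
        unfolding continuous_map_atin \<theta>_def
        using Re_a by (auto intro!: isCont_tendsto_compose[OF continuous_at_Arg] ca simp: complex_nonpos_Reals_iff)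
          (meson not_le)
      show "\<bar>\<theta> x\<bar> \<le> pi" for x using Arg_bounded[of "a x"] by (auto simp: \<theta>_def abs_le_iff)
    qed
    \<comment> \<open>The factor that sends e_j to the j-th column of u. Its first two reflections
      form a turn, admissible because the j-th coordinate of p is a positive real, and its last one
      is a phase along e_j.\<close>
    define W where "W = pi_reflection p \<otimes> pi_reflection (\<lambda>_. bvec j) \<otimes> reflection (\<lambda>_. bvec j) \<theta>"
    have WH: "W \<in> H"
    proof -
      have "pi_reflection p \<otimes> pi_reflection (\<lambda>_. bvec j) \<in> H"
      proof (rule turns[OF p j])
        fix x assume x: "x \<in> topspace X"
        have "0 < (1 + cmod (a x)) / sqrt (2 + 2 * cmod (a x))"
          by (intro divide_pos_pos) (auto intro: add_pos_nonneg)
        then show "\<exists>r>0. p x j = complex_of_real r" using elim(2)[OF x] by blast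
      qed
      then show ?thesis
        unfolding W_def using subgroup.m_closed[OF H] phases[OF j \<theta>] by (metis unitary_group_simps(2))
    qed
    then have W: "W \<in> carrier (unitary_group A)" using subgroup.subset[OF H] by blast
    define v where "v = inv\<^bsub>unitary_group A\<^esub> W \<otimes> u"
    have v: "v \<in> carrier (unitary_group A)" unfolding v_def using W step.prems(1) by (simp add: UG.m_closed)
    have Wv: "W \<otimes> v = u"
      unfolding v_def using W step.prems(1) by (simp add: UG.m_assoc[symmetric] UG.r_inv)
    have facts: "accretive k (\<rho> v x) \<and> (\<forall>i\<le>j. \<forall>l<k. \<rho> v x l i = id_mat l i)" if x: "x \<in> topspace X" for x
    proof (rule elim(3)[OF x unitary_rho[OF v x]])
      fix f i assume i: "i < k"
      note b = unit_field_bvec[OF j]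
      have cl: "pi_reflection p \<in> carrier A" "pi_reflection (\<lambda>_. bvec j) \<in> carrier A" "reflection (\<lambda>_. bvec j) \<theta> \<in> carrier A" "v \<in> carrier A"
        using p b \<theta> v by (simp_all add: rho_reflection phase_const unitary_carrier)
      have R: "app k (\<rho> (reflection q \<eta>) x) g i = app k (hrefl (q x) (cis (\<eta> x))) g i"
        if "unit_field q" "phase \<eta>" "i < k" for q \<eta> g i
        using that x by (intro app_eqI) (simp_all add: rho_reflection)
      have "app k (\<rho> u x) f i = app k (\<rho> (W \<otimes> v) x) f i" by (simp add: Wv)
      also have "\<dots> = app k (\<rho> (pi_reflection p) x) (app k (\<rho> (pi_reflection (\<lambda>_. bvec j)) x)
          (app k (\<rho> (reflection (\<lambda>_. bvec j) \<theta>) x) (app k (\<rho> v x) f))) i"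
        using cl x i unfolding W_def by (simp add: unitary_mult_app mult_closed cong: app_cong)
      also have "\<dots> = app k (hrefl (p x) (-1)) (app k (hrefl (bvec j) (-1)) (app k (hrefl (bvec j) (sgn (a x))) (app k (\<rho> v x) f))) i"
        using i p b \<theta> cis_Arg[OF a0[OF x]] by (simp add: R phase_const \<theta>_def cong: app_cong)
      finally show "app k (hrefl (p x) (-1)) (app k (hrefl (bvec j) (-1)) (app k (hrefl (bvec j) (sgn (a x))) (app k (\<rho> v x) f))) i
          = app k (\<rho> u x) f i" by simp
    qed
    have "v \<in> H" by (rule step.IH[OF v]) (use facts in \<open>auto simp: less_Suc_eq_le\<close>)
    then show ?case
      using subgroup.m_closed[OF H WH] Wv by (metis unitary_group_simps(2))
  qed
  show ?thesis by (rule *[of 0]) (auto simp: u)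
qed

lemma U0_generated:
  assumes H: "subgroup H (unitary_group A)"
    and "\<And>p j. \<lbrakk>unit_field p; j < k; \<And>x. x \<in> topspace X \<Longrightarrow> \<exists>r>0. p x j = complex_of_real r\<rbrakk> \<Longrightarrow>
      pi_reflection p \<otimes> pi_reflection (\<lambda>_. bvec j) \<in> H"
    and "\<And>j \<theta>. \<lbrakk>j < k; phase \<theta>\<rbrakk> \<Longrightarrow> reflection (\<lambda>_. bvec j) \<theta> \<in> H"
  shows "carrier (U0 A) \<subseteq> H"
proof (rule U0_subset[OF H])
  \<comment> \<open>With this radius r the quantity k * k * r of \<open>accretive_near_id\<close> is
    1/2.\<close>
  show "0 < 1 / (2 * real k * real k)" using dim_pos by simp
  fix u assume u: "u \<in> carrier (unitary_group A)" and near: "near (1 / (2 * real k * real k)) u \<one>"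
  have "accretive k (\<rho> u x)" if "x \<in> topspace X" for x
    using near that dim_pos by (intro accretive_near_id[of k _ "1 / (2 * real k * real k)"]) (auto simp: rho_one)
  then show "u \<in> H" using accretive_generated[OF assms u] by blast
qed

text \<open>The path component contains all reflections, hence a neighbourhood of 1, and so absorbs
  the connected component. From here on U_0 is handled through paths alone.\<close>

lemma U0_eq_path_comp: "carrier (U0 A) = path_comp"
proof
  show "carrier (U0 A) \<subseteq> path_comp"
  proof (rule U0_generated[OF path_comp_subgroup])
    fix p j assume "unit_field p" "j < k"
    then show "pi_reflection p \<otimes> pi_reflection (\<lambda>_. bvec j) \<in> path_comp"
      using subgroup.m_closed[OF path_comp_subgroup] reflection_path_comp phase_const unit_field_bvec
      by (metis unitary_group_simps(2))
  qed (simp add: reflection_path_comp unit_field_bvec)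
qed (rule path_comp_subset_U0)

end

section \<open>Commutators and determinants\<close>

definition matdet :: "nat \<Rightarrow> (nat \<Rightarrow> nat \<Rightarrow> complex) \<Rightarrow> complex" where
  "matdet k M = det (mat k k (\<lambda>(i, j). M i j))"

lemma matdet_cong: "(\<And>i j. \<lbrakk>i < k; j < k\<rbrakk> \<Longrightarrow> M i j = N i j) \<Longrightarrow> matdet k M = matdet k N"
  unfolding matdet_def by (intro arg_cong[of _ _ det] eq_matI) auto

lemma matdet_mm: "matdet k (mm k M N) = matdet k M * matdet k N"
proof -
  have "mat k k (\<lambda>(i, j). mm k M N i j) = mat k k (\<lambda>(i, j). M i j) * mat k k (\<lambda>(i, j). N i j)"
    by (rule eq_matI) (auto simp: scalar_prod_def mm_def lessThan_atLeast0)
  then show ?thesis by (simp add: matdet_def det_mult[of _ k])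
qed

lemma matdet_id: "matdet k id_mat = 1"
proof -
  have "mat k k (\<lambda>(i, j). id_mat i j) = 1\<^sub>m k" by (rule eq_matI) (auto simp: id_mat_def)
  then show ?thesis by (simp add: matdet_def)
qed

lemma matdet_hrefl_bvec:
  assumes "0 < k"
  shows "matdet k (hrefl (bvec 0) z) = z"
proof -
  have "matdet k (hrefl (bvec 0) z) = (\<Prod>i = 0..<k. hrefl (bvec 0) z i i)"
    unfolding matdet_def
    by (subst det_upper_triangular[of _ k])
      (auto simp: prod_list_diag_prod hrefl_def bvec_def id_mat_def intro!: prod.cong)
  also have "\<dots> = (\<Prod>i = 0..<k. if i = 0 then z else 1)"
    by (rule prod.cong) (auto simp: hrefl_def bvec_def id_mat_def)
  also have "\<dots> = z" using assms by simp
  finally show ?thesis .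
qed

text \<open>By the Leibniz formula the determinant is a polynomial in the entries.\<close>

lemma tendsto_matdet:
  assumes "\<And>i j. \<lbrakk>i < k; j < k\<rbrakk> \<Longrightarrow> ((\<lambda>n. M n i j) \<longlongrightarrow> N i j) F"
  shows "((\<lambda>n. matdet k (M n)) \<longlongrightarrow> matdet k N) F"
proof -
  have perm: "p i < k" if "p permutes {0..<k}" "i < k" for p i
    using permutes_in_image[OF that(1), of i] that(2) by simp
  have det: "matdet k M = (\<Sum>p | p permutes {0..<k}. signof p * (\<Prod>i = 0..<k. M i (p i)))" for M
  proof -
    have "(\<Prod>i = 0..<k. mat k k (\<lambda>(i, j). M i j) $$ (i, p i)) = (\<Prod>i = 0..<k. M i (p i))"
      if "p permutes {0..<k}" for p
      by (rule prod.cong) (auto simp: perm[OF that])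
    then show ?thesis unfolding matdet_def by (subst det_def'[of _ k]) simp_all
  qed
  show ?thesis unfolding det
    by (intro tendsto_sum tendsto_mult tendsto_const tendsto_prod assms) (auto simp: perm)
qed

context matrix_functions
begin

lemma U0_eq: "U0 A = unitary_group A\<lparr>carrier := path_comp\<rparr>"
  using U0_eq_path_comp unfolding U0_def by simp

definition commutators :: "'a set" where
  "commutators = derived (unitary_group A) path_comp"

lemma derived_U0: "derived (U0 A) (carrier (U0 A)) = commutators"
  unfolding U0_eq commutators_def
  by (simp add: UG.derived_consistent[OF _ path_comp_subgroup])

lemma commutators_subgroup: "subgroup commutators (unitary_group A)"
  unfolding commutators_def by (intro UG.derived_is_subgroup subgroup.subset[OF path_comp_subgroup])

lemma commutators_subset: "commutators \<subseteq> path_comp"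
  unfolding commutators_def by (rule UG.derived_incl[OF order_refl path_comp_subgroup])

lemma group_U0: "group (U0 A)"
  unfolding U0_eq by (rule UG.subgroup_imp_group[OF path_comp_subgroup])

lemma commutators_normal: "commutators \<lhd> U0 A"
  unfolding U0_eq commutators_def by (rule UG.derived_subgroup_is_normal[OF path_comp_subgroup])

lemma inv_U0: "u \<in> path_comp \<Longrightarrow> inv\<^bsub>U0 A\<^esub> u = inv\<^bsub>unitary_group A\<^esub> u"
  unfolding U0_eq by (rule UG.m_inv_consistent[OF path_comp_subgroup])

lemma U0_mult: "u \<otimes>\<^bsub>U0 A\<^esub> v = u \<otimes> v" and U0_one: "\<one>\<^bsub>U0 A\<^esub> = \<one>"
  by (simp_all add: U0_eq unitary_group_simps)

lemma path_comp_closed: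
  "\<lbrakk>u \<in> path_comp; v \<in> path_comp\<rbrakk> \<Longrightarrow> u \<otimes> v \<in> path_comp"
  "u \<in> path_comp \<Longrightarrow> inv\<^bsub>unitary_group A\<^esub> u \<in> path_comp"
  "\<one> \<in> path_comp"
  using subgroup.m_closed[OF path_comp_subgroup] subgroup.m_inv_closed[OF path_comp_subgroup]
    subgroup.one_closed[OF path_comp_subgroup]
  by (simp_all add: unitary_group_simps)

lemma commutators_closed:
  "\<lbrakk>u \<in> commutators; v \<in> commutators\<rbrakk> \<Longrightarrow> u \<otimes> v \<in> commutators"
  "u \<in> commutators \<Longrightarrow> inv\<^bsub>unitary_group A\<^esub> u \<in> commutators"
  "\<one> \<in> commutators"
  using subgroup.m_closed[OF commutators_subgroup] subgroup.m_inv_closed[OF commutators_subgroup]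
    subgroup.one_closed[OF commutators_subgroup]
  by (simp_all add: unitary_group_simps)

lemma commutators_conj:
  "\<lbrakk>q \<in> path_comp; d \<in> commutators\<rbrakk> \<Longrightarrow> q \<otimes> d \<otimes> inv\<^bsub>unitary_group A\<^esub> q \<in> commutators"
  using normal.inv_op_closed2[OF commutators_normal, of q d]
  by (simp add: U0_mult inv_U0) (simp add: U0_eq)

lemma commutatorI:
  assumes "u \<in> path_comp" "v \<in> path_comp"
  shows "u \<otimes> v \<otimes> inv\<^bsub>unitary_group A\<^esub> u \<otimes> inv\<^bsub>unitary_group A\<^esub> v \<in> commutators"
proof -
  have "u \<otimes> v \<otimes> inv\<^bsub>unitary_group A\<^esub> u \<otimes> inv\<^bsub>unitary_group A\<^esub> v \<in> derived_set (unitary_group A) path_comp"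
    using assms by (auto simp: unitary_group_simps)
  then show ?thesis unfolding commutators_def derived_def by (rule generate.incl)
qed

text \<open>With \<open>q\<close> the normalised midpoint of \<open>p\<close> and the basis vector \<open>e\<close>, the reflection \<open>R\<^sub>q\<close> maps \<open>e\<close> to \<open>- p\<close>,
  so that \<open>R\<^sub>p R\<^sub>e\<close> is the commutator of \<open>R\<^sub>q\<close> and \<open>R\<^sub>e\<close>.\<close>

lemma turn_in_commutators:
  assumes p: "unit_field p" and j: "j < k"
    and pj: "\<And>x. x \<in> topspace X \<Longrightarrow> \<exists>r>0. p x j = complex_of_real r"
  shows "pi_reflection p \<otimes> pi_reflection (\<lambda>_. bvec j) \<in> commutators"
proof -
  \<comment> \<open>The norm of e_j + p, whose square is 2 + 2 Re p_j. It cannot vanish since p_j is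
    positive.\<close>
  define s where "s = (\<lambda>x. complex_of_real (sqrt (2 + 2 * Re (p x j))))"
  define q where "q = (\<lambda>x i. (bvec j i + p x i) / s x)"
  have s2: "s x * s x = 2 + 2 * p x j" and s0: "s x \<noteq> 0" "cnj (s x) = s x" if x: "x \<in> topspace X" for x
  proof -
    obtain r where r: "0 < r" "p x j = complex_of_real r" using pj[OF x] by blast
    then have "sqrt (2 + 2 * Re (p x j)) * sqrt (2 + 2 * Re (p x j)) = 2 + 2 * r" by simp
    then show "s x * s x = 2 + 2 * p x j" unfolding s_def r(2)
      by (metis of_real_add of_real_mult of_real_numeral r(2))
    show "s x \<noteq> 0" "cnj (s x) = s x" using r by (auto simp: s_def add_nonneg_eq_0_iff)
  qed
  have cnj_pj: "cnj (p x j) = p x j" if "x \<in> topspace X" for x using pj[OF that] by auto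
  have bj: "bvec j j = 1" by (simp add: bvec_def)
  have pp: "ip k (p x) (p x) = 1" if "x \<in> topspace X" for x
    using p that by (simp add: ip_self unit_field_def)
  have q: "unit_field q"
  proof -
    have "vnorm k (q x) = 1" if x: "x \<in> topspace X" for x
    proof (rule vnorm_eq_1I)
      have "ip k (q x) (q x) = (2 + 2 * p x j) / (s x * s x)"
        unfolding q_def ip_linear using x j by (simp add: ip_bvec pp cnj_pj s0 bj field_simps)
      also have "2 + 2 * p x j = s x * s x" using s2[OF x] by simp
      finally show "ip k (q x) (q x) = 1" using s0[OF x] by simp
    qed
    moreover have "continuous_map X euclidean (\<lambda>x. q x i)" if i: "i < k" for i
    proof -
      have "((\<lambda>x. p x i) \<longlongrightarrow> p x i) (atin X x)" "((\<lambda>x. p x j) \<longlongrightarrow> p x j) (atin X x)" if "x \<in> topspace X" for x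
        using p i j that by (auto simp: unit_field_def continuous_map_atin)
      then show ?thesis unfolding q_def s_def continuous_map_atin
        using s0(1) by (auto intro!: tendsto_intros simp: s_def)
    qed
    ultimately show ?thesis by (simp add: unit_field_def)
  qed
  note b = unit_field_bvec[OF j]
  let ?R = "pi_reflection q" and ?E = "pi_reflection (\<lambda>_. bvec j)"
  have Rq: "?R \<in> path_comp" "?E \<in> path_comp" using q b by (auto intro: reflection_path_comp phase_const)
  have "app k (\<rho> ?R x) (bvec j) i = - p x i" if x: "x \<in> topspace X" "i < k" for x i
  proof -
    have "app k (\<rho> ?R x) (bvec j) i = app k (hrefl (q x) (-1)) (bvec j) i"
      using x q by (intro app_eqI) (simp_all add: rho_reflection phase_const)
    also have "\<dots> = bvec j i - (2 + 2 * p x j) / (s x * s x) * (bvec j i + p x i)"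
      using x j by (simp add: app_hrefl ip_bvec) (simp add: q_def s0 bj cnj_pj field_simps)
    finally show ?thesis using s0[OF x(1)] by (simp flip: s2[OF x(1)])
  qed
  then have "?R \<otimes> ?E \<otimes> inv\<^bsub>unitary_group A\<^esub> ?R = pi_reflection (\<lambda>x i. - p x i)"
    using q b by (subst reflection_conj)
      (auto intro!: reflection_cong unit_field_app reflection_unitary unit_field_uminus p simp: phase_const)
  \<comment> \<open>The sign disappears because a reflection depends on its axis only through p p^*.
    The reflection along e_j is an involution, so the commutator ends in it and not in a different
    inverse.\<close>
  also have "\<dots> = pi_reflection p" using p by (simp add: reflection_uminus phase_const)
  finally have "?R \<otimes> ?E \<otimes> inv\<^bsub>unitary_group A\<^esub> ?R \<otimes> inv\<^bsub>unitary_group A\<^esub> ?E = pi_reflection p \<otimes> ?E"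
    by (simp add: reflection_pi_inv[OF b])
  then show ?thesis using commutatorI[OF Rq] by simp
qed

text \<open>The reflection along \<open>e\<^sub>j - e\<^sub>0\<close> swaps \<open>e\<^sub>j\<close> and \<open>e\<^sub>0\<close>.\<close>

lemma phase_reflection_move:
  assumes j: "j < k" and \<theta>: "phase \<theta>"
  shows "\<exists>d\<in>commutators. reflection (\<lambda>_. bvec j) \<theta> = d \<otimes> reflection (\<lambda>_. bvec 0) \<theta>"
proof (cases "j = 0")
  case True
  then show ?thesis using commutators_closed(3) \<theta> unit_field_bvec[OF dim_pos]
    by (intro bexI[of _ \<one>]) (simp_all add: one_mult rho_reflection)
next
  case False
  define w where "w = (\<lambda>i. (bvec j i - bvec 0 i) / complex_of_real (sqrt 2))"
  have w: "unit_field (\<lambda>_. w)"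
  proof -
    have "complex_of_real (sqrt 2) * complex_of_real (sqrt 2) = 2"
      by (simp flip: of_real_mult)
    then have "ip k w w = 1"
      unfolding w_def ip_linear using j dim_pos False
      by (simp add: ip_bvec) (simp add: bvec_def divide_eq_eq)
    then show ?thesis by (simp add: unit_field_def vnorm_eq_1I)
  qed
  note bj = unit_field_bvec[OF j] and b0 = unit_field_bvec[OF dim_pos]
  let ?S = "pi_reflection (\<lambda>_. w)" and ?Q = "reflection (\<lambda>_. bvec j) \<theta>"
  let ?iQ = "reflection (\<lambda>_. bvec j) (\<lambda>x. - \<theta> x)" and ?P = "reflection (\<lambda>_. bvec 0) \<theta>"
  have mem: "?S \<in> path_comp" "?Q \<in> path_comp" "?iQ \<in> path_comp" "?P \<in> path_comp"
    using w bj b0 \<theta> by (auto intro: reflection_path_comp phase_const phase_uminus)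
  note un = mem[THEN path_comp_unitary]
  have "app k (\<rho> ?S x) (bvec j) i = bvec 0 i" if x: "x \<in> topspace X" "i < k" for x i
  proof -
    have "app k (\<rho> ?S x) (bvec j) i = app k (hrefl w (-1)) (bvec j) i"
      using x w by (intro app_eqI) (simp_all add: rho_reflection phase_const)
    also have "\<dots> = bvec j i - (bvec j i - bvec 0 i) * (2 / (complex_of_real (sqrt 2) * complex_of_real (sqrt 2)))"
      using x j False by (simp add: app_hrefl ip_bvec) (simp add: w_def bvec_def)
    also have "complex_of_real (sqrt 2) * complex_of_real (sqrt 2) = 2"
      by (simp flip: of_real_mult)
    finally show ?thesis by simp
  qed
  then have conj: "?S \<otimes> ?iQ \<otimes> inv\<^bsub>unitary_group A\<^esub> ?S = reflection (\<lambda>_. bvec 0) (\<lambda>x. - \<theta> x)"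
    using w bj b0 \<theta> by (subst reflection_conj)
      (auto intro!: reflection_cong unit_field_app reflection_unitary simp: phase_const phase_uminus)
  \<comment> \<open>Read as Q times S Q^{-1} S^{-1}: the second factor is the conjugate by S of an
    inverse phase along e_j, that is, P^{-1}. Hence the commutator equals Q P^{-1}.\<close>
  let ?d = "?Q \<otimes> ?S \<otimes> inv\<^bsub>unitary_group A\<^esub> ?Q \<otimes> inv\<^bsub>unitary_group A\<^esub> ?S"
  have "?d = ?Q \<otimes> (?S \<otimes> ?iQ \<otimes> inv\<^bsub>unitary_group A\<^esub> ?S)"
    unfolding reflection_inv[OF bj \<theta>] by (simp only: UG.m_assoc UG.m_closed UG.inv_closed un)
  also have "\<dots> = ?Q \<otimes> inv\<^bsub>unitary_group A\<^esub> ?P"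
    by (simp add: conj reflection_inv[OF b0 \<theta>])
  finally have "?d \<otimes> ?P = ?Q \<otimes> inv\<^bsub>unitary_group A\<^esub> ?P \<otimes> ?P" by (rule arg_cong)
  also have "\<dots> = ?Q"
    using un(2,4) by (simp add: UG.m_assoc UG.l_inv UG.inv_closed unitary_carrier one_mult)
  finally have "?Q = ?d \<otimes> ?P" by (rule sym)
  then show ?thesis by (intro bexI[of _ ?d] commutatorI[OF mem(2,1)])
qed

text \<open>The products of a commutator element with a phase along e_0 form a subgroup, since the
  commutators are normal in U_0 and the phases are closed under product and inverse. Turns and
  phases along any e_j lie in it, so it contains U_0.\<close>

lemma U0_decomposition:
  assumes "u \<in> path_comp"
  shows "\<exists>d\<in>commutators. \<exists>\<theta>. phase \<theta> \<and> u = d \<otimes> reflection (\<lambda>_. bvec 0) \<theta>"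
proof -
  note b0 = unit_field_bvec[OF dim_pos]
  let ?Q = "\<lambda>\<theta>. reflection (\<lambda>_. bvec 0) \<theta>"
  define K where "K = {d \<otimes> ?Q \<theta> | d \<theta>. d \<in> commutators \<and> phase \<theta>}"
  have Q: "?Q \<theta> \<in> path_comp" if "phase \<theta>" for \<theta> by (rule reflection_path_comp[OF b0 that])
  note Qu = Q[THEN path_comp_unitary]
  have Du: "d \<in> carrier (unitary_group A)" if "d \<in> commutators" for d
    using commutators_subset path_comp_unitary that by blast
  note cl = UG.m_closed UG.inv_closed
  have K: "subgroup K (unitary_group A)"
  proof (rule UG.subgroupI)
    show "K \<subseteq> carrier (unitary_group A)" using Qu Du by (auto simp: K_def cl)
    have "\<one> \<otimes> ?Q (\<lambda>_. 0) \<in> K" unfolding K_def using commutators_closed(3) phase_const by blast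
    then show "K \<noteq> {}" by blast
  next
    fix u assume "u \<in> K"
    then obtain d \<theta> where u: "u = d \<otimes> ?Q \<theta>" "d \<in> commutators" "phase \<theta>" by (auto simp: K_def)
    let ?i = "inv\<^bsub>unitary_group A\<^esub> (?Q \<theta>)"
    \<comment> \<open>(d Q)^{-1} = (Q^{-1} d^{-1} Q) Q^{-1}: normality moves the commutator part
      back to the left.\<close>
    have "inv\<^bsub>unitary_group A\<^esub> u = (?i \<otimes> inv\<^bsub>unitary_group A\<^esub> d \<otimes> inv\<^bsub>unitary_group A\<^esub> ?i) \<otimes> ?i"
      unfolding u(1) using Du[OF u(2)] Qu[OF u(3)]
      by (simp add: UG.inv_mult_group UG.m_assoc cl UG.r_inv UG.inv_inv unitary_carrier one_mult)
    moreover have "?i \<otimes> inv\<^bsub>unitary_group A\<^esub> d \<otimes> inv\<^bsub>unitary_group A\<^esub> ?i \<in> commutators"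
      using u Q by (intro commutators_conj path_comp_closed commutators_closed)
    ultimately show "inv\<^bsub>unitary_group A\<^esub> u \<in> K"
      unfolding K_def using reflection_inv[OF b0 u(3)] phase_uminus[OF u(3)] by auto
  next
    fix u v assume "u \<in> K" "v \<in> K"
    then obtain d \<theta> e \<eta> where u: "u = d \<otimes> ?Q \<theta>" "d \<in> commutators" "phase \<theta>"
      and v: "v = e \<otimes> ?Q \<eta>" "e \<in> commutators" "phase \<eta>" by (auto simp: K_def)
    \<comment> \<open>Moving e to the left past the first phase replaces it by a conjugate, which is
      again in the commutator subgroup.\<close>
    let ?e = "?Q \<theta> \<otimes> e \<otimes> inv\<^bsub>unitary_group A\<^esub> ?Q \<theta>"
    have "?e \<otimes> ?Q \<theta> = ?Q \<theta> \<otimes> e"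
      using Du[OF v(2)] Qu[OF u(3)] by (simp add: UG.m_assoc cl UG.l_inv unitary_carrier one_mult)
    then have "u \<otimes> v = (d \<otimes> ?e) \<otimes> (?Q \<theta> \<otimes> ?Q \<eta>)"
      unfolding u(1) v(1) using Du[OF v(2)] Du[OF u(2)] Qu[OF u(3)] Qu[OF v(3)]
      by (metis (no_types, lifting) UG.m_assoc cl)
    moreover have "d \<otimes> ?e \<in> commutators"
      using u v Q by (intro commutators_closed commutators_conj)
    ultimately show "u \<otimes> v \<in> K"
      unfolding K_def reflection_mult[OF b0 u(3) v(3)] using phase_add[OF u(3) v(3)] by blast
  qed
  have "carrier (U0 A) \<subseteq> K"
  proof (rule U0_generated[OF K])
    fix p j assume pj: "unit_field p" "j < k" "\<And>x. x \<in> topspace X \<Longrightarrow> \<exists>r>0. p x j = complex_of_real r"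
    let ?t = "pi_reflection p \<otimes> pi_reflection (\<lambda>_. bvec j)"
    have t: "?t \<in> commutators" by (rule turn_in_commutators) (use pj in auto)
    have "?t = ?t \<otimes> ?Q (\<lambda>_. 0)"
      using Du[OF t] by (simp add: reflection_zero[OF b0] one_mult unitary_carrier)
    then show "?t \<in> K" unfolding K_def using t phase_const by blast
  next
    fix j \<theta> assume "j < k" "phase \<theta>"
    then show "reflection (\<lambda>_. bvec j) \<theta> \<in> K"
      unfolding K_def using phase_reflection_move by blast
  qed
  then have "u \<in> K" using assms U0_eq_path_comp by blast
  then show ?thesis unfolding K_def by blast
qed

section \<open>Determinants and the commutator subgroup\<close>

lemma matdet_mult:
  "\<lbrakk>a \<in> carrier A; b \<in> carrier A; x \<in> topspace X\<rbrakk> \<Longrightarrow> matdet k (\<rho> (a \<otimes> b) x) = matdet k (\<rho> a x) * matdet k (\<rho> b x)"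
  unfolding matdet_mm[symmetric] by (rule matdet_cong) (simp add: rho_mult)

lemma matdet_one: "x \<in> topspace X \<Longrightarrow> matdet k (\<rho> \<one> x) = 1"
  using matdet_cong[of k "\<rho> \<one> x" id_mat] by (simp add: rho_one matdet_id)

lemma matdet_inv:
  assumes "u \<in> carrier (unitary_group A)" "x \<in> topspace X"
  shows "matdet k (\<rho> u x) * matdet k (\<rho> (inv\<^bsub>unitary_group A\<^esub> u) x) = 1"
  using assms matdet_mult[of u "inv\<^bsub>unitary_group A\<^esub> u" x]
  by (simp add: UG.r_inv matdet_one unitary_carrier UG.inv_closed)

lemma matdet_reflection:
  assumes "phase \<theta>" "x \<in> topspace X"
  shows "matdet k (\<rho> (reflection (\<lambda>_. bvec 0) \<theta>) x) = cis (\<theta> x)"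
  using matdet_cong[of k "\<rho> (reflection (\<lambda>_. bvec 0) \<theta>) x" "hrefl (bvec 0) (cis (\<theta> x))"] assms
  by (simp add: rho_reflection unit_field_bvec dim_pos matdet_hrefl_bvec)

lemma matdet_commutators:
  assumes "u \<in> commutators" "x \<in> topspace X"
  shows "matdet k (\<rho> u x) = 1"
proof -
  define K where "K = {u \<in> carrier (unitary_group A). matdet k (\<rho> u x) = 1}"
  have "subgroup K (unitary_group A)"
  proof (rule UG.subgroupI)
    show "K \<noteq> {}" using matdet_one[OF assms(2)] UG.one_closed by (auto simp: K_def)
    fix u v assume u: "u \<in> K"
    then show "inv\<^bsub>unitary_group A\<^esub> u \<in> K"
      using matdet_inv[of u x] assms(2) by (simp add: K_def UG.inv_closed)
    assume "v \<in> K"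
    with u show "u \<otimes> v \<in> K"
      using assms(2) by (simp add: K_def UG.m_closed matdet_mult unitary_carrier)
  qed (simp add: K_def)
  moreover have "derived_set (unitary_group A) path_comp \<subseteq> K"
    unfolding unitary_group_simps
  proof clarify
    fix u v assume uv: "u \<in> path_comp" "v \<in> path_comp"
    then have "u \<in> carrier (unitary_group A)" "v \<in> carrier (unitary_group A)" by (simp_all add: path_comp_unitary)
    moreover from this have "matdet k (\<rho> (u \<otimes> v \<otimes> inv\<^bsub>unitary_group A\<^esub> u \<otimes> inv\<^bsub>unitary_group A\<^esub> v) x)
        = (matdet k (\<rho> u x) * matdet k (\<rho> (inv\<^bsub>unitary_group A\<^esub> u) x))
          * (matdet k (\<rho> v x) * matdet k (\<rho> (inv\<^bsub>unitary_group A\<^esub> v) x))"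
      using assms(2) by (simp add: UG.inv_closed matdet_mult unitary_carrier mult_closed ac_simps)
    ultimately show "u \<otimes> v \<otimes> inv\<^bsub>unitary_group A\<^esub> u \<otimes> inv\<^bsub>unitary_group A\<^esub> v \<in> K"
      using matdet_inv[of u x] matdet_inv[of v x] assms(2)
      by (simp add: K_def UG.m_closed UG.inv_closed)
  qed
  ultimately have "commutators \<subseteq> K"
    unfolding commutators_def derived_def by (intro UG.generate_subgroup_incl)
  then show ?thesis using assms(1) by (auto simp: K_def)
qed

text \<open>In a decomposition of u into a commutator part and a phase \<theta>, the determinant is
  cis \<theta>. If it is 1, the phase factor is 1 even where \<theta> is a nonzero multiple of 2 pi,
  because the reflection depends only on cis \<theta>.\<close>

lemma mem_commutators_iff:
  "u \<in> commutators \<longleftrightarrow> u \<in> path_comp \<and> (\<forall>x\<in>topspace X. matdet k (\<rho> u x) = 1)"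
proof
  assume "u \<in> commutators"
  then show "u \<in> path_comp \<and> (\<forall>x\<in>topspace X. matdet k (\<rho> u x) = 1)"
    using commutators_subset matdet_commutators by blast
next
  note b0 = unit_field_bvec[OF dim_pos]
  assume u: "u \<in> path_comp \<and> (\<forall>x\<in>topspace X. matdet k (\<rho> u x) = 1)"
  then obtain d \<theta> where d: "d \<in> commutators" "phase \<theta>" "u = d \<otimes> reflection (\<lambda>_. bvec 0) \<theta>"
    using U0_decomposition by blast
  have dA: "d \<in> carrier A" using d(1) commutators_subset path_comp_unitary unitary_carrier by blast
  have "cis (\<theta> x) = 1" if x: "x \<in> topspace X" for x
    using u d(1,2) x dA unfolding d(3)
    by (simp add: matdet_mult rho_reflection[OF b0] matdet_reflection matdet_commutators)
  then have "reflection (\<lambda>_. bvec 0) \<theta> = \<one>"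
    using d(2) by (intro reflection_eqI[symmetric] rho_inj) (auto simp: rho_reflection[OF b0] one_closed hrefl_one rho_one)
  then show "u \<in> commutators" using d dA by (simp add: one_mult)
qed

text \<open>Openness of U_0 with an explicit radius. One factor k is lost in
  \<open>near_quotient\<close> and k * k in \<open>accretive_near_id\<close>, which leaves
  1/2.\<close>

lemma near_U0:
  assumes "u \<in> path_comp" "v \<in> carrier (unitary_group A)" "near (1 / (2 * real k * real k * real k)) v u"
  shows "v \<in> path_comp"
proof -
  let ?r = "1 / (2 * real k * real k * real k)"
  let ?w = "v \<otimes> inv\<^bsub>unitary_group A\<^esub> u"
  have u: "u \<in> carrier (unitary_group A)" by (rule path_comp_unitary[OF assms(1)])
  have w: "?w \<in> carrier (unitary_group A)" using u assms(2) by (simp add: UG.m_closed UG.inv_closed)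
  have "near (real k * ?r) ?w \<one>" by (rule near_quotient[OF u assms(2,3)]) simp
  then have acc: "accretive k (\<rho> ?w x)" if "x \<in> topspace X" for x
    using that dim_pos by (intro accretive_near_id[of k _ "real k * ?r"]) (auto simp: rho_one)
  have "?w \<in> path_comp"
  proof (rule accretive_generated[OF path_comp_subgroup _ _ w acc])
    fix p j assume "unit_field p" "j < k" "\<And>x. x \<in> topspace X \<Longrightarrow> \<exists>r>0. p x j = complex_of_real r"
    then show "pi_reflection p \<otimes> pi_reflection (\<lambda>_. bvec j) \<in> path_comp"
      by (rule subsetD[OF commutators_subset turn_in_commutators])
  next
    fix j \<theta> assume "j < k" "phase \<theta>"
    then show "reflection (\<lambda>_. bvec j) \<theta> \<in> path_comp"
      by (intro reflection_path_comp unit_field_bvec)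
  qed
  then have "?w \<otimes> u \<in> path_comp" using assms(1) by (rule path_comp_closed)
  then show ?thesis using u assms(2) by (simp add: UG.m_assoc UG.l_inv UG.inv_closed unitary_carrier one_mult)
qed

text \<open>The closure adds nothing. A norm limit of commutator products is unitary and has
  determinant 1 by entrywise convergence, and it lies in U_0 because it is close to a member of U_0;
  \<open>mem_commutators_iff\<close> then applies.\<close>

lemma CU_eq: "CU A = commutators"
proof -
  have "commutators \<subseteq> carrier A"
    using commutators_subset path_comp_unitary unitary_carrier by blast
  moreover have "v \<in> commutators" if v: "v \<in> Abstract_Topology.closure_of mtopology commutators" for v
  proof -
    have vA: "v \<in> carrier A" and ex: "\<And>r. 0 < r \<Longrightarrow> \<exists>w\<in>commutators. w \<in> mball v r"
      using v by (auto simp: metric_closure_of)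
    have "\<exists>w\<in>commutators. nrm_dist A v w < 1 / real (Suc n)" for n
      using ex[of "1 / real (Suc n)"] by auto
    then obtain w where w: "\<And>n. w n \<in> commutators" "\<And>n. nrm_dist A v (w n) < 1 / real (Suc n)"
      by metis
    have wU: "w n \<in> path_comp" "w n \<in> carrier (unitary_group A)" "w n \<in> carrier A" for n
      using w(1)[of n] commutators_subset path_comp_unitary unitary_carrier by blast+
    have nearw: "near (1 / real (Suc n)) v (w n)" for n
      using rho_le_dist[OF vA wU(3)] w(2)[of n] by (meson less_imp_le order_trans)
    have lim: "(\<lambda>n. \<rho> (w n) x i j) \<longlonglongrightarrow> \<rho> v x i j" if "x \<in> topspace X" "i < k" "j < k" for x i j
    proof (rule LIM_zero_cancel, rule Lim_null_comparison)
      show "\<forall>\<^sub>F n in sequentially. cmod (\<rho> (w n) x i j - \<rho> v x i j) \<le> 1 / real (Suc n)"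
        using nearw that by (simp add: norm_minus_commute)
      show "(\<lambda>n. 1 / real (Suc n)) \<longlonglongrightarrow> 0" by (rule LIMSEQ_Suc[OF lim_1_over_n])
    qed
    have "unitary k (\<rho> v x)" if x: "x \<in> topspace X" for x
      unfolding unitary_def
    proof (intro allI impI)
      fix i j assume ij: "i < k" "j < k"
      have un: "mm k (adj (\<rho> (w n) x)) (\<rho> (w n) x) i j = id_mat i j \<and> mm k (\<rho> (w n) x) (adj (\<rho> (w n) x)) i j = id_mat i j" for n
        using unitary_rho[OF wU(2) x, of n] ij by (simp add: unitary_def)
      have "(\<lambda>n. mm k (adj (\<rho> (w n) x)) (\<rho> (w n) x) i j) \<longlonglongrightarrow> mm k (adj (\<rho> v x)) (\<rho> v x) i j"
        "(\<lambda>n. mm k (\<rho> (w n) x) (adj (\<rho> (w n) x)) i j) \<longlonglongrightarrow> mm k (\<rho> v x) (adj (\<rho> v x)) i j"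
        using x ij unfolding mm_def adj_def by (auto intro!: tendsto_intros lim)
      then show "mm k (adj (\<rho> v x)) (\<rho> v x) i j = id_mat i j \<and> mm k (\<rho> v x) (adj (\<rho> v x)) i j = id_mat i j"
        using un by (simp add: LIMSEQ_const_iff)
    qed
    then have vU: "v \<in> carrier (unitary_group A)" using vA by (simp add: unitary_group_iff)
    have "matdet k (\<rho> v x) = 1" if x: "x \<in> topspace X" for x
    proof -
      have "(\<lambda>n. matdet k (\<rho> (w n) x)) \<longlonglongrightarrow> matdet k (\<rho> v x)"
        by (rule tendsto_matdet) (rule lim[OF x])
      then show ?thesis using matdet_commutators[OF w(1) x] by (simp add: LIMSEQ_const_iff)
    qed
    moreover have "v \<in> path_comp"
    proof -
      have "0 < 1 / (2 * real k * real k * real k)" using dim_pos by simp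
      then obtain n where n: "1 / real (Suc n) < 1 / (2 * real k * real k * real k)"
        using nat_approx_posE by (metis One_nat_def of_nat_1)
      then have "near (1 / (2 * real k * real k * real k)) v (w n)"
        using nearw[of n] by (meson less_imp_le order_trans)
      then show ?thesis using near_U0[OF wU(1) vU] by blast
    qed
    ultimately show ?thesis by (simp add: mem_commutators_iff)
  qed
  ultimately show ?thesis
    unfolding CU_def derived_U0 norm_topology_def
    by (intro equalityI closure_of_subset) auto
qed

end

section \<open>Enlarging matrices\<close>

definition pad :: "nat \<Rightarrow> (nat \<Rightarrow> nat \<Rightarrow> complex) \<Rightarrow> nat \<Rightarrow> nat \<Rightarrow> complex" where
  "pad k M i j = (if i < k \<and> j < k then M i j else id_mat i j)"

lemma mm_pad:
  assumes "k \<le> m" "i < m" "j < m"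
  shows "mm m (pad k M) (pad k N) i j = pad k (mm k M N) i j"
proof (cases "i < k \<and> j < k")
  case True
  have "mm m (pad k M) (pad k N) i j = (\<Sum>l<k. pad k M i l * pad k N l j)"
    unfolding mm_def using assms(1) True
    by (intro sum.mono_neutral_right) (auto simp: pad_def id_mat_def)
  also have "\<dots> = mm k M N i j"
    unfolding mm_def using True by (intro sum.cong) (auto simp: pad_def)
  finally show ?thesis using True by (simp add: pad_def)
next
  case False
  have "pad k M i l * pad k N l j = (if l = i then pad k N i j else 0)" if "\<not> i < k" for l
    using that by (simp add: pad_def id_mat_def)
  moreover have "pad k M i l * pad k N l j = (if l = j then pad k M i j else 0)" if "\<not> j < k" for l
    using that by (simp add: pad_def id_mat_def)
  ultimately show ?thesis
    using False assms(2,3) unfolding mm_def by (auto simp: pad_def)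
qed

lemma adj_pad: "adj (pad k M) = pad k (adj M)"
  by (auto simp: adj_def pad_def id_mat_def fun_eq_iff)

lemma unitary_pad:
  assumes "k \<le> m" "unitary k M"
  shows "unitary m (pad k M)"
  using assms by (auto simp: unitary_def adj_pad mm_pad) (auto simp: pad_def)

lemma unitary_cong:
  assumes "\<And>i j. \<lbrakk>i < k; j < k\<rbrakk> \<Longrightarrow> M i j = N i j"
  shows "unitary k M \<longleftrightarrow> unitary k N"
proof -
  have "mm k (adj M) M i j = mm k (adj N) N i j" "mm k M (adj M) i j = mm k N (adj N) i j" if "i < k" "j < k" for i j
    by (rule mm_cong[OF _ _ that]; simp add: adj_def assms)+
  then show ?thesis by (simp add: unitary_def)
qed

lemma pad_hrefl_bvec: "0 < k \<Longrightarrow> pad k (hrefl (bvec 0) z) i j = hrefl (bvec 0) z i j"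
  by (auto simp: pad_def hrefl_def bvec_def id_mat_def)

text \<open>The map u |-> diag(u, 1) seen pointwise on scalar matrices, so that the block structure
  of \<open>diag_embed\<close> is unfolded only once, when the locale is instantiated.\<close>

locale matrix_functions_inclusion =
  B: matrix_functions B X k \<rho> + C: matrix_functions C X m \<sigma>
  for B :: "'a cstar" and X :: "'x topology" and k \<rho> and C :: "'b cstar" and m \<sigma> +
  fixes \<phi> :: "'a \<Rightarrow> 'b"
  assumes dim_le: "k \<le> m"
    and phi_closed: "a \<in> carrier B \<Longrightarrow> \<phi> a \<in> carrier C"
    and rho_phi: "\<lbrakk>a \<in> carrier B; x \<in> topspace X; i < m; j < m\<rbrakk> \<Longrightarrow> \<sigma> (\<phi> a) x i j = pad k (\<rho> a x) i j"
begin

lemma phi_mult: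
  assumes a: "a \<in> carrier B" and b: "b \<in> carrier B"
  shows "\<phi> (a \<otimes>\<^bsub>B\<^esub> b) = \<phi> a \<otimes>\<^bsub>C\<^esub> \<phi> b"
proof (rule C.rho_inj)
  fix x i j assume x: "x \<in> topspace X" "i < m" "j < m"
  have "\<sigma> (\<phi> (a \<otimes>\<^bsub>B\<^esub> b)) x i j = pad k (mm k (\<rho> a x) (\<rho> b x)) i j"
    using x by (simp add: rho_phi B.mult_closed a b) (simp add: pad_def B.rho_mult a b)
  also have "\<dots> = mm m (pad k (\<rho> a x)) (pad k (\<rho> b x)) i j"
    by (rule mm_pad[OF dim_le x(2,3), symmetric])
  also have "\<dots> = mm m (\<sigma> (\<phi> a) x) (\<sigma> (\<phi> b) x) i j"
    by (rule mm_cong[OF _ _ x(2,3)]) (simp_all add: rho_phi a b x)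
  finally show "\<sigma> (\<phi> (a \<otimes>\<^bsub>B\<^esub> b)) x i j = \<sigma> (\<phi> a \<otimes>\<^bsub>C\<^esub> \<phi> b) x i j"
    using x by (simp add: C.rho_mult phi_closed a b)
qed (simp_all add: a b phi_closed B.mult_closed C.mult_closed)

lemma phi_one: "\<phi> \<one>\<^bsub>B\<^esub> = \<one>\<^bsub>C\<^esub>"
  by (rule C.rho_inj)
    (auto simp: phi_closed B.one_closed C.one_closed rho_phi C.rho_one pad_def B.rho_one)

lemma phi_unitary:
  assumes "u \<in> carrier (unitary_group B)"
  shows "\<phi> u \<in> carrier (unitary_group C)"
proof -
  have u: "u \<in> carrier B" using assms by (rule B.unitary_carrier)
  have "unitary m (\<sigma> (\<phi> u) x)" if x: "x \<in> topspace X" for x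
    using unitary_cong[of m "\<sigma> (\<phi> u) x" "pad k (\<rho> u x)"] unitary_pad[OF dim_le B.unitary_rho[OF assms x]]
    by (simp add: rho_phi u x)
  then show ?thesis by (simp add: C.unitary_group_iff phi_closed u)
qed

lemma phi_path_comp:
  assumes "u \<in> B.path_comp"
  shows "\<phi> u \<in> C.path_comp"
proof -
  obtain \<gamma> L where \<gamma>: "B.lipschitz_path \<gamma> L" "\<gamma> 0 = \<one>\<^bsub>B\<^esub>" "\<gamma> 1 = u"
    using assms by (auto simp: B.path_comp_def)
  have "C.near (L * \<bar>s - t\<bar>) (\<phi> (\<gamma> s)) (\<phi> (\<gamma> t))" if st: "s \<in> {0..1}" "t \<in> {0..1}" for s t
  proof (intro ballI allI impI)
    fix x i j assume x: "x \<in> topspace X" "i < m" "j < m"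
    have c: "\<gamma> s \<in> carrier B" "\<gamma> t \<in> carrier B" and L: "0 \<le> L"
      using \<gamma>(1) st by (auto simp: B.lipschitz_path_def B.unitary_carrier)
    \<comment> \<open>Outside the k x k corner both entries come from the identity and their
      difference is 0, so the Lipschitz constant is unchanged.\<close>
    show "cmod (\<sigma> (\<phi> (\<gamma> s)) x i j - \<sigma> (\<phi> (\<gamma> t)) x i j) \<le> L * \<bar>s - t\<bar>"
      using \<gamma>(1) st x c L by (auto simp: rho_phi pad_def B.lipschitz_path_def)
  qed
  then have "C.lipschitz_path (\<lambda>t. \<phi> (\<gamma> t)) L"
    using \<gamma>(1) by (simp add: B.lipschitz_path_def C.lipschitz_path_def phi_unitary)
  then show ?thesis unfolding C.path_comp_def
    using \<gamma> phi_one by (intro CollectI exI[of _ "\<lambda>t. \<phi> (\<gamma> t)"] exI[of _ L]) simp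
qed

lemma phi_reflection:
  assumes "B.phase \<theta>"
  shows "\<phi> (B.reflection (\<lambda>_. bvec 0) \<theta>) = C.reflection (\<lambda>_. bvec 0) \<theta>"
proof (rule C.reflection_eqI)
  show "C.phase \<theta>" using assms by (simp add: B.phase_def C.phase_def)
  note b0 = B.unit_field_bvec[OF B.dim_pos]
  show "\<phi> (B.reflection (\<lambda>_. bvec 0) \<theta>) \<in> carrier C"
    by (intro phi_closed B.rho_reflection b0 assms)
  fix x i j assume x: "x \<in> topspace X" "i < m" "j < m"
  have "\<sigma> (\<phi> (B.reflection (\<lambda>_. bvec 0) \<theta>)) x i j = pad k (hrefl (bvec 0) (cis (\<theta> x))) i j"
    using x by (simp add: rho_phi B.rho_reflection b0 assms) (simp add: pad_def B.rho_reflection b0 assms)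
  then show "\<sigma> (\<phi> (B.reflection (\<lambda>_. bvec 0) \<theta>)) x i j = hrefl (bvec 0) (cis (\<theta> x)) i j"
    by (simp add: pad_hrefl_bvec B.dim_pos)
qed (rule C.unit_field_bvec[OF C.dim_pos])

lemma phi_inv:
  assumes "u \<in> carrier (unitary_group B)"
  shows "\<phi> (inv\<^bsub>unitary_group B\<^esub> u) = inv\<^bsub>unitary_group C\<^esub> (\<phi> u)"
proof (rule C.UG.inv_equality[symmetric])
  show "\<phi> (inv\<^bsub>unitary_group B\<^esub> u) \<otimes>\<^bsub>C\<^esub> \<phi> u = \<one>\<^bsub>C\<^esub>"
    using assms by (simp add: phi_mult[symmetric] B.unitary_carrier B.UG.inv_closed B.UG.l_inv phi_one)
qed (simp_all add: phi_unitary B.UG.inv_closed assms)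

text \<open>No block determinant is expanded. In the decomposition of u, the commutator part is
  mapped to commutators and has determinant 1 in both sizes, while the phase along e_0 is mapped to
  the phase along e_0 with the same \<theta>.\<close>

lemma matdet_phi:
  assumes "u \<in> B.path_comp" "x \<in> topspace X"
  shows "matdet m (\<sigma> (\<phi> u) x) = matdet k (\<rho> u x)"
proof -
  obtain d \<theta> where d: "d \<in> B.commutators" "B.phase \<theta>" "u = d \<otimes>\<^bsub>B\<^esub> B.reflection (\<lambda>_. bvec 0) \<theta>"
    using B.U0_decomposition[OF assms(1)] by blast
  have dU: "d \<in> carrier (unitary_group B)" and dB: "d \<in> carrier B"
    using d(1) B.commutators_subset B.path_comp_unitary B.unitary_carrier by blast+
  have th: "C.phase \<theta>" using d(2) by (simp add: B.phase_def C.phase_def)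
  have "\<phi> d \<in> C.commutators"
  proof -
    define K where "K = {v \<in> carrier (unitary_group B). \<phi> v \<in> C.commutators}"
    have "subgroup K (unitary_group B)"
    proof (rule B.UG.subgroupI)
      show "K \<noteq> {}" using C.commutators_closed(3) B.UG.one_closed phi_one by (auto simp: K_def)
      fix v w assume "v \<in> K"
      then show "inv\<^bsub>unitary_group B\<^esub> v \<in> K"
        by (simp add: K_def B.UG.inv_closed phi_inv C.commutators_closed)
      assume "w \<in> K"
      then show "v \<otimes>\<^bsub>B\<^esub> w \<in> K" using \<open>v \<in> K\<close>
        by (simp add: K_def B.UG.m_closed phi_mult B.unitary_carrier C.commutators_closed)
    qed (auto simp: K_def)
    moreover have "derived_set (unitary_group B) B.path_comp \<subseteq> K"
      unfolding unitary_group_simps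
    proof clarify
      fix v w assume vw: "v \<in> B.path_comp" "w \<in> B.path_comp"
      then have "v \<in> carrier (unitary_group B)" "w \<in> carrier (unitary_group B)" by (simp_all add: B.path_comp_unitary)
      then show "v \<otimes>\<^bsub>B\<^esub> w \<otimes>\<^bsub>B\<^esub> inv\<^bsub>unitary_group B\<^esub> v \<otimes>\<^bsub>B\<^esub> inv\<^bsub>unitary_group B\<^esub> w \<in> K"
        using C.commutatorI[OF phi_path_comp[OF vw(1)] phi_path_comp[OF vw(2)]]
        by (simp add: K_def B.UG.m_closed B.UG.inv_closed phi_mult phi_inv B.unitary_carrier B.mult_closed)
    qed
    ultimately have "B.commutators \<subseteq> K"
      unfolding B.commutators_def derived_def by (intro B.UG.generate_subgroup_incl)
    then show ?thesis using d(1) by (auto simp: K_def)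
  qed
  then show ?thesis
    using assms(2) d dB th C.commutators_subset C.path_comp_unitary C.unitary_carrier
    by (simp add: phi_mult phi_closed B.rho_reflection B.unit_field_bvec B.dim_pos B.matdet_mult C.matdet_mult
        phi_reflection C.rho_reflection C.unit_field_bvec C.dim_pos B.matdet_reflection C.matdet_reflection
        B.matdet_commutators C.matdet_commutators)
qed

lemma phi_commutators_iff:
  assumes "u \<in> B.path_comp"
  shows "\<phi> u \<in> C.commutators \<longleftrightarrow> u \<in> B.commutators"
  using assms by (simp add: B.mem_commutators_iff C.mem_commutators_iff matdet_phi phi_path_comp)

text \<open>The first isomorphism theorem for u |-> class of \<phi> u. Its kernel consists of the u
  in U_0 whose image has determinant 1, and the determinant is the same in both sizes. The
  \<open>the_elem\<close> form is that of \<open>induced_map\<close>.\<close>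

theorem coset_iso:
  "(\<lambda>K. the_elem ((\<lambda>u. CU C #>\<^bsub>U0 C\<^esub> \<phi> u) ` K)) \<in> iso (U0 B Mod CU B) (U0 C Mod CU C)"
proof -
  interpret N: normal C.commutators "U0 C" by (rule C.commutators_normal)
  interpret Q: group "U0 C Mod C.commutators" by (rule N.factorgroup_is_group)
  interpret U: group "U0 B" by (rule B.group_U0)
  let ?h = "\<lambda>u. C.commutators #>\<^bsub>U0 C\<^esub> \<phi> u"
  have cB: "carrier (U0 B) = B.path_comp" and cC: "carrier (U0 C) = C.path_comp"
    by (simp_all add: B.U0_eq_path_comp C.U0_eq_path_comp)
  interpret h: group_hom "U0 B" "U0 C Mod C.commutators" ?h
  proof
    show "?h \<in> hom (U0 B) (U0 C Mod C.commutators)"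
    proof (rule homI)
      fix u v assume uv: "u \<in> carrier (U0 B)" "v \<in> carrier (U0 B)"
      then show "?h u \<in> carrier (U0 C Mod C.commutators)"
        using phi_path_comp by (auto simp: FactGroup_def RCOSETS_def cB cC)
      have "\<phi> (u \<otimes>\<^bsub>U0 B\<^esub> v) = \<phi> u \<otimes>\<^bsub>U0 C\<^esub> \<phi> v"
        using uv by (simp add: B.U0_mult C.U0_mult phi_mult cB B.unitary_carrier B.path_comp_unitary)
      then show "?h (u \<otimes>\<^bsub>U0 B\<^esub> v) = ?h u \<otimes>\<^bsub>U0 C Mod C.commutators\<^esub> ?h v"
        using uv phi_path_comp by (simp add: N.rcos_sum cB cC)
    qed
  qed
  have "?h ` carrier (U0 B) = carrier (U0 C Mod C.commutators)"
  proof
    show "?h ` carrier (U0 B) \<subseteq> carrier (U0 C Mod C.commutators)" using h.hom_closed by blast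
    show "carrier (U0 C Mod C.commutators) \<subseteq> ?h ` carrier (U0 B)"
    proof
      fix K assume "K \<in> carrier (U0 C Mod C.commutators)"
      then obtain w where w: "w \<in> C.path_comp" "K = C.commutators #>\<^bsub>U0 C\<^esub> w"
        by (auto simp: FactGroup_def RCOSETS_def cC)
      obtain d \<theta> where d: "d \<in> C.commutators" "C.phase \<theta>" "w = d \<otimes>\<^bsub>C\<^esub> C.reflection (\<lambda>_. bvec 0) \<theta>"
        using C.U0_decomposition[OF w(1)] by blast
      have th: "B.phase \<theta>" using d(2) by (simp add: B.phase_def C.phase_def)
      let ?q = "B.reflection (\<lambda>_. bvec 0) \<theta>"
      have q: "?q \<in> B.path_comp"
        by (intro B.reflection_path_comp B.unit_field_bvec B.dim_pos th)
      \<comment> \<open>The phase factor of w along e_0 is the image under \<phi> of the phase with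
        the same \<theta> in the small algebra; the commutator factor is absorbed by the
        coset.\<close>
      have "w \<in> C.commutators #>\<^bsub>U0 C\<^esub> \<phi> ?q"
        using d by (auto simp: r_coset_def C.U0_mult phi_reflection[OF th])
      then have "K = ?h ?q"
        unfolding w(2) using phi_path_comp[OF q]
        by (intro N.repr_independence[symmetric]) (simp_all add: cC N.subgroup_axioms)
      then show "K \<in> ?h ` carrier (U0 B)" using q cB by blast
    qed
  qed
  then have "(\<lambda>K. the_elem (?h ` K)) \<in> iso (U0 B Mod kernel (U0 B) (U0 C Mod C.commutators) ?h) (U0 C Mod C.commutators)"
    by (rule h.FactGroup_iso_set)
  also have "kernel (U0 B) (U0 C Mod C.commutators) ?h = B.commutators"
  proof -
    have "?h u = C.commutators \<longleftrightarrow> \<phi> u \<in> C.commutators" if "u \<in> B.path_comp" for u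
      using N.coset_join1[OF _ _ N.subgroup_axioms] N.coset_join2[OF _ N.subgroup_axioms] phi_path_comp[OF that] cC
      by blast
    then show ?thesis
      using phi_commutators_iff B.commutators_subset
      by (auto simp: kernel_def cB)
  qed
  finally show ?thesis by (simp add: B.CU_eq C.CU_eq)
qed

end

lemma matrix_functions_inclusion_diag_embed:
  assumes "matrix_functions B X k \<rho>" "0 < l" "l \<le> n"
  shows "matrix_functions_inclusion (mat_alg l B) X (l * k) (block_fun k \<rho>)
    (mat_alg n B) (n * k) (block_fun k \<rho>) (diag_embed B l n)"
proof -
  interpret B: matrix_functions B X k \<rho> by fact
  show ?thesis
  proof (intro matrix_functions_inclusion.intro matrix_functions_inclusion_axioms.intro)
    show "matrix_functions (mat_alg l B) X (l * k) (block_fun k \<rho>)"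
      "matrix_functions (mat_alg n B) X (n * k) (block_fun k \<rho>)"
      using assms by (auto intro: B.matrix_functions_mat_alg)
    show "l * k \<le> n * k" using assms by simp
    fix a assume a: "a \<in> carrier (mat_alg l B)"
    then show "diag_embed B l n a \<in> carrier (mat_alg n B)"
      using B.mat_alg_index[OF a] B.one_closed B.zero_closed by (auto simp: diag_embed_def mat_alg_simps)
    fix x i j assume x: "x \<in> topspace X" "i < n * k" "j < n * k"
    \<comment> \<open>Lying in the corner of scalar size l * k is the same as lying in one of the
      first l blocks.\<close>
    have "i < l * k \<longleftrightarrow> i div k < l" for i by (simp add: div_less_iff_less_mult B.dim_pos)
    moreover have "i = j \<longleftrightarrow> i div k = j div k \<and> i mod k = j mod k" by (metis div_mult_mod_eq)
    ultimately show "block_fun k \<rho> (diag_embed B l n a) x i j = pad (l * k) (block_fun k \<rho> a x) i j"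
      using x div_less_mod_less[OF x(2)] div_less_mod_less[OF x(3)]
      by (auto simp: block_fun_def diag_embed_def pad_def B.rho_one B.rho_zero id_mat_def)
  qed
qed

theorem proposition3p7:
  fixes X :: "'x set" and d :: "'x \<Rightarrow> 'x \<Rightarrow> real" and n :: nat
  assumes "Metric_space X d"
    and "compact_space (Metric_space.mtopology X d)"
    and "1 \<le> n"
  shows "Dur (mat_alg n (cont_alg (Metric_space.mtopology X d))) = 1"
proof -
  let ?T = "Metric_space.mtopology X d"
  let ?B = "mat_alg n (cont_alg ?T)"
  let ?S = "{enat m | m. 1 \<le> m \<and> (\<forall>N>m. induced_map ?B m N \<in>
     iso (U0 (mat_alg m ?B) Mod CU (mat_alg m ?B)) (U0 (mat_alg N ?B) Mod CU (mat_alg N ?B)))}"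
  interpret C: matrix_functions "cont_alg ?T" ?T 1 "\<lambda>f x i j. f x"
    by (rule matrix_functions_cont_alg[OF assms(2)])
  have B: "matrix_functions ?B ?T (n * 1) (block_fun 1 (\<lambda>f x i j. f x))"
    using assms(3) by (intro C.matrix_functions_mat_alg) simp
  \<comment> \<open>M_1(B) is itself an instance of the locale, so it enters without being
    identified with B.\<close>
  have "induced_map ?B 1 N \<in> iso (U0 (mat_alg 1 ?B) Mod CU (mat_alg 1 ?B)) (U0 (mat_alg N ?B) Mod CU (mat_alg N ?B))"
    if "N > 1" for N
    using matrix_functions_inclusion.coset_iso[OF matrix_functions_inclusion_diag_embed[OF B, of 1 N]] that
    unfolding induced_map_def by simp
  then have "1 \<in> ?S" by (auto simp: one_enat_def)
  moreover have "1 \<le> m" if "m \<in> ?S" for m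
    using that by (auto simp: one_enat_def)
  ultimately have "Inf ?S = 1" by (intro Inf_eqI) auto
  then show ?thesis by (simp add: Dur_def)
qed

end
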